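(* Let $P_\bullet=(P_{n,\pm})_{n\ge 0}$ be a shaded planar algebra and let $\Phi: P_\bullet\to\overline{P}_\bullet$ be a shaded planar algebra isomorphism from $P_\bullet$ to its dual such that $\Phi_\mp\circ\Phi_\pm=\mathrm{id}_{P_\pm}$ (i.e. $(P_\bullet,\Phi)$ is a symmetrically self-dual shaded planar algebra). Then there is an unshaded planar algebra $Q_\bullet=(Q_n)_{n\ge 0}$ with $Q_{2n+1}=(0)$ for all $n\ge 0$ such that $P_\bullet$ is obtained from $Q_\bullet$ by re-shading, i.e. $P_\bullet$ is isomorphic as a shaded planar algebra to the re-shading of $Q_\bullet$.
   Context: Tangles. An (unshaded) planar tangle $T$ consists of an output disk $D_0(T)$, finitely many (ordered) disjoint input disks $D_1(T),\dots,D_t(T)$ in its interior, and a finite collection of disjoint smooth strings in the complement of the input disks, each string being either closed or having its endpoints at marked points on the boundaries of the disks. Every marked boundary point is an endpoint of exactly one string, and each disk has a distinguished boundary interval between consecutive marked points. Tangles are considered up to planar isotopy. If the output disk of $T'$ has the same number of boundary points as $D_i(T)$, the composite $T\circ_i T'$ is obtained by inserting $T'$ into $D_i(T)$, matching boundary points and distinguished intervals, and erasing the boundary of $D_i(T)$. A shaded planar tangle is a planar tangle in which every disk has an even number of boundary points and whose regions are checkerboard shaded (adjacent regions have opposite shading). A disk with $2n$ boundary points has type $(n,+)$ if its distinguished interval meets an unshaded region and type $(n,-)$ if it meets a shaded region. Composition of shaded tangles requires types to match. Planar algebras. An unshaded planar algebra $Q_\bullet$ is a sequence of complex vector spaces $(Q_n)_{n\ge0}$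 ($Q_n$ corresponds to boxes with $n$ boundary points) together with, for every unshaded tangle $T$ whose $i$-th disk has $k_i$ boundary points, a linear map $Z(T):\bigotimes_{i=1}^t Q_{k_i}\to Q_{k_0}$, such that $Z$ is isotopy invariant, compatible with composition, $Z(T\circ_i T')=Z(T)\circ_i Z(T')$, and identity (radial) tangles act as identity maps. A shaded planar algebra $P_\bullet$ is a family of complex vector spaces $(P_{n,\pm})_{n\ge0}$ ($P_{n,\pm}$ corresponds to boxes with $2n$ boundary points) together with, for every shaded tangle $S$ whose $i$-th disk has type $(n_i,\epsilon_i)$, a linear map $Z(S):\bigotimes_{i=1}^t P_{n_i,\epsilon_i}\to P_{n_0,\epsilon_0}$, with the analogous properties. An isomorphism of shaded planar algebras is a family of linear isomorphisms of the spaces intertwining the actions of all shaded tangles. Duality. For a shaded tangle $S$, $S^{\mathrm{op}}$ denotes the tangle obtained by reversing the shading. The dual $\overline{P}_\bullet$ of $P_\bullet$ is obtained by reversing the shading: $\overline{P}_{n,\pm}=P_{n,\mp}$, with $S$ acting as $Z(S^{\mathrm{op}})$. A shaded planar algebra isomorphism $\Phi:P_\bullet\to\overline{P}_\bullet$ is thus a family of linear isomorphisms $\Phi_\pm: P_{n,\pm}\to P_{n,\mp}$ $(n\ge0)$ with $\Phi\circ Z(S)=Z(S^{\mathrm{op}})\circ(\bigotimes\Phi)$ for every shaded tangle $S$. $P_\bullet$ is symmetrically self-dual if there is such a $\Phi$ with $\Phi^2=\mathrm{id}$, i.e. $\Phi_\mp\circ\Phi_\pm=\mathrm{id}_{P_\pm}$.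 Re-shading. Given an unshaded planar algebra $Q_\bullet$ with $Q_{2n+1}=(0)$ for all $n\ge 0$, its re-shading is the shaded planar algebra with both the $(n,+)$ and $(n,-)$ spaces equal to $Q_{2n}$, on which a shaded tangle $S$ acts by $Z$ of the unshaded tangle obtained from $S$ by forgetting the shading. *)

theory Defs
  imports "HOL-Analysis.Analysis"
begin

text \<open>\<open>D k\<close> is the k-th derivative, so the curve is of class \<open>C\<^sup>\<infinity>\<close> (and extends past its end
  points); it is regular on the unit interval.\<close>

definition smooth_path :: "(real \<Rightarrow> complex) \<Rightarrow> bool" where
  "smooth_path \<gamma> \<longleftrightarrow>
     (\<exists>D. D 0 = \<gamma> \<and>
          (\<forall>k t. (D k has_vector_derivative D (Suc k) t) (at t)) \<and>
          (\<forall>t\<in>{0..1}. D 1 t \<noteq> 0))"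

definition smooth_arc :: "complex set \<Rightarrow> complex \<Rightarrow> complex \<Rightarrow> bool" where
  "smooth_arc s a b \<longleftrightarrow>
     (\<exists>\<gamma>. smooth_path \<gamma> \<and> arc \<gamma> \<and> pathstart \<gamma> = a \<and> pathfinish \<gamma> = b \<and> path_image \<gamma> = s)"

definition smooth_circle :: "complex set \<Rightarrow> bool" where
  "smooth_circle s \<longleftrightarrow>
     (\<exists>\<gamma>. smooth_path \<gamma> \<and> (\<forall>t. \<gamma> (t + 1) = \<gamma> t) \<and> simple_path \<gamma> \<and> path_image \<gamma> = s)"

definition smooth_disk :: "complex set \<Rightarrow> bool" where
  "smooth_disk B \<longleftrightarrow> (\<exists>C. smooth_circle C \<and> B = C \<union> inside C)"

record marked_disk =
  body :: "complex set"
  marks :: "complex set"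
  base_interval :: "complex set"

text \<open>If there are no marked points, the distinguished interval is the whole boundary circle.\<close>

definition is_marked_disk :: "marked_disk \<Rightarrow> bool" where
  "is_marked_disk d \<longleftrightarrow>
     smooth_disk (body d) \<and> finite (marks d) \<and> marks d \<subseteq> frontier (body d) \<and>
     base_interval d \<in> components (frontier (body d) - marks d)"

record tangle =
  out :: marked_disk
  ins :: "marked_disk list"
  strings :: "complex set set"

definition disks :: "tangle \<Rightarrow> marked_disk set" where
  "disks T = insert (out T) (set (ins T))"

definition all_marks :: "tangle \<Rightarrow> complex set" where
  "all_marks T = (\<Union>d\<in>disks T. marks d)"

definition string_space :: "tangle \<Rightarrow> complex set" where
  "string_space T = interior (body (out T)) - (\<Union>d\<in>set (ins T). body d)"

definition is_tangle :: "tangle \<Rightarrow> bool" where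
  "is_tangle T \<longleftrightarrow>
     (\<forall>d\<in>disks T. is_marked_disk d) \<and>
     (\<forall>d\<in>set (ins T). body d \<subseteq> interior (body (out T))) \<and>
     (\<forall>i<length (ins T). \<forall>j<length (ins T). i \<noteq> j \<longrightarrow>
        disjnt (body (ins T ! i)) (body (ins T ! j))) \<and>
     finite (strings T) \<and> pairwise disjnt (strings T) \<and>
     (\<forall>s\<in>strings T.
        (smooth_circle s \<and> s \<subseteq> string_space T) \<or>
        (\<exists>a b. smooth_arc s a b \<and> a \<in> all_marks T \<and> b \<in> all_marks T \<and>
               s - {a, b} \<subseteq> string_space T)) \<and>
     (\<forall>m\<in>all_marks T. \<exists>!s. s \<in> strings T \<and> (\<exists>b. smooth_arc s m b))"

definition planar_isotopy :: "(real \<Rightarrow> complex \<Rightarrow> complex) \<Rightarrow> bool" where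
  "planar_isotopy H \<longleftrightarrow>
     continuous_on ({0..1} \<times> UNIV) (\<lambda>(t, z). H t z) \<and>
     (\<forall>t\<in>{0..1}. \<exists>g. homeomorphism UNIV UNIV (H t) g) \<and>
     H 0 = id"

definition move_disk :: "(complex \<Rightarrow> complex) \<Rightarrow> marked_disk \<Rightarrow> marked_disk" where
  "move_disk h d =
     \<lparr>body = h ` body d, marks = h ` marks d, base_interval = h ` base_interval d\<rparr>"

definition move :: "(complex \<Rightarrow> complex) \<Rightarrow> tangle \<Rightarrow> tangle" where
  "move h T =
     \<lparr>out = move_disk h (out T), ins = map (move_disk h) (ins T),
      strings = (`) h ` strings T\<rparr>"

definition isotopic :: "tangle \<Rightarrow> tangle \<Rightarrow> bool" where
  "isotopic T T' \<longleftrightarrow> (\<exists>H. planar_isotopy H \<and> T' = move (H 1) T)"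

text \<open>\<open>composite T i T' T''\<close>: the output disk of \<open>T'\<close> is literally the \<open>i\<close>-th input disk of \<open>T\<close>
  (including marked points and distinguished interval), and \<open>T''\<close> is the result of erasing its
  boundary.  Inserting a tangle whose output disk merely has the same number of marked points is
  covered because the action is invariant under isotopy: the two tangles can first be moved so that
  they match, and meet smoothly, along the common circle.  The strings of \<open>T''\<close> are determined by
  their union, being its connected components.\<close>

definition composite :: "tangle \<Rightarrow> nat \<Rightarrow> tangle \<Rightarrow> tangle \<Rightarrow> bool" where
  "composite T i T' T'' \<longleftrightarrow>
     i < length (ins T) \<and> out T' = ins T ! i \<and>
     out T'' = out T \<and> ins T'' = take i (ins T) @ ins T' @ drop (Suc i) (ins T) \<and>
     \<Union> (strings T'') = \<Union> (strings T) \<union> \<Union> (strings T')"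

definition round_disk :: "nat \<Rightarrow> real \<Rightarrow> marked_disk" where
  "round_disk n r =
     \<lparr>body = cball 0 r,
      marks = (\<lambda>k. of_real r * cis (2 * pi * real k / real n)) ` {..<n},
      base_interval =
        (if n = 0 then sphere 0 r
         else (\<lambda>t. of_real r * cis (2 * pi * t / real n)) ` {0<..<1})\<rparr>"

definition radial_tangle :: "nat \<Rightarrow> tangle" where
  "radial_tangle n =
     \<lparr>out = round_disk n 2, ins = [round_disk n 1],
      strings = (\<lambda>k. closed_segment (cis (2 * pi * real k / real n))
                                    (2 * cis (2 * pi * real k / real n))) ` {..<n}\<rparr>"

datatype sign = Plus | Minus

fun flip :: "sign \<Rightarrow> sign" where
  "flip Plus = Minus"
| "flip Minus = Plus"

text \<open>The regions contain the boundary intervals of the disks that they border.\<close>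

definition region_space :: "tangle \<Rightarrow> complex set" where
  "region_space T = body (out T) - (\<Union>d\<in>set (ins T). interior (body d)) - \<Union> (strings T)"

definition regions :: "tangle \<Rightarrow> complex set set" where
  "regions T = components (region_space T)"

definition adjacent :: "tangle \<Rightarrow> complex set \<Rightarrow> complex set \<Rightarrow> bool" where
  "adjacent T R R' \<longleftrightarrow> R \<noteq> R' \<and> (\<exists>s\<in>strings T. s \<subseteq> closure R \<inter> closure R')"

text \<open>\<open>shade S\<close> is the union of the shaded regions.\<close>

record shaded_tangle =
  tangle_of :: tangle
  shade :: "complex set"

definition is_shaded_tangle :: "shaded_tangle \<Rightarrow> bool" where
  "is_shaded_tangle S \<longleftrightarrow>
     is_tangle (tangle_of S) \<and>
     (\<forall>d\<in>disks (tangle_of S). even (card (marks d))) \<and>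
     shade S \<subseteq> region_space (tangle_of S) \<and>
     (\<forall>R\<in>regions (tangle_of S). R \<subseteq> shade S \<or> disjnt R (shade S)) \<and>
     (\<forall>R\<in>regions (tangle_of S). \<forall>R'\<in>regions (tangle_of S).
        adjacent (tangle_of S) R R' \<longrightarrow> (R \<subseteq> shade S \<longleftrightarrow> \<not> R' \<subseteq> shade S))"

text \<open>The distinguished interval is connected, hence contained in a single region.\<close>

definition disk_type :: "shaded_tangle \<Rightarrow> marked_disk \<Rightarrow> nat \<times> sign" where
  "disk_type S d =
     (card (marks d) div 2, if disjnt (base_interval d) (shade S) then Plus else Minus)"

definition reverse_shading :: "shaded_tangle \<Rightarrow> shaded_tangle" where
  "reverse_shading S = S\<lparr>shade := region_space (tangle_of S) - shade S\<rparr>"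

definition shaded_isotopic :: "shaded_tangle \<Rightarrow> shaded_tangle \<Rightarrow> bool" where
  "shaded_isotopic S S' \<longleftrightarrow>
     (\<exists>H. planar_isotopy H \<and> tangle_of S' = move (H 1) (tangle_of S) \<and> shade S' = H 1 ` shade S)"

definition shaded_composite ::
    "shaded_tangle \<Rightarrow> nat \<Rightarrow> shaded_tangle \<Rightarrow> shaded_tangle \<Rightarrow> bool" where
  "shaded_composite S i S' S'' \<longleftrightarrow>
     composite (tangle_of S) i (tangle_of S') (tangle_of S'') \<and>
     disk_type S' (out (tangle_of S')) = disk_type S (ins (tangle_of S) ! i) \<and>
     shade S = shade S'' \<inter> region_space (tangle_of S) \<and>
     shade S' = shade S'' \<inter> region_space (tangle_of S')"

text \<open>The vector spaces of a planar algebra are subspaces of one complex vector space, the type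
  \<open>'a\<close> with scalar multiplication \<open>sc\<close>; every sequence of vector spaces arises in this way, inside
  its direct sum.  A linear map on a tensor product is given by the corresponding multilinear map on
  lists of vectors, whose values outside the given subspaces are irrelevant.\<close>

definition multilinear_on ::
    "(complex \<Rightarrow> 'a::ab_group_add \<Rightarrow> 'a) \<Rightarrow> 'a set list \<Rightarrow> 'a set \<Rightarrow> ('a list \<Rightarrow> 'a) \<Rightarrow> bool" where
  "multilinear_on sc Vs W f \<longleftrightarrow>
     (\<forall>vs\<in>listset Vs. f vs \<in> W) \<and>
     (\<forall>vs\<in>listset Vs. \<forall>i<length Vs. \<forall>x\<in>Vs ! i. \<forall>y\<in>Vs ! i.
        f (vs[i := x + y]) = f (vs[i := x]) + f (vs[i := y])) \<and>
     (\<forall>vs\<in>listset Vs. \<forall>i<length Vs. \<forall>x\<in>Vs ! i. \<forall>c.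
        f (vs[i := sc c x]) = sc c (f (vs[i := x])))"

definition linear_iso_on ::
    "(complex \<Rightarrow> 'a::ab_group_add \<Rightarrow> 'a) \<Rightarrow> 'a set \<Rightarrow> 'a set \<Rightarrow> ('a \<Rightarrow> 'a) \<Rightarrow> bool" where
  "linear_iso_on sc V W f \<longleftrightarrow>
     bij_betw f V W \<and>
     (\<forall>x\<in>V. \<forall>y\<in>V. f (x + y) = f x + f y) \<and>
     (\<forall>c. \<forall>x\<in>V. f (sc c x) = sc c (f x))"

record 'a unshaded_data =
  spaces :: "nat \<Rightarrow> 'a set"
  action :: "tangle \<Rightarrow> 'a list \<Rightarrow> 'a"

definition disk_space :: "'a unshaded_data \<Rightarrow> marked_disk \<Rightarrow> 'a set" where
  "disk_space Q d = spaces Q (card (marks d))"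

definition unshaded_planar_algebra ::
    "(complex \<Rightarrow> 'a::ab_group_add \<Rightarrow> 'a) \<Rightarrow> 'a unshaded_data \<Rightarrow> bool" where
  "unshaded_planar_algebra sc Q \<longleftrightarrow>
     vector_space sc \<and>
     (\<forall>n. module.subspace sc (spaces Q n)) \<and>
     (\<forall>T. is_tangle T \<longrightarrow>
        multilinear_on sc (map (disk_space Q) (ins T)) (disk_space Q (out T)) (action Q T)) \<and>
     (\<forall>T T'. is_tangle T \<and> is_tangle T' \<and> isotopic T T' \<longrightarrow>
        (\<forall>vs\<in>listset (map (disk_space Q) (ins T)). action Q T' vs = action Q T vs)) \<and>
     (\<forall>T i T' T''. is_tangle T \<and> is_tangle T' \<and> is_tangle T'' \<and> composite T i T' T'' \<longrightarrow>
        (\<forall>us vs ws. length us = i \<and> length vs = length (ins T') \<and>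
           us @ vs @ ws \<in> listset (map (disk_space Q) (ins T'')) \<longrightarrow>
           action Q T'' (us @ vs @ ws) = action Q T (us @ [action Q T' vs] @ ws))) \<and>
     (\<forall>n. \<forall>v\<in>spaces Q n. action Q (radial_tangle n) [v] = v)"

record 'a shaded_data =
  shaded_spaces :: "nat \<Rightarrow> sign \<Rightarrow> 'a set"
  shaded_action :: "shaded_tangle \<Rightarrow> 'a list \<Rightarrow> 'a"

definition shaded_disk_space ::
    "'a shaded_data \<Rightarrow> shaded_tangle \<Rightarrow> marked_disk \<Rightarrow> 'a set" where
  "shaded_disk_space P S d = case_prod (shaded_spaces P) (disk_type S d)"

definition input_spaces :: "'a shaded_data \<Rightarrow> shaded_tangle \<Rightarrow> 'a set list" where
  "input_spaces P S = map (shaded_disk_space P S) (ins (tangle_of S))"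

definition output_space :: "'a shaded_data \<Rightarrow> shaded_tangle \<Rightarrow> 'a set" where
  "output_space P S = shaded_disk_space P S (out (tangle_of S))"

definition shaded_planar_algebra ::
    "(complex \<Rightarrow> 'a::ab_group_add \<Rightarrow> 'a) \<Rightarrow> 'a shaded_data \<Rightarrow> bool" where
  "shaded_planar_algebra sc P \<longleftrightarrow>
     vector_space sc \<and>
     (\<forall>n \<epsilon>. module.subspace sc (shaded_spaces P n \<epsilon>)) \<and>
     (\<forall>S. is_shaded_tangle S \<longrightarrow>
        multilinear_on sc (input_spaces P S) (output_space P S) (shaded_action P S)) \<and>
     (\<forall>S S'. is_shaded_tangle S \<and> is_shaded_tangle S' \<and> shaded_isotopic S S' \<longrightarrow>
        (\<forall>vs\<in>listset (input_spaces P S). shaded_action P S' vs = shaded_action P S vs)) \<and>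
     (\<forall>S i S' S''. is_shaded_tangle S \<and> is_shaded_tangle S' \<and> is_shaded_tangle S'' \<and>
        shaded_composite S i S' S'' \<longrightarrow>
        (\<forall>us vs ws. length us = i \<and> length vs = length (ins (tangle_of S')) \<and>
           us @ vs @ ws \<in> listset (input_spaces P S'') \<longrightarrow>
           shaded_action P S'' (us @ vs @ ws) =
             shaded_action P S (us @ [shaded_action P S' vs] @ ws))) \<and>
     (\<forall>S n. is_shaded_tangle S \<and> tangle_of S = radial_tangle (2 * n) \<longrightarrow>
        (\<forall>v\<in>output_space P S. shaded_action P S [v] = v))"

definition shaded_iso ::
    "(complex \<Rightarrow> 'a::ab_group_add \<Rightarrow> 'a) \<Rightarrow> 'a shaded_data \<Rightarrow> 'a shaded_data \<Rightarrow>
     (nat \<Rightarrow> sign \<Rightarrow> 'a \<Rightarrow> 'a) \<Rightarrow> bool" where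
  "shaded_iso sc P P' \<Phi> \<longleftrightarrow>
     (\<forall>n \<epsilon>. linear_iso_on sc (shaded_spaces P n \<epsilon>) (shaded_spaces P' n \<epsilon>) (\<Phi> n \<epsilon>)) \<and>
     (\<forall>S. is_shaded_tangle S \<longrightarrow>
        (\<forall>vs\<in>listset (input_spaces P S).
           case_prod \<Phi> (disk_type S (out (tangle_of S))) (shaded_action P S vs) =
           shaded_action P' S
             (map2 (\<lambda>d v. case_prod \<Phi> (disk_type S d) v) (ins (tangle_of S)) vs)))"

definition dual :: "'a shaded_data \<Rightarrow> 'a shaded_data" where
  "dual P =
     \<lparr>shaded_spaces = (\<lambda>n \<epsilon>. shaded_spaces P n (flip \<epsilon>)),
      shaded_action = (\<lambda>S. shaded_action P (reverse_shading S))\<rparr>"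

definition symmetric_self_duality ::
    "(complex \<Rightarrow> 'a::ab_group_add \<Rightarrow> 'a) \<Rightarrow> 'a shaded_data \<Rightarrow> (nat \<Rightarrow> sign \<Rightarrow> 'a \<Rightarrow> 'a) \<Rightarrow> bool" where
  "symmetric_self_duality sc P \<Phi> \<longleftrightarrow>
     shaded_iso sc P (dual P) \<Phi> \<and>
     (\<forall>n \<epsilon>. \<forall>x\<in>shaded_spaces P n \<epsilon>. \<Phi> n (flip \<epsilon>) (\<Phi> n \<epsilon> x) = x)"

definition reshading :: "'a unshaded_data \<Rightarrow> 'a shaded_data" where
  "reshading Q =
     \<lparr>shaded_spaces = (\<lambda>n \<epsilon>. spaces Q (2 * n)),
      shaded_action = (\<lambda>S. action Q (tangle_of S))\<rparr>"

end

theory Submission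
  imports Defs "HOL-Complex_Analysis.Complex_Analysis"
begin

text \<open>
  The unshaded algebra \<open>Q\<close> has \<open>Q\<^bsub>2n\<^esub> = P\<^bsub>n,+\<^esub>\<close>, and zero in odd degrees.  A tangle
  \<open>T\<close> with an even number of marked points on each disk acts on \<open>Q\<close> as follows: choose a
  checkerboard shading of \<open>T\<close>, use \<open>\<Phi>\<close> to carry each input from \<open>P\<^bsub>n,+\<^esub>\<close> to the
  space that the shading prescribes for its disk, let \<open>P\<close> act, and use \<open>\<Phi>\<close> to bring the
  output back to \<open>P\<^bsub>n,+\<^esub>\<close>.  The two shadings of \<open>T\<close> are exchanged by reversal; since
  \<open>\<Phi>\<close> intertwines the actions of a shaded tangle and of its reversal and \<open>\<Phi>\<^sup>2 = id\<close>,
  both give the same map (\<open>transported_complement\<close>).  A tangle with an odd disk acts by zero.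
  The axioms for \<open>Q\<close> then follow from those for \<open>P\<close>: an isotopy carries a shading along, and
  a shading of a composite restricts to shadings of its two parts whose types match.  The isomorphism
  from \<open>P\<close> to the re-shading is the identity on \<open>P\<^bsub>n,+\<^esub>\<close> and \<open>\<Phi>\<close> on \<open>P\<^bsub>n,-\<^esub>\<close>.

  What needs work is the planar topology behind the word \<open>the two shadings\<close>.  The definition of a
  shading says that adjacent regions have opposite colours, which is vacuous where a string has one
  region on both sides.  The proof replaces it by a local condition (\<open>alternating\<close>): the colour
  is constant on connected sets, and both colours accumulate at each interior point of each string.
  This condition is inherited by the parts of a composite and by homeomorphic images, directly from its
  form.  It is shown to be equivalent to being a shading on tangles with even disks
  (\<open>shading_iff_alternating\<close>), and to determine the colouring up to reversal
  (\<open>alternating_unique\<close>).  The inputs are: a regular smooth curve locally has exactly two sides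
  (\<open>crosses_sides\<close>), and the part of the plane where the strings live is connected
  (\<open>connected_string_space\<close>).

  The existence of an alternating colouring (\<open>exists_alternating\<close>) comes from comparing two square
  roots of the polynomial \<open>\<Prod>(m - z)\<close> over all marked points \<open>m\<close>.  A path \<open>\<gamma>\<close> from \<open>a\<close>
  to \<open>b\<close> gives the continuous square root \<open>exp (\<pi> \<i> w(\<gamma>, z))\<close> of \<open>(b - z) / (a - z)\<close>
  off \<open>\<gamma>\<close>, where \<open>w\<close> is the winding number.  Since the strings pair up the marked points, they
  yield one root of the polynomial, and this root changes sign across each string, because the winding
  number jumps by one there (\<open>winding_number_jump\<close>).  Paths that run inside the input disks and
  outside the output disk, from a centre to the marked points, yield another root, which is continuous
  across the strings; it exists because the centre of each disk is used an even number of times.  The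
  quotient of the two roots has the values \<open>1\<close> and \<open>-1\<close> and changes sign exactly at the
  strings.
\<close>

section \<open>Local sides of smooth curves\<close>

text \<open>The curve passes through \<open>\<gamma> t0\<close> only once, and near that time it moves strictly forward in
  the direction \<open>\<nu>\<close>.  This is all that the local arguments below use of smoothness.\<close>
definition crosses :: "(real \<Rightarrow> complex) \<Rightarrow> real \<Rightarrow> complex \<Rightarrow> real \<Rightarrow> bool" where
  "crosses \<gamma> t0 \<nu> \<delta> \<longleftrightarrow>
     path \<gamma> \<and> \<nu> \<noteq> 0 \<and> 0 < \<delta> \<and> 0 < t0 - \<delta> \<and> t0 + \<delta> < 1 \<and>
     strict_mono_on {t0 - \<delta>..t0 + \<delta>} (\<lambda>t. Re (\<gamma> t / \<nu>)) \<and>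
     (\<forall>t\<in>{0..1}. \<gamma> t = \<gamma> t0 \<longrightarrow> t = t0)"

lemma smooth_path_continuous_on:
  assumes "smooth_path \<gamma>" shows "continuous_on S \<gamma>"
proof -
  from assms obtain D where "D 0 = \<gamma>" "\<And>k t. (D k has_vector_derivative D (Suc k) t) (at t)"
    unfolding smooth_path_def by blast
  then have "\<And>t. (\<gamma> has_vector_derivative D (Suc 0) t) (at t)" by metis
  then show ?thesis
    by (meson continuous_at_imp_continuous_on has_vector_derivative_continuous)
qed

lemma smooth_path_crosses:
  assumes "smooth_path \<gamma>" "0 < t0" "t0 < 1" "\<forall>t\<in>{0..1}. \<gamma> t = \<gamma> t0 \<longrightarrow> t = t0"
  obtains \<nu> \<delta> where "crosses \<gamma> t0 \<nu> \<delta>"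
proof -
  from assms(1) obtain D where D0: "D 0 = \<gamma>"
    and Dk: "\<And>k t. (D k has_vector_derivative D (Suc k) t) (at t)"
    and nz: "\<forall>t\<in>{0..1}. D 1 t \<noteq> 0"
    unfolding smooth_path_def by blast
  define \<nu> where "\<nu> = D 1 t0"
  have \<nu>: "\<nu> \<noteq> 0" using nz assms unfolding \<nu>_def by auto
  have der: "((\<lambda>t. Re (\<gamma> t / \<nu>)) has_real_derivative Re (D 1 t / \<nu>)) (at t)" for t
  proof -
    have "(\<gamma> has_vector_derivative D 1 t) (at t)" using Dk[of 0 t] D0 by simp
    then have "((\<lambda>t. \<gamma> t / \<nu>) has_vector_derivative D 1 t / \<nu>) (at t)"
      by (rule has_vector_derivative_divide)
    then have "((\<lambda>t. Re (\<gamma> t / \<nu>)) has_vector_derivative Re (D 1 t / \<nu>)) (at t)"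
      by (rule bounded_linear.has_vector_derivative[OF bounded_linear_Re])
    then show ?thesis by (simp add: has_real_derivative_iff_has_vector_derivative)
  qed
  have "continuous (at t0) (D 1)"
    using Dk[of 1 t0] has_vector_derivative_continuous by blast
  then have "continuous (at t0) (\<lambda>t. Re (D 1 t / \<nu>))" using \<nu> by (intro continuous_Re isCont_divide continuous_const) auto
  then have "((\<lambda>t. Re (D 1 t / \<nu>)) \<longlongrightarrow> 1) (at t0)"
    using \<nu> unfolding continuous_within by (simp add: \<nu>_def)
  then have "eventually (\<lambda>t. Re (D 1 t / \<nu>) > 0) (at t0)"
    by (rule order_tendstoD) simp
  then obtain d where d: "d > 0" "\<And>t. t \<noteq> t0 \<Longrightarrow> dist t t0 < d \<Longrightarrow> Re (D 1 t / \<nu>) > 0"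
    unfolding eventually_at by blast
  have d': "Re (D 1 t / \<nu>) > 0" if "dist t t0 < d" for t
    using d(2)[of t] that \<nu> by (cases "t = t0") (auto simp: \<nu>_def)
  define \<delta> where "\<delta> = Min {d, t0, 1 - t0} / 2"
  have \<delta>: "0 < \<delta>" "\<delta> < d" "\<delta> < t0" "\<delta> < 1 - t0" using d(1) assms unfolding \<delta>_def by (auto simp: min_def)
  have "strict_mono_on {t0 - \<delta>..t0 + \<delta>} (\<lambda>t. Re (\<gamma> t / \<nu>))"
  proof (rule strict_mono_onI)
    fix r s assume rs: "r \<in> {t0 - \<delta>..t0 + \<delta>}" "s \<in> {t0 - \<delta>..t0 + \<delta>}" "r < s"
    show "Re (\<gamma> r / \<nu>) < Re (\<gamma> s / \<nu>)"
    proof (rule DERIV_pos_imp_increasing[OF \<open>r < s\<close>])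
      fix x assume "r \<le> x" "x \<le> s"
      then have "dist x t0 < d" using rs \<delta> by (auto simp: dist_real_def)
      then show "\<exists>y. ((\<lambda>t. Re (\<gamma> t / \<nu>)) has_real_derivative y) (at x) \<and> 0 < y"
        using der d' by blast
    qed
  qed
  moreover have "path \<gamma>" unfolding path_def using smooth_path_continuous_on[OF assms(1)] .
  ultimately have "crosses \<gamma> t0 \<nu> \<delta>" using \<nu> \<delta> assms unfolding crosses_def by auto
  then show ?thesis by (rule that)
qed

lemma smooth_arc_crosses:
  assumes "smooth_arc s a b" "p \<in> s" "p \<noteq> a" "p \<noteq> b"
  obtains \<gamma> t0 \<nu> \<delta> where "crosses \<gamma> t0 \<nu> \<delta>" "\<gamma> t0 = p" "path_image \<gamma> = s"
proof -
  from assms(1) obtain \<gamma> where g: "smooth_path \<gamma>" "arc \<gamma>" "pathstart \<gamma> = a" "pathfinish \<gamma> = b" "path_image \<gamma> = s"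
    unfolding smooth_arc_def by blast
  from assms(2) g obtain t0 where t0: "t0 \<in> {0..1}" "\<gamma> t0 = p" unfolding path_image_def by auto
  have "t0 \<noteq> 0" "t0 \<noteq> 1" using t0 g assms unfolding pathstart_def pathfinish_def by auto
  then have "0 < t0" "t0 < 1" using t0 by auto
  moreover have "\<forall>t\<in>{0..1}. \<gamma> t = \<gamma> t0 \<longrightarrow> t = t0"
    using g(2) t0(1) unfolding arc_def inj_on_def by auto
  ultimately show ?thesis using smooth_path_crosses[OF g(1)] that t0 g(5) by metis
qed

lemma periodic_frac:
  fixes \<gamma> :: "real \<Rightarrow> complex"
  assumes "\<forall>t. \<gamma> (t + 1) = \<gamma> t" shows "\<gamma> (frac x) = \<gamma> x"
proof -
  interpret periodic_fun_simple' \<gamma> by unfold_locales (use assms in auto)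
  show ?thesis unfolding frac_def using minus_of_int by simp
qed

text \<open>The given parametrisation may start at \<open>p\<close>; shifting it moves \<open>p\<close> to the time \<open>1/2\<close>,
  so that closed curves can be treated like arcs.\<close>
lemma smooth_circle_crosses:
  assumes "smooth_circle s" "p \<in> s"
  obtains \<gamma> t0 \<nu> \<delta> where "crosses \<gamma> t0 \<nu> \<delta>" "\<gamma> t0 = p" "path_image \<gamma> = s"
proof -
  from assms(1) obtain \<gamma> where g: "smooth_path \<gamma>" "\<forall>t. \<gamma> (t + 1) = \<gamma> t" "simple_path \<gamma>" "path_image \<gamma> = s"
    unfolding smooth_circle_def by blast
  note fr = periodic_frac[OF g(2)]
  have frac01: "frac x \<in> {0..1}" for x :: real
    using frac_lt_1[of x] by (auto intro: less_imp_le)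
  have img: "\<gamma> x \<in> s" for x using fr[of x] frac01[of x] g(4) unfolding path_image_def by (metis imageI)
  from assms(2) g(4) obtain t1 where t1: "\<gamma> t1 = p" unfolding path_image_def by auto
  define t0 where "t0 = frac t1"
  have t0: "0 \<le> t0" "t0 < 1" "\<gamma> t0 = p" using t1 fr frac_lt_1 by (auto simp: t0_def)
  define \<eta> where "\<eta> = (\<lambda>t. \<gamma> (t + (t0 - 1/2)))"
  have "\<eta> (t + 1) = \<eta> t" for t
    using g(2)[rule_format, of "t + (t0 - 1/2)"] by (simp add: \<eta>_def algebra_simps)
  then have per: "\<eta> (frac x) = \<eta> x" for x by (intro periodic_frac) simp
  have sm: "smooth_path \<eta>"
  proof -
    from g(1) obtain D where D0: "D 0 = \<gamma>"
      and Dk: "\<And>k t. (D k has_vector_derivative D (Suc k) t) (at t)"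
      and nz: "\<forall>t\<in>{0..1}. D 1 t \<noteq> 0"
      unfolding smooth_path_def by blast
    have sh: "((\<lambda>t. D k (t + c)) has_vector_derivative D (Suc k) (t + c)) (at t)" for k c t
    proof -
      have "((\<lambda>t. t + c) has_vector_derivative 1) (at t)" by (auto intro!: derivative_eq_intros)
      from vector_diff_chain_at[OF this Dk] show ?thesis by (simp add: o_def)
    qed
    have "D 1 (t + 1) = D 1 t" for t
    proof (rule vector_derivative_unique_at)
      show "(\<gamma> has_vector_derivative D 1 t) (at t)" using Dk[of 0] D0 by simp
      show "(\<gamma> has_vector_derivative D 1 (t + 1)) (at t)" using sh[of 0 1 t] D0 g(2) by simp
    qed
    then have nz': "D 1 x \<noteq> 0" for x using nz frac01[of x] periodic_frac[of "D 1" x] by metis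
    show ?thesis unfolding smooth_path_def \<eta>_def
      by (rule exI[of _ "\<lambda>k t. D k (t + (t0 - 1/2))"]) (use sh nz' D0 in auto)
  qed
  have "\<forall>t\<in>{0..1}. \<eta> t = \<eta> (1/2) \<longrightarrow> t = 1/2"
  proof (intro ballI impI)
    fix t :: real assume t: "t \<in> {0..1}" "\<eta> t = \<eta> (1/2)"
    define x where "x = t + (t0 - 1/2)"
    have "\<gamma> (frac x) = \<gamma> t0" using t fr by (simp add: \<eta>_def x_def)
    moreover have "frac x \<in> {0..1}" "t0 \<in> {0..1}" "frac x < 1" using t0 frac01 frac_lt_1 by auto
    ultimately have "frac x = t0"
      using g(3) t0 unfolding simple_path_def loop_free_def by fastforce
    then have "t - 1/2 = of_int \<lfloor>x\<rfloor>" by (simp add: frac_def x_def)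
    moreover have "\<bar>t - 1/2\<bar> < 1" using t by auto
    ultimately show "t = 1/2" by (smt (verit) of_int_0 of_int_1 of_int_less_iff of_int_minus)
  qed
  then obtain \<nu> \<delta> where "crosses \<eta> (1/2) \<nu> \<delta>" using smooth_path_crosses[OF sm, of "1/2"] by auto
  moreover have "\<eta> (1/2) = p" using t0 by (simp add: \<eta>_def)
  moreover have "path_image \<eta> = s"
  proof
    show "path_image \<eta> \<subseteq> s" using img unfolding path_image_def \<eta>_def by auto
    show "s \<subseteq> path_image \<eta>"
    proof
      fix z assume "z \<in> s"
      then obtain x where "z = \<gamma> x" using g(4) unfolding path_image_def by auto
      then have "z = \<eta> (frac (x - (t0 - 1/2)))"
        using per[of "x - (t0 - 1/2)"] by (simp add: \<eta>_def)
      then show "z \<in> path_image \<eta>" using frac01 unfolding path_image_def by auto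
    qed
  qed
  ultimately show ?thesis by (rule that)
qed

text \<open>The map \<open>t + iy \<mapsto> \<gamma> t + iy\<nu>\<close> is injective on a thin strip around \<open>t0\<close>, because the
  component of \<open>\<gamma>\<close> along \<open>\<nu>\<close> increases.  By invariance of domain the image of a small box is
  a neighbourhood of \<open>\<gamma> t0\<close>; its two halves \<open>y > 0\<close> and \<open>y < 0\<close> are the two sides.\<close>
lemma crosses_sides:
  assumes cr: "crosses \<gamma> t0 \<nu> \<delta>" and W: "open W" "\<gamma> t0 \<in> W"
  obtains N Np Nm r where "open N" "\<gamma> t0 \<in> N" "N \<subseteq> W" "connected Np" "connected Nm"
    "N - path_image \<gamma> = Np \<union> Nm"
    "path_image \<gamma> \<inter> N \<subseteq> closure Np \<inter> closure Nm"
    "0 < r" "\<And>y. 0 < y \<Longrightarrow> y < r \<Longrightarrow> \<gamma> t0 + of_real y * \<i> * \<nu> \<in> Np"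
    "\<And>y. 0 < y \<Longrightarrow> y < r \<Longrightarrow> \<gamma> t0 - of_real y * \<i> * \<nu> \<in> Nm"
proof -
  let ?p = "\<gamma> t0"
  from cr have g: "path \<gamma>" "\<nu> \<noteq> 0" "0 < \<delta>" "0 < t0 - \<delta>" "t0 + \<delta> < 1"
    and mono: "strict_mono_on {t0 - \<delta>..t0 + \<delta>} (\<lambda>t. Re (\<gamma> t / \<nu>))"
    and uniq: "\<And>t. t \<in> {0..1} \<Longrightarrow> \<gamma> t = \<gamma> t0 \<Longrightarrow> t = t0"
    unfolding crosses_def by auto
  have contg: "continuous_on {0..1} \<gamma>" using g(1) by (simp add: path_def)
\<comment> \<open>The rest of the curve, at a positive distance from \<open>\<gamma> t0\<close>.\<close>
  define R where "R = \<gamma> ` ({0..1} - {t0 - \<delta><..<t0 + \<delta>})"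
  have "compact ({0..1} - {t0 - \<delta><..<t0 + \<delta>})" by (intro compact_diff) auto
  then have "compact R" unfolding R_def
    by (rule compact_continuous_image[rotated]) (rule continuous_on_subset[OF contg], auto)
  then have "open (W - R)" using W by (simp add: compact_imp_closed open_Diff)
  moreover have "?p \<in> W - R" using W uniq g(3) unfolding R_def by auto
  ultimately obtain e where e: "e > 0" "ball ?p e \<subseteq> W - R" using open_contains_ball by blast
  have "continuous (at t0) \<gamma>"
    using contg g by (intro continuous_on_interior[OF contg]) auto
  then obtain d where d: "d > 0" "\<And>t. dist t t0 < d \<Longrightarrow> dist (\<gamma> t) ?p < e / 2"
    using e(1) unfolding continuous_at_eps_delta
    by (metis half_gt_zero_iff dist_commute)
  define \<eta> where "\<eta> = min d \<delta>"
  have \<eta>: "0 < \<eta>" "\<eta> \<le> d" "\<eta> \<le> \<delta>" using d g by (auto simp: \<eta>_def)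
  define r where "r = e / (2 * norm \<nu>)"
  have r: "0 < r" "r * norm \<nu> = e / 2" using e g by (auto simp: r_def)
  define h where "h = (\<lambda>z. \<gamma> (Re z) + of_real (Im z) * \<i> * \<nu>)"
  define B where "B = {z. t0 - \<eta> < Re z \<and> Re z < t0 + \<eta> \<and> - r < Im z \<and> Im z < r}"
  define N where "N = h ` B"
  define Np where "Np = h ` (B \<inter> {z. 0 < Im z})"
  define Nm where "Nm = h ` (B \<inter> {z. Im z < 0})"
  have box: "B = {z. t0 - \<eta> < Re z} \<inter> {z. Re z < t0 + \<eta>} \<inter> {z. - r < Im z} \<inter> {z. Im z < r}"
    by (auto simp: B_def)
  have "open B" unfolding box by (intro open_Int open_halfspace_Re_gt open_halfspace_Re_lt open_halfspace_Im_gt open_halfspace_Im_lt)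
  have "convex B" unfolding box by (intro convex_Int convex_halfspace_Re_gt convex_halfspace_Re_lt convex_halfspace_Im_gt convex_halfspace_Im_lt)
  have conth: "continuous_on B h"
  proof -
    have "continuous_on B (\<gamma> \<circ> Re)"
      by (rule continuous_on_compose, intro continuous_intros, rule continuous_on_subset[OF contg])
        (use g \<eta> in \<open>auto simp: B_def\<close>)
    then show ?thesis unfolding h_def o_def by (intro continuous_intros)
  qed
  have reh: "Re (h z / \<nu>) = Re (\<gamma> (Re z) / \<nu>)" for z
    using g(2) by (simp add: h_def add_divide_distrib)
  have inB: "Re z \<in> {t0 - \<delta>..t0 + \<delta>}" "Re z \<in> {0..1}" if "z \<in> B" for z using that \<eta> g by (auto simp: B_def)
  have inj: "inj_on h B"
  proof (rule inj_onI)
    fix z w assume zw: "z \<in> B" "w \<in> B" "h z = h w"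
    then have "Re (\<gamma> (Re z) / \<nu>) = Re (\<gamma> (Re w) / \<nu>)" using reh by metis
    then have "Re z = Re w"
      using inB zw mono by (metis strict_mono_on_eqD)
    moreover from this zw(3) g(2) have "Im z = Im w" by (simp add: h_def)
    ultimately show "z = w" by (simp add: complex_eq_iff)
  qed
  have oN: "open N" unfolding N_def by (rule invariance_of_domain[OF conth \<open>open B\<close> inj])
  have t0B: "of_real t0 \<in> B" using \<eta> r by (auto simp: B_def)
  have hre: "h (of_real t) = \<gamma> t" for t by (simp add: h_def)
  have pN: "?p \<in> N" unfolding N_def using t0B hre by (metis imageI)
  have NW: "N \<subseteq> W - R"
  proof -
    have "h z \<in> ball ?p e" if "z \<in> B" for z
    proof -
      have "dist (\<gamma> (Re z)) ?p < e / 2" using that \<eta> by (intro d) (auto simp: B_def dist_real_def)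
      moreover have "norm (of_real (Im z) * \<i> * \<nu>) \<le> r * norm \<nu>"
        using that by (auto simp: norm_mult B_def intro!: mult_right_mono)
      ultimately have "dist ?p (h z) < e" unfolding h_def dist_norm r(2)
        by (smt (verit) add.commute add_diff_eq field_sum_of_halves norm_minus_commute norm_triangle_ineq)
      then show ?thesis by simp
    qed
    then show ?thesis using e unfolding N_def by blast
  qed
  have onc: "h z \<in> path_image \<gamma> \<longleftrightarrow> Im z = 0" if "z \<in> B" for z
  proof
    assume "Im z = 0"
    then show "h z \<in> path_image \<gamma>" using inB(2)[OF that] by (simp add: h_def path_image_def)
  next
    assume "h z \<in> path_image \<gamma>"
    then obtain t where t: "t \<in> {0..1}" "\<gamma> t = h z" unfolding path_image_def by auto
    have "h z \<notin> R" using NW that unfolding N_def by auto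
    then have t': "t \<in> {t0 - \<delta><..<t0 + \<delta>}" using t unfolding R_def by (metis DiffI imageI)
    have "Re (\<gamma> t / \<nu>) = Re (\<gamma> (Re z) / \<nu>)" using reh[of z] t by simp
    then have "t = Re z" using inB[OF that] t' mono strict_mono_on_eqD by fastforce
    with t show "Im z = 0" using g(2) by (simp add: h_def)
  qed
  have split: "N - path_image \<gamma> = Np \<union> Nm"
  proof
    show "N - path_image \<gamma> \<subseteq> Np \<union> Nm"
    proof
      fix w assume "w \<in> N - path_image \<gamma>"
      then obtain z where z: "z \<in> B" "w = h z" "Im z \<noteq> 0" using onc unfolding N_def by auto
      then show "w \<in> Np \<union> Nm" unfolding Np_def Nm_def by (cases "Im z > 0") auto
    qed
    show "Np \<union> Nm \<subseteq> N - path_image \<gamma>" using onc unfolding N_def Np_def Nm_def by fastforce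
  qed
  have lim: "((\<lambda>y. h (Complex t y)) \<longlongrightarrow> \<gamma> t) (at 0 within S)" for t S
  proof -
    have "continuous_on UNIV (\<lambda>y. h (Complex t y))" unfolding h_def complex.sel by (intro continuous_intros)
    then have "continuous (at 0) (\<lambda>y. h (Complex t y))" by (simp add: continuous_on_eq_continuous_at)
    then have "((\<lambda>y. h (Complex t y)) \<longlongrightarrow> h (Complex t 0)) (at 0)" by (simp add: continuous_within)
    then show ?thesis by (auto simp: h_def intro: tendsto_within_subset)
  qed
  have clos: "path_image \<gamma> \<inter> N \<subseteq> closure Np \<inter> closure Nm"
  proof
    fix w assume "w \<in> path_image \<gamma> \<inter> N"
    then obtain z where z: "z \<in> B" "w = h z" "Im z = 0" using onc unfolding N_def by auto
    have w: "w = \<gamma> (Re z)" using z by (simp add: h_def)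
    have "w \<in> closure Np"
    proof (rule Lim_in_closed_set[OF closed_closure _ _ lim[of "Re z" "{0<..}"], folded w])
      show "\<forall>\<^sub>F y in at_right 0. h (Complex (Re z) y) \<in> closure Np"
        unfolding eventually_at using r z
        by (intro exI[of _ r]) (auto simp: Np_def B_def intro!: subsetD[OF closure_subset] imageI)
    qed simp
    moreover have "w \<in> closure Nm"
    proof (rule Lim_in_closed_set[OF closed_closure _ _ lim[of "Re z" "{..<0}"], folded w])
      show "\<forall>\<^sub>F y in at_left 0. h (Complex (Re z) y) \<in> closure Nm"
        unfolding eventually_at using r z
        by (intro exI[of _ r]) (auto simp: Nm_def B_def intro!: subsetD[OF closure_subset] imageI)
    qed simp
    ultimately show "w \<in> closure Np \<inter> closure Nm" by simp
  qed
  have cp: "connected Np" unfolding Np_def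
    by (rule connected_continuous_image, rule continuous_on_subset[OF conth], simp)
      (intro convex_connected convex_Int \<open>convex B\<close> convex_halfspace_Im_gt)
  have cm: "connected Nm" unfolding Nm_def
    by (rule connected_continuous_image, rule continuous_on_subset[OF conth], simp)
      (intro convex_connected convex_Int \<open>convex B\<close> convex_halfspace_Im_lt)
  have yp: "?p + of_real y * \<i> * \<nu> \<in> Np" if "0 < y" "y < r" for y
    unfolding Np_def using that \<eta> by (intro image_eqI[of _ _ "Complex t0 y"]) (auto simp: h_def B_def)
  have ym: "?p - of_real y * \<i> * \<nu> \<in> Nm" if "0 < y" "y < r" for y
    unfolding Nm_def using that \<eta> by (intro image_eqI[of _ _ "Complex t0 (- y)"]) (auto simp: h_def B_def)
  show ?thesis
    by (rule that[OF oN pN _ cp cm split clos r(1) yp ym]) (use NW in auto)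
qed


section \<open>Winding numbers across a curve\<close>

text \<open>If the path seen from \<open>z\<close> avoids a ray, the logarithm cut along that ray is a continuous
  logarithm along the whole path.\<close>
lemma winding_number_slit:
  assumes "path q" "c \<noteq> 0" "\<And>t. t \<in> {0..1} \<Longrightarrow> c * (q t - z) \<notin> \<real>\<^sub>\<le>\<^sub>0"
  shows "winding_number q z = (Ln (c * (q 1 - z)) - Ln (c * (q 0 - z))) / (2 * of_real pi * \<i>)"
proof -
  define p where "p = (\<lambda>t. Ln (c * (q t - z)) - Ln c)"
  have "path p" unfolding p_def path_def
    using assms by (intro continuous_intros) (auto simp: path_def)
  have e: "exp (p t) = q t - z" if "t \<in> {0..1}" for t
  proof -
    have "c * (q t - z) \<noteq> 0" using assms(3)[OF that] by auto
    then show ?thesis using assms(2) by (simp add: p_def exp_diff)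
  qed
  have "winding_number q z = winding_number (\<lambda>t. q t - z) 0" by (rule winding_number_offset)
  also have "\<dots> = winding_number (exp \<circ> p) 0" by (rule winding_number_cong) (simp add: e)
  also have "\<dots> = (pathfinish p - pathstart p) / (2 * of_real pi * \<i>)"
    by (rule winding_number_compose_exp[OF \<open>path p\<close>])
  finally show ?thesis by (simp add: p_def pathfinish_def pathstart_def)
qed

text \<open>Only the short middle piece of the curve matters in the limit.  Seen from a point slightly to the left
  of the curve it avoids the left-pointing normal ray, and seen from a point slightly to the right it
  avoids the right-pointing one; the logarithms cut along these opposite rays differ by \<open>2\<pi>\<i>\<close>
  in their increments.\<close>
lemma winding_number_jump:
  assumes cr: "crosses \<gamma> t0 \<nu> \<delta>" and r: "0 < r"
    and off: "\<And>y. 0 < y \<Longrightarrow> y < r \<Longrightarrow> \<gamma> t0 + of_real y * \<i> * \<nu> \<notin> path_image \<gamma> \<and> \<gamma> t0 - of_real y * \<i> * \<nu> \<notin> path_image \<gamma>"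
  shows "((\<lambda>y. winding_number \<gamma> (\<gamma> t0 + of_real y * \<i> * \<nu>) - winding_number \<gamma> (\<gamma> t0 - of_real y * \<i> * \<nu>)) \<longlongrightarrow> 1) (at_right 0)"
proof -
  let ?p = "\<gamma> t0"
  from cr have g: "path \<gamma>" "\<nu> \<noteq> 0" "0 < \<delta>" "0 < t0 - \<delta>" "t0 + \<delta> < 1"
    and mono: "strict_mono_on {t0 - \<delta>..t0 + \<delta>} (\<lambda>t. Re (\<gamma> t / \<nu>))"
    and uniq: "\<And>t. t \<in> {0..1} \<Longrightarrow> \<gamma> t = \<gamma> t0 \<Longrightarrow> t = t0"
    unfolding crosses_def by auto
  define a where "a = t0 - \<delta>"
  define b where "b = t0 + \<delta>"
  have ab: "0 < a" "a < t0" "t0 < b" "b < 1" using g by (auto simp: a_def b_def)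
  define A where "A = subpath 0 a \<gamma>"
  define M where "M = subpath a b \<gamma>"
  define E where "E = subpath b 1 \<gamma>"
  define u where "u = (\<lambda>t. (\<gamma> t - ?p) / \<nu>)"
  have paths: "path A" "path M" "path E"
    unfolding A_def M_def E_def using ab g(1) by (auto intro!: path_subpath)
  have noA: "?p \<notin> path_image A" "?p \<notin> path_image E"
  proof -
    have "\<gamma> t \<noteq> ?p" if "t \<in> {0..a} \<union> {b..1}" for t using uniq[of t] that ab by auto
    moreover have "path_image A = \<gamma> ` {0..a}" "path_image E = \<gamma> ` {b..1}"
      unfolding A_def E_def using ab by (auto simp: path_image_subpath)
    ultimately show "?p \<notin> path_image A" "?p \<notin> path_image E" by (metis UnI1 UnI2 imageE)+
  qed
  have dec: "winding_number \<gamma> z = winding_number A z + winding_number M z + winding_number E z"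
    if "z \<notin> path_image \<gamma>" for z
  proof -
    have "winding_number A z + winding_number M z = winding_number (subpath 0 b \<gamma>) z"
      unfolding A_def M_def using that ab g(1) by (intro winding_number_subpath_combine) auto
    moreover have "winding_number (subpath 0 b \<gamma>) z + winding_number E z = winding_number (subpath 0 1 \<gamma>) z"
      unfolding E_def using that ab g(1) by (intro winding_number_subpath_combine) auto
    ultimately show ?thesis by simp
  qed
  have Re_u: "Re (u t) = Re (\<gamma> t / \<nu>) - Re (?p / \<nu>)" for t by (simp add: u_def diff_divide_distrib)
  have u0: "t = t0" if "t \<in> {a..b}" "Re (u t) = 0" for t
  proof -
    have "Re (\<gamma> t / \<nu>) = Re (\<gamma> t0 / \<nu>)" using that(2) Re_u by simp
    moreover have "t \<in> {t0 - \<delta>..t0 + \<delta>}" "t0 \<in> {t0 - \<delta>..t0 + \<delta>}" using that(1) ab by (auto simp: a_def b_def)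
    ultimately show ?thesis using strict_mono_on_eqD[OF mono] by metis
  qed
  have "Re (u a) < 0" "Re (u b) > 0"
    using strict_mono_onD[OF mono, of a t0] strict_mono_onD[OF mono, of t0 b] ab g(3) Re_u
    by (auto simp: a_def b_def)
  note sgns = this
  have uu: "u t0 = 0" by (simp add: u_def)
  have Mval: "M t = \<gamma> (a + (b - a) * t)" "a + (b - a) * t \<in> {a..b}" if "t \<in> {0..1}" for t
  proof -
    have "(b - a) * t \<le> (b - a) * 1" using that ab by (intro mult_left_mono) auto
    moreover have "0 \<le> (b - a) * t" using that ab by (intro mult_nonneg_nonneg) auto
    moreover have "M t = \<gamma> (a + (b - a) * t)" by (simp add: M_def subpath_def add.commute)
    ultimately show "M t = \<gamma> (a + (b - a) * t)" "a + (b - a) * t \<in> {a..b}" by auto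
  qed
  have wM: "winding_number M (?p + of_real y * \<i> * \<nu>) =
      (Ln (\<i> * u b + of_real y) - Ln (\<i> * u a + of_real y)) / (2 * of_real pi * \<i>)"
    "winding_number M (?p - of_real y * \<i> * \<nu>) =
      (Ln (- \<i> * u b + of_real y) - Ln (- \<i> * u a + of_real y)) / (2 * of_real pi * \<i>)"
    if "y > 0" for y
  proof -
    have e1: "(\<i> / \<nu>) * (\<gamma> t - (?p + of_real y * \<i> * \<nu>)) = \<i> * u t + of_real y"
     and e2: "(- \<i> / \<nu>) * (\<gamma> t - (?p - of_real y * \<i> * \<nu>)) = - \<i> * u t + of_real y" for t
      using g(2) by (auto simp: u_def field_simps)
    have n1: "\<i> * u t + of_real y \<notin> \<real>\<^sub>\<le>\<^sub>0" "- \<i> * u t + of_real y \<notin> \<real>\<^sub>\<le>\<^sub>0" if "t \<in> {a..b}" for t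
      using u0[OF that] uu \<open>y > 0\<close> by (auto simp: complex_nonpos_Reals_iff)
    have "M 0 = \<gamma> a" "M 1 = \<gamma> b" using Mval[of 0] Mval[of 1] by auto
    moreover have "winding_number M (?p + of_real y * \<i> * \<nu>) =
        (Ln ((\<i> / \<nu>) * (M 1 - (?p + of_real y * \<i> * \<nu>))) - Ln ((\<i> / \<nu>) * (M 0 - (?p + of_real y * \<i> * \<nu>)))) / (2 * of_real pi * \<i>)"
      by (rule winding_number_slit[OF paths(2)]) (use g(2) in simp, simp only: Mval(1) e1, rule n1, rule Mval(2))
    moreover have "winding_number M (?p - of_real y * \<i> * \<nu>) =
        (Ln ((- \<i> / \<nu>) * (M 1 - (?p - of_real y * \<i> * \<nu>))) - Ln ((- \<i> / \<nu>) * (M 0 - (?p - of_real y * \<i> * \<nu>)))) / (2 * of_real pi * \<i>)"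
      by (rule winding_number_slit[OF paths(2)]) (use g(2) in simp, simp only: Mval(1) e2, rule n1, rule Mval(2))
    ultimately show "winding_number M (?p + of_real y * \<i> * \<nu>) =
      (Ln (\<i> * u b + of_real y) - Ln (\<i> * u a + of_real y)) / (2 * of_real pi * \<i>)"
    "winding_number M (?p - of_real y * \<i> * \<nu>) =
      (Ln (- \<i> * u b + of_real y) - Ln (- \<i> * u a + of_real y)) / (2 * of_real pi * \<i>)"
      by (simp_all only: e1 e2)
  qed
  have y0: "((\<lambda>y::real. y) \<longlongrightarrow> 0) (at_right 0)" by (simp add: tendsto_ident_at)
  have LnT: "((\<lambda>y. Ln (c + of_real y)) \<longlongrightarrow> Ln c) (at_right (0::real))" if "Im c \<noteq> 0" for c :: complex
  proof -
    have "c \<notin> \<real>\<^sub>\<le>\<^sub>0" using that by (auto simp: complex_nonpos_Reals_iff)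
    moreover have "((\<lambda>y. c + complex_of_real y) \<longlongrightarrow> c + of_real 0) (at_right 0)"
      by (intro tendsto_intros y0)
    ultimately show ?thesis by (intro tendsto_Ln) auto
  qed
  have Ml: "((\<lambda>y. winding_number M (?p + of_real y * \<i> * \<nu>) - winding_number M (?p - of_real y * \<i> * \<nu>)) \<longlongrightarrow>
     (Ln (\<i> * u b) - Ln (\<i> * u a)) / (2 * of_real pi * \<i>) - (Ln (- \<i> * u b) - Ln (- \<i> * u a)) / (2 * of_real pi * \<i>)) (at_right 0)"
    (is "(?f \<longlongrightarrow> ?l) _")
  proof (rule Lim_transform_eventually)
    show "((\<lambda>y. (Ln (\<i> * u b + of_real y) - Ln (\<i> * u a + of_real y)) / (2 * of_real pi * \<i>) -
       (Ln (- \<i> * u b + of_real y) - Ln (- \<i> * u a + of_real y)) / (2 * of_real pi * \<i>)) \<longlongrightarrow> ?l) (at_right 0)"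
      by (intro tendsto_intros LnT) (use sgns in auto)
    show "\<forall>\<^sub>F y in at_right 0. (Ln (\<i> * u b + of_real y) - Ln (\<i> * u a + of_real y)) / (2 * of_real pi * \<i>) -
       (Ln (- \<i> * u b + of_real y) - Ln (- \<i> * u a + of_real y)) / (2 * of_real pi * \<i>) = ?f y"
      unfolding eventually_at by (intro exI[of _ 1]) (simp add: wM)
  qed
  have l: "?l = 1"
  proof -
    have i: "Ln (\<i> * w) = Ln w + \<i> * of_real pi / 2" "Ln (- \<i> * w) = Ln w - \<i> * of_real pi / 2"
      if "Re w > 0" for w
    proof -
      have "Im (Ln w) < pi / 2" "- (pi / 2) < Im (Ln w)" using that Re_Ln_pos_lt_imp[of w] by (auto simp: abs_less_iff)
      moreover have "w \<noteq> 0" using that by auto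
      moreover have e: "exp (\<i> * of_real pi / 2) = \<i>" using cis_conv_exp[of "pi/2"] by simp
      ultimately show "Ln (\<i> * w) = Ln w + \<i> * of_real pi / 2" "Ln (- \<i> * w) = Ln w - \<i> * of_real pi / 2"
        using pi_gt_zero e by (auto intro!: Ln_unique simp: exp_add exp_diff)
    qed
    note b = i[OF sgns(2)]
    have a: "Ln (\<i> * u a) = Ln (- u a) - \<i> * of_real pi / 2" "Ln (- \<i> * u a) = Ln (- u a) + \<i> * of_real pi / 2"
      using i[of "- u a"] sgns(1) by auto
    show ?thesis unfolding a b by (simp add: field_simps)
  qed
  have rest: "((\<lambda>y. winding_number X (?p + of_real y * \<i> * \<nu>) - winding_number X (?p - of_real y * \<i> * \<nu>)) \<longlongrightarrow> 0) (at_right 0)"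
    if "path X" "?p \<notin> path_image X" for X
  proof -
    have c: "isCont (winding_number X) ?p" by (rule continuous_at_winding_number[OF that])
    have 1: "((\<lambda>y. ?p + of_real y * \<i> * \<nu>) \<longlongrightarrow> ?p + of_real 0 * \<i> * \<nu>) (at_right 0)"
      by (intro tendsto_intros y0)
    have 2: "((\<lambda>y. ?p - of_real y * \<i> * \<nu>) \<longlongrightarrow> ?p - of_real 0 * \<i> * \<nu>) (at_right 0)"
      by (intro tendsto_intros y0)
    have "((\<lambda>y. winding_number X (?p + of_real y * \<i> * \<nu>) - winding_number X (?p - of_real y * \<i> * \<nu>)) \<longlongrightarrow> winding_number X ?p - winding_number X ?p) (at_right 0)"
      by (intro tendsto_diff isCont_tendsto_compose[OF c]) (use 1 2 in auto)
    then show ?thesis by simp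
  qed
  have "((\<lambda>y. (winding_number A (?p + of_real y * \<i> * \<nu>) - winding_number A (?p - of_real y * \<i> * \<nu>)) +
      (winding_number M (?p + of_real y * \<i> * \<nu>) - winding_number M (?p - of_real y * \<i> * \<nu>)) +
      (winding_number E (?p + of_real y * \<i> * \<nu>) - winding_number E (?p - of_real y * \<i> * \<nu>))) \<longlongrightarrow> 0 + 1 + 0) (at_right 0)"
    using Ml unfolding l by (intro tendsto_add rest paths noA)
  note lim = this[unfolded add_0_left add_0_right]
  have ev: "\<forall>\<^sub>F y in at_right 0. (winding_number A (?p + of_real y * \<i> * \<nu>) - winding_number A (?p - of_real y * \<i> * \<nu>)) +
      (winding_number M (?p + of_real y * \<i> * \<nu>) - winding_number M (?p - of_real y * \<i> * \<nu>)) +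
      (winding_number E (?p + of_real y * \<i> * \<nu>) - winding_number E (?p - of_real y * \<i> * \<nu>)) =
      winding_number \<gamma> (?p + of_real y * \<i> * \<nu>) - winding_number \<gamma> (?p - of_real y * \<i> * \<nu>)"
    unfolding eventually_at by (intro exI[of _ r]) (use r off in \<open>auto simp: dec\<close>)
  show ?thesis by (rule Lim_transform_eventually[OF lim ev])
qed

text \<open>A continuous square root of \<open>(b - z) / (a - z)\<close> off a path from \<open>a\<close> to \<open>b\<close>.\<close>
definition half_turn :: "(real \<Rightarrow> complex) \<Rightarrow> complex \<Rightarrow> complex" where
  "half_turn \<gamma> z = exp (of_real pi * \<i> * winding_number \<gamma> z)"

lemma half_turn_square:
  assumes "path \<gamma>" "z \<notin> path_image \<gamma>"
  shows "(half_turn \<gamma> z)\<^sup>2 * (pathstart \<gamma> - z) = pathfinish \<gamma> - z"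
  using winding_number_exp_2pi[OF assms]
  by (simp add: half_turn_def exp_double[symmetric] mult.assoc mult.left_commute power2_eq_square exp_add[symmetric])

lemma isCont_half_turn: "path \<gamma> \<Longrightarrow> z \<notin> path_image \<gamma> \<Longrightarrow> isCont (half_turn \<gamma>) z"
  unfolding half_turn_def by (intro continuous_intros continuous_at_winding_number)

lemma half_turn_flips_arc:
  assumes cr: "crosses \<gamma> t0 \<nu> \<delta>"
  obtains zp zm where "zp \<longlonglongrightarrow> \<gamma> t0" "zm \<longlonglongrightarrow> \<gamma> t0" "\<And>n. zp n \<notin> path_image \<gamma>" "\<And>n. zm n \<notin> path_image \<gamma>"
    "(\<lambda>n. half_turn \<gamma> (zp n) / half_turn \<gamma> (zm n)) \<longlonglongrightarrow> -1"
proof -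
  obtain N Np Nm r where N: "N - path_image \<gamma> = Np \<union> Nm" "0 < r"
    "\<And>y. 0 < y \<Longrightarrow> y < r \<Longrightarrow> \<gamma> t0 + of_real y * \<i> * \<nu> \<in> Np"
    "\<And>y. 0 < y \<Longrightarrow> y < r \<Longrightarrow> \<gamma> t0 - of_real y * \<i> * \<nu> \<in> Nm"
    by (rule crosses_sides[OF cr open_UNIV UNIV_I]) blast
  have off: "\<gamma> t0 + of_real y * \<i> * \<nu> \<notin> path_image \<gamma> \<and> \<gamma> t0 - of_real y * \<i> * \<nu> \<notin> path_image \<gamma>" if "0 < y" "y < r" for y
    using N that by blast
  define y where "y = (\<lambda>n. r / (2 + real n))"
  have y: "0 < y n" "y n < r" for n using N(2) by (auto simp: y_def field_simps add_pos_nonneg)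
  have "y \<longlonglongrightarrow> 0" unfolding y_def
    by (rule tendsto_divide_0[OF tendsto_const]) (auto intro!: filterlim_at_top_imp_at_infinity filterlim_tendsto_add_at_top filterlim_real_sequentially)
  then have fy: "filterlim y (at_right 0) sequentially" using y by (auto simp: filterlim_at less_imp_neq[THEN not_sym])
  note l = filterlim_compose[OF winding_number_jump[OF cr N(2) off] fy]
  show ?thesis
  proof (rule that[of "\<lambda>n. \<gamma> t0 + of_real (y n) * \<i> * \<nu>" "\<lambda>n. \<gamma> t0 - of_real (y n) * \<i> * \<nu>"])
    have "(\<lambda>n. \<gamma> t0 + of_real (y n) * \<i> * \<nu>) \<longlonglongrightarrow> \<gamma> t0 + of_real 0 * \<i> * \<nu>"
      "(\<lambda>n. \<gamma> t0 - of_real (y n) * \<i> * \<nu>) \<longlonglongrightarrow> \<gamma> t0 - of_real 0 * \<i> * \<nu>"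
      by (intro tendsto_intros \<open>y \<longlonglongrightarrow> 0\<close>)+
    then show "(\<lambda>n. \<gamma> t0 + of_real (y n) * \<i> * \<nu>) \<longlonglongrightarrow> \<gamma> t0"
      "(\<lambda>n. \<gamma> t0 - of_real (y n) * \<i> * \<nu>) \<longlonglongrightarrow> \<gamma> t0" by simp_all
    have "(\<lambda>n. exp (of_real pi * \<i> * (winding_number \<gamma> (\<gamma> t0 + of_real (y n) * \<i> * \<nu>) - winding_number \<gamma> (\<gamma> t0 - of_real (y n) * \<i> * \<nu>))))
       \<longlonglongrightarrow> exp (of_real pi * \<i> * 1)"
      by (intro tendsto_intros l)
    then show "(\<lambda>n. half_turn \<gamma> (\<gamma> t0 + of_real (y n) * \<i> * \<nu>) / half_turn \<gamma> (\<gamma> t0 - of_real (y n) * \<i> * \<nu>)) \<longlonglongrightarrow> -1"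
      by (simp add: half_turn_def exp_diff[symmetric] right_diff_distrib)
  qed (use off y in auto)
qed

text \<open>For a closed curve the square root is \<open>-1\<close> inside and \<open>1\<close> outside.\<close>
lemma half_turn_flips_loop:
  assumes "simple_path \<gamma>" "pathfinish \<gamma> = pathstart \<gamma>" "p \<in> path_image \<gamma>"
  obtains zp zm where "zp \<longlonglongrightarrow> p" "zm \<longlonglongrightarrow> p" "\<And>n. zp n \<notin> path_image \<gamma>" "\<And>n. zm n \<notin> path_image \<gamma>"
    "(\<lambda>n. half_turn \<gamma> (zp n) / half_turn \<gamma> (zm n)) \<longlonglongrightarrow> -1"
proof -
  note J = Jordan_inside_outside[OF assms(1,2)]
  have "p \<in> closure (inside (path_image \<gamma>))" "p \<in> closure (outside (path_image \<gamma>))"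
    using J assms(3) by (auto simp: frontier_def)
  then obtain zp zm where z: "\<And>n. zp n \<in> inside (path_image \<gamma>)" "zp \<longlonglongrightarrow> p"
    "\<And>n. zm n \<in> outside (path_image \<gamma>)" "zm \<longlonglongrightarrow> p" unfolding closure_sequential by metis
  have off: "zp n \<notin> path_image \<gamma>" "zm n \<notin> path_image \<gamma>" for n
    using z(1)[of n] z(3)[of n] inside_no_overlap[of "path_image \<gamma>"] outside_no_overlap[of "path_image \<gamma>"] by blast+
  have m: "half_turn \<gamma> (zm n) = 1" for n
    using winding_number_zero_in_outside[OF _ assms(2) z(3)] assms(1) by (simp add: half_turn_def simple_path_imp_path)
  have "half_turn \<gamma> (zp n) = -1" for n
    by (rule simple_closed_path_winding_number_inside[OF assms(1)])
      (use z(1) in \<open>auto simp: half_turn_def exp_minus\<close>)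
  with m have "(\<lambda>n. half_turn \<gamma> (zp n) / half_turn \<gamma> (zm n)) \<longlonglongrightarrow> -1" by simp
  then show ?thesis using that z off by blast
qed


section \<open>Smooth disks\<close>

text \<open>All of this is the Jordan curve theorem, read off for the closed disk instead of its boundary.\<close>
lemma smooth_disk_facts:
  assumes "smooth_disk B"
  shows "compact B" "smooth_circle (frontier B)" "connected (interior B)" "connected (- B)"
    "interior B \<noteq> {}" "- B \<noteq> {}"
    "frontier B \<subseteq> closure (interior B)" "frontier B \<subseteq> closure (- B)"
proof -
  from assms obtain C where C: "smooth_circle C" "B = C \<union> inside C" unfolding smooth_disk_def by blast
  then obtain \<gamma> where g: "simple_path \<gamma>" "path_image \<gamma> = C" "pathfinish \<gamma> = pathstart \<gamma>"
    unfolding smooth_circle_def pathstart_def pathfinish_def by (metis add_0)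
  note J = Jordan_inside_outside[OF g(1,3), unfolded g(2)]
  have cB: "- B = outside C" using C(2) by (metis union_with_inside double_complement)
  have cmpC: "compact C" using g by (metis compact_simple_path_image)
  have fr: "frontier B = C" using J cB frontier_complement[of B] by metis
  have int: "interior B = inside C"
  proof -
    have "interior B = - closure (outside C)" using cB by (metis interior_closure double_complement)
    also have "\<dots> = - (outside C \<union> C)" using J by (simp add: closure_Un_frontier)
    also have "\<dots> = inside C" using J by blast
    finally show ?thesis .
  qed
  show "connected (interior B)" "connected (- B)" "interior B \<noteq> {}" "- B \<noteq> {}" "smooth_circle (frontier B)"
    using int cB J C fr by auto
  have clo: "closure (inside C) = B" using J C by (simp add: closure_Un_frontier Un_commute)
  show "frontier B \<subseteq> closure (interior B)" using int clo C fr by auto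
  show "compact B" using clo J compact_closure by metis
  show "frontier B \<subseteq> closure (- B)" by (simp add: frontier_closures)
qed

lemma connectehole_subset_or_disjoint_frontier:
  assumes "connected S" "S \<inter> frontier T = {}" shows "S \<subseteq> T \<or> S \<inter> T = {}"
  using connected_Int_frontier[of S T] assms by blast

text \<open>Both the interior and the complement of the disk accumulate at \<open>p\<close>, and each of the two local
  sides of the boundary curve lies in one of them; so one side is inner and the other is outer.\<close>
lemma smooth_disk_sides:
  assumes B: "smooth_disk B" and p: "p \<in> frontier B" and W: "open W" "p \<in> W"
  obtains Nin Nout \<nu> r where "connected Nin" "Nin \<subseteq> W \<inter> interior B" "p \<in> closure Nin"
    "connected Nout" "Nout \<subseteq> W \<inter> - B" "p \<in> closure Nout" "0 < r"
    "\<And>y. 0 < y \<Longrightarrow> y < r \<Longrightarrow> p + of_real y * \<nu> \<in> Nin" "\<And>y. 0 < y \<Longrightarrow> y < r \<Longrightarrow> p - of_real y * \<nu> \<in> Nout"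
proof -
  note F = smooth_disk_facts[OF B]
  obtain \<gamma> t0 \<nu> \<delta> where cr: "crosses \<gamma> t0 \<nu> \<delta>" "\<gamma> t0 = p" "path_image \<gamma> = frontier B"
    using smooth_circle_crosses[OF F(2) p] by metis
  obtain N Np Nm r where N: "open N" "p \<in> N" "N \<subseteq> W" "connected Np" "connected Nm"
    "N - frontier B = Np \<union> Nm" "frontier B \<inter> N \<subseteq> closure Np \<inter> closure Nm" "0 < r"
    "\<And>y. 0 < y \<Longrightarrow> y < r \<Longrightarrow> p + of_real y * \<i> * \<nu> \<in> Np"
    "\<And>y. 0 < y \<Longrightarrow> y < r \<Longrightarrow> p - of_real y * \<i> * \<nu> \<in> Nm"
    using crosses_sides[OF cr(1), of W] W unfolding cr by metis
  have cl: "p \<in> closure Np" "p \<in> closure Nm" using N p by auto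
  have bd: "closed B" using F(1) compact_imp_closed by blast
  have sub: "S \<subseteq> interior B \<or> S \<subseteq> - B" if "connected S" "S \<inter> frontier B = {}" for S
  proof -
    have "S \<subseteq> B \<or> S \<inter> B = {}" by (rule connectehole_subset_or_disjoint_frontier[OF that])
    then show ?thesis using that bd by (auto simp: frontier_def)
  qed
  have "Np \<inter> frontier B = {}" "Nm \<inter> frontier B = {}" using N(6) by blast+
  note s = sub[OF N(4) this(1)] sub[OF N(5) this(2)]
  have "N \<inter> interior B \<noteq> {}" "N \<inter> - B \<noteq> {}"
    using N(1,2) F(7,8) p by (metis open_Int_closure_eq_empty disjoint_iff subsetD)+
  moreover have "interior B \<inter> frontier B = {}" "- B \<inter> frontier B = {}"
    using bd by (auto simp: frontier_def)
  moreover have "interior B \<subseteq> B" by (rule interior_subset)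
  ultimately have "(Np \<union> Nm) \<inter> interior B \<noteq> {}" "(Np \<union> Nm) \<inter> - B \<noteq> {}" unfolding N(6)[symmetric] by blast+
  then consider "Np \<subseteq> interior B" "Nm \<subseteq> - B" | "Nm \<subseteq> interior B" "Np \<subseteq> - B"
    using s \<open>interior B \<subseteq> B\<close> by blast
  then show ?thesis
  proof cases
    case 1
    show ?thesis by (rule that[of Np Nm r "\<i> * \<nu>"])
       (use 1 N cl in \<open>auto simp: mult.assoc\<close>)
  next
    case 2
    show ?thesis by (rule that[of Nm Np r "- \<i> * \<nu>"])
       (use 2 N cl in \<open>auto simp: mult.assoc\<close>)
  qed
qed

text \<open>A boundary point that is reached by a straight segment from \<open>U\<close> can be joined to any point of
  \<open>U\<close> by a path that stays in \<open>U\<close> up to its last moment.\<close>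
lemma access_path:
  fixes p \<nu> :: complex
  assumes "open U" "connected U" "c \<in> U" "0 < r" "\<And>y. 0 < y \<Longrightarrow> y < r \<Longrightarrow> p + of_real y * \<nu> \<in> U"
  obtains \<kappa> where "path \<kappa>" "pathstart \<kappa> = c" "pathfinish \<kappa> = p" "path_image \<kappa> \<subseteq> insert p U"
proof -
  define q where "q = p + of_real (r/2) * \<nu>"
  have "q \<in> U" unfolding q_def using assms(4) by (intro assms(5)) auto
  then obtain g where g: "path g" "path_image g \<subseteq> U" "pathstart g = c" "pathfinish g = q"
    using assms(1-3) by (metis connected_open_path_connected path_connected_def)
  have "closed_segment p q \<subseteq> insert p U"
  proof
    fix z assume "z \<in> closed_segment p q"
    then obtain u where u: "0 \<le> u" "u \<le> 1" "z = (1 - u) *\<^sub>R p + u *\<^sub>R q" by (auto simp: closed_segment_def)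
    then have z: "z = p + of_real (u * r / 2) * \<nu>" by (simp add: q_def scaleR_conv_of_real algebra_simps)
    show "z \<in> insert p U"
    proof (cases "u = 0")
      case False
      have "u * r \<le> 1 * r" using u assms by (intro mult_right_mono) auto
      with False u assms(4) show ?thesis unfolding z by (intro insertI2 assms(5)) auto
    qed (use z in simp)
  qed
  then show ?thesis using g
    by (intro that[of "g +++ linepath q p"]) (auto simp: path_image_join closed_segment_commute)
qed

text \<open>By Janiszewski's theorem, the union of two disjoint closed sets, one of them compact, separates the plane only if
  one of them does.\<close>
lemma connected_Compl_disjoint_union:
  fixes F :: "complex set set"
  assumes "finite F" "\<And>B. B \<in> F \<Longrightarrow> compact B \<and> connected (- B) \<and> B \<inter> K = {}" "pairwise disjnt F"
    "closed K" "connected (- K)"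
  shows "connected (- (\<Union>F \<union> K))"
  using assms(1-3)
proof (induction F)
  case (insert B F)
  have "B \<inter> (\<Union>F \<union> K) = {}"
    using insert.prems insert.hyps by (auto simp: pairwise_insert disjnt_def)
  moreover have "closed (\<Union>F \<union> K)" using insert.prems(1) insert.hyps(1) assms(4)
    by (intro closed_Un closed_Union) (auto simp: compact_imp_closed)
  moreover have "connected (- (\<Union>F \<union> K))" using insert by (simp add: pairwise_insert)
  ultimately have "connected (- (B \<union> (\<Union>F \<union> K)))"
    using insert.prems(1)[of B] by (intro Janiszewski_connected[of B "\<Union>F \<union> K"]) simp_all
  then show ?case by (simp add: Un_assoc)
qed (use assms in simp)

section \<open>Geometry of a tangle\<close>

text \<open>Sequences suffice here: together with continuity and the values \<open>1\<close> and \<open>-1\<close> they show that both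
  signs occur arbitrarily close to \<open>p\<close>.\<close>
definition sign_flip :: "(complex \<Rightarrow> complex) \<Rightarrow> complex set \<Rightarrow> complex \<Rightarrow> bool" where
  "sign_flip g s p \<longleftrightarrow> (\<exists>zp zm. zp \<longlonglongrightarrow> p \<and> zm \<longlonglongrightarrow> p \<and> (\<forall>n. zp n \<notin> s) \<and> (\<forall>n. zm n \<notin> s) \<and>
     (\<lambda>n. g (zp n) / g (zm n)) \<longlonglongrightarrow> -1)"

lemma sign_flip_mult:
  assumes "sign_flip g s p" "isCont f p" "f p \<noteq> 0"
  shows "sign_flip (\<lambda>z. g z * f z) s p"
proof -
  obtain zp zm where z: "zp \<longlonglongrightarrow> p" "zm \<longlonglongrightarrow> p" "\<forall>n. zp n \<notin> s" "\<forall>n. zm n \<notin> s"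
     "(\<lambda>n. g (zp n) / g (zm n)) \<longlonglongrightarrow> -1" using assms(1) unfolding sign_flip_def by blast
  have "(\<lambda>n. f (zp n)) \<longlonglongrightarrow> f p" "(\<lambda>n. f (zm n)) \<longlonglongrightarrow> f p"
    using z assms(2) isCont_tendsto_compose by blast+
  then have "(\<lambda>n. g (zp n) / g (zm n) * (f (zp n) / f (zm n))) \<longlonglongrightarrow> -1 * (f p / f p)"
    by (intro tendsto_intros z assms)
  then show ?thesis unfolding sign_flip_def using z assms(3) by (intro exI[of _ zp] exI[of _ zm]) simp
qed

text \<open>The strings run in the open set \<open>SS\<close> up to their end points; the regions are the components of
  \<open>RS\<close>, which also contains the boundary intervals.  \<open>X\<close> is the union of the strings and
  \<open>M\<close> is the set of all marked points.\<close>
locale planar_tangle =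
  fixes T :: tangle
  assumes tangle: "is_tangle T"
begin

abbreviation "SS \<equiv> string_space T"
abbreviation "RS \<equiv> region_space T"
abbreviation "X \<equiv> \<Union> (strings T)"
abbreviation "M \<equiv> all_marks T"

lemma marked_disks: "\<forall>d\<in>disks T. is_marked_disk d"
  and bodies_inside: "\<forall>d\<in>set (ins T). body d \<subseteq> interior (body (out T))"
  and bodies_disjoint: "\<forall>i<length (ins T). \<forall>j<length (ins T). i \<noteq> j \<longrightarrow> disjnt (body (ins T ! i)) (body (ins T ! j))"
  and finite_strings: "finite (strings T)"
  and pairwise_strings: "pairwise disjnt (strings T)"
  and string_shapes: "\<forall>s\<in>strings T. (smooth_circle s \<and> s \<subseteq> SS) \<or>
     (\<exists>a b. smooth_arc s a b \<and> a \<in> M \<and> b \<in> M \<and> s - {a, b} \<subseteq> SS)"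
  and marks_ends: "\<forall>m\<in>M. \<exists>!s. s \<in> strings T \<and> (\<exists>b. smooth_arc s m b)"
  using tangle unfolding is_tangle_def by - (elim conjE, assumption)+

lemma marked_disk: "d \<in> disks T \<Longrightarrow> is_marked_disk d"
  using marked_disks by blast

lemma disk: "d \<in> disks T \<Longrightarrow> smooth_disk (body d)"
  and finite_marks: "d \<in> disks T \<Longrightarrow> finite (marks d)"
  and marks_frontier: "d \<in> disks T \<Longrightarrow> marks d \<subseteq> frontier (body d)"
  and base_component: "d \<in> disks T \<Longrightarrow> base_interval d \<in> components (frontier (body d) - marks d)"
  using marked_disk unfolding is_marked_disk_def by blast+

lemma closed_disk: "d \<in> disks T \<Longrightarrow> closed (body d)"
  using smooth_disk_facts(1)[OF disk] compact_imp_closed by blast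

lemma out_disk [simp]: "out T \<in> disks T" and in_disk [simp]: "d \<in> set (ins T) \<Longrightarrow> d \<in> disks T"
  by (auto simp: disks_def)

lemma finite_disks: "finite (disks T)" by (simp add: disks_def)

lemma finite_all_marks: "finite M"
  unfolding all_marks_def using finite_disks finite_marks by blast

lemma body_subset: "d \<in> set (ins T) \<Longrightarrow> body d \<subseteq> interior (body (out T))"
  using bodies_inside by blast

lemma disjoint_nth: "i < length (ins T) \<Longrightarrow> j < length (ins T) \<Longrightarrow> i \<noteq> j \<Longrightarrow> body (ins T ! i) \<inter> body (ins T ! j) = {}"
  using bodies_disjoint unfolding disjnt_def by blast

lemma disjoint_ins: "d \<in> set (ins T) \<Longrightarrow> d' \<in> set (ins T) \<Longrightarrow> d \<noteq> d' \<Longrightarrow> body d \<inter> body d' = {}"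
  using disjoint_nth by (metis in_set_conv_nth)

lemma body_disjoint_out_frontier: "d \<in> set (ins T) \<Longrightarrow> body d \<inter> frontier (body (out T)) = {}"
  using body_subset by (auto simp: frontier_def)

lemma frontier_subset_body: "d \<in> disks T \<Longrightarrow> frontier (body d) \<subseteq> body d"
  using closed_disk by (simp add: frontier_subset_closed)

lemma frontier_disjoint: "d \<in> disks T \<Longrightarrow> d' \<in> disks T \<Longrightarrow> d \<noteq> d' \<Longrightarrow> frontier (body d) \<inter> frontier (body d') = {}"
  using disjoint_ins[of d d'] body_disjoint_out_frontier[of d] body_disjoint_out_frontier[of d']
    frontier_subset_body[of d] frontier_subset_body[of d'] unfolding disks_def by blast

lemma marks_disjoint: "d \<in> disks T \<Longrightarrow> d' \<in> disks T \<Longrightarrow> d \<noteq> d' \<Longrightarrow> marks d \<inter> marks d' = {}"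
  using frontier_disjoint marks_frontier by blast

lemma open_string_space: "open SS"
  unfolding string_space_def using closed_disk by (intro open_Diff closed_UN) auto

lemma frontier_string_space: "d \<in> disks T \<Longrightarrow> frontier (body d) \<inter> SS = {}"
  using frontier_subset_body unfolding string_space_def disks_def by (auto simp: frontier_def)

lemma marks_string_space: "M \<inter> SS = {}"
  using frontier_string_space marks_frontier unfolding all_marks_def by blast

lemma disjoint_strings: "s \<in> strings T \<Longrightarrow> s' \<in> strings T \<Longrightarrow> s \<noteq> s' \<Longrightarrow> s \<inter> s' = {}"
  using pairwise_strings unfolding pairwise_def disjnt_def by blast

lemma string_cases:
  assumes "s \<in> strings T"
  obtains "smooth_circle s" "s \<subseteq> SS"
  | a b where "smooth_arc s a b" "a \<in> M" "b \<in> M" "s - {a, b} \<subseteq> SS"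
  using bspec[OF string_shapes assms] by blast

lemma string_subset: "s \<in> strings T \<Longrightarrow> s \<subseteq> SS \<union> M"
  by (erule string_cases) blast+

lemma compact_string: "s \<in> strings T \<Longrightarrow> compact s"
  by (erule string_cases) (auto simp: smooth_circle_def smooth_arc_def intro: compact_simple_path_image compact_arc_image)

lemma compact_strings: "F \<subseteq> strings T \<Longrightarrow> compact (\<Union> F)"
  using compact_string finite_strings by (meson compact_Union finite_subset subsetD)

lemma marks_on_strings: "M \<subseteq> X"
proof
  fix m assume "m \<in> M"
  then obtain s b where "s \<in> strings T" "smooth_arc s m b" using ex1_implies_ex[OF bspec[OF marks_ends]] by blast
  then show "m \<in> X" unfolding smooth_arc_def using pathstart_in_path_image by blast
qed

lemma region_space_in_string_space: "RS \<inter> SS = SS - X"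
proof -
  have "SS \<subseteq> body (out T)" "d \<in> set (ins T) \<Longrightarrow> SS \<inter> interior (body d) = {}" for d
    unfolding string_space_def using interior_subset by blast+
  then show ?thesis unfolding region_space_def by blast
qed

lemma region_space_off_strings: "RS \<inter> X = {}"
  by (auto simp: region_space_def)

lemma region_space_frontier: "z \<in> RS \<Longrightarrow> z \<notin> SS \<Longrightarrow> \<exists>d\<in>disks T. z \<in> frontier (body d)"
  unfolding region_space_def string_space_def disks_def frontier_def using closed_disk by auto

lemma frontier_region_space: 
  assumes "d \<in> disks T" shows "frontier (body d) - marks d \<subseteq> RS"
proof
  fix z assume z: "z \<in> frontier (body d) - marks d"
  have "z \<in> body (out T)"
    using z assms frontier_subset_body[OF assms] body_subset interior_subset unfolding disks_def by blast
  moreover have "z \<notin> interior (body e)" if "e \<in> set (ins T)" for e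
  proof (cases "e = d")
    case True then show ?thesis using z by (simp add: frontier_def)
  next
    case False
    then have "z \<notin> body e"
      using z that assms disjoint_ins[OF that] body_disjoint_out_frontier[OF that] frontier_subset_body[OF assms] 
      unfolding disks_def by blast
    then show ?thesis using interior_subset by blast
  qed
  moreover have "z \<notin> X"
  proof
    assume "z \<in> X"
    then have "z \<in> M" using string_subset frontier_string_space[OF assms] z by blast
    then obtain e where e: "e \<in> disks T" "z \<in> marks e" unfolding all_marks_def by blast
    then have "z \<in> frontier (body e)" using marks_frontier by blast
    then show False using e z frontier_disjoint[OF assms e(1)] by blast
  qed
  ultimately show "z \<in> RS" unfolding region_space_def by blast
qed

lemma base_interval_subset: "d \<in> disks T \<Longrightarrow> base_interval d \<subseteq> RS"
  using base_component frontier_region_space in_components_subset by blast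

lemma base_interval_connected: "d \<in> disks T \<Longrightarrow> connected (base_interval d)"
  and base_interval_nonempty: "d \<in> disks T \<Longrightarrow> base_interval d \<noteq> {}"
  using base_component in_components_connected in_components_nonempty by blast+

lemma connected_string_space: "connected SS"
proof -
  let ?F = "body ` set (ins T)"
  have "connected (- (\<Union>?F \<union> - interior (body (out T))))"
  proof (rule connected_Compl_disjoint_union)
    show "compact B \<and> connected (- B) \<and> B \<inter> - interior (body (out T)) = {}" if "B \<in> ?F" for B
      using that smooth_disk_facts(1,4) disk in_disk body_subset by blast
    show "pairwise disjnt ?F" using disjoint_ins unfolding pairwise_def disjnt_def by blast
    show "connected (- (- interior (body (out T))))" using smooth_disk_facts(3)[OF disk[OF out_disk]] by simp
  qed auto
  moreover have "- (\<Union>?F \<union> - interior (body (out T))) = SS" unfolding string_space_def by auto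
  ultimately show ?thesis by simp
qed

lemma string_sides:
  assumes "p \<in> X" "p \<in> SS" "open W" "p \<in> W"
  obtains N Np Nm where "open N" "p \<in> N" "N \<subseteq> W" "N \<subseteq> SS" "connected Np" "connected Nm"
    "N - X = Np \<union> Nm" "X \<inter> N \<subseteq> closure Np \<inter> closure Nm"
proof -
  obtain s where s: "s \<in> strings T" "p \<in> s" using assms(1) by blast
  define W' where "W' = W \<inter> SS - \<Union> (strings T - {s})"
  have W': "open W'" unfolding W'_def
    by (intro open_Diff open_Int assms open_string_space compact_imp_closed compact_strings) auto
  have pW': "p \<in> W'" unfolding W'_def using assms s disjoint_strings by blast
  obtain \<gamma> t0 \<nu> \<delta> where cr: "crosses \<gamma> t0 \<nu> \<delta>" "\<gamma> t0 = p" "path_image \<gamma> = s"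
  proof (rule string_cases[OF s(1)])
    assume "smooth_circle s"
    then show ?thesis using smooth_circle_crosses s(2) that by metis
  next
    fix a b assume ab: "smooth_arc s a b" "a \<in> M" "b \<in> M"
    then have "p \<noteq> a" "p \<noteq> b" using assms(2) marks_string_space by blast+
    then show ?thesis using smooth_arc_crosses[OF ab(1) s(2)] that by metis
  qed
  obtain N Np Nm r where N: "open N" "p \<in> N" "N \<subseteq> W'" "connected Np" "connected Nm"
    "N - s = Np \<union> Nm" "s \<inter> N \<subseteq> closure Np \<inter> closure Nm"
    using crosses_sides[OF cr(1), of W'] W' pW' unfolding cr by metis
  have "X \<inter> N = s \<inter> N" "N - X = N - s" using N(3) s(1) unfolding W'_def by blast+
  with N show ?thesis by (intro that[of N Np Nm]) (auto simp: W'_def)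
qed

lemma strings_partition_marks: "M = (\<Union>s\<in>strings T. s \<inter> M)"
  using marks_on_strings by blast

text \<open>The product over \<open>s \<inter> M\<close> is \<open>(a - z)(b - z)\<close> for an arc from \<open>a\<close> to \<open>b\<close> and \<open>1\<close>
  for a closed string.  So the lemma says that each string contributes a square root of the inverse of
  the polynomial of its own end points, with a change of sign across the string.\<close>
lemma string_root:
  assumes "s \<in> strings T"
  obtains g where "\<And>z. z \<notin> s \<Longrightarrow> isCont g z" "\<And>z. z \<notin> s \<Longrightarrow> (g z)\<^sup>2 * (\<Prod>m\<in>s \<inter> M. m - z) = 1"
    "\<And>p. p \<in> s \<inter> SS \<Longrightarrow> sign_flip g s p" "even (card (s \<inter> M))"
  using assms
proof (cases rule: string_cases)
  case 1
  then obtain \<gamma> where g: "simple_path \<gamma>" "path_image \<gamma> = s" "pathfinish \<gamma> = pathstart \<gamma>"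
    unfolding smooth_circle_def pathstart_def pathfinish_def by (metis add_0)
  have "path \<gamma>" using g simple_path_imp_path by blast
  have e: "s \<inter> M = {}" using 1 marks_string_space by blast
  show ?thesis
  proof (rule that[of "half_turn \<gamma>"])
    fix z assume z: "z \<notin> s"
    show "isCont (half_turn \<gamma>) z" using isCont_half_turn \<open>path \<gamma>\<close> z g by metis
    have "pathstart \<gamma> - z \<noteq> 0" using z g by (metis eq_iff_diff_eq_0 pathstart_in_path_image)
    then show "(half_turn \<gamma> z)\<^sup>2 * (\<Prod>m\<in>s \<inter> M. m - z) = 1"
      using half_turn_square[OF \<open>path \<gamma>\<close>, of z] z g e by simp
  next
    fix p assume "p \<in> s \<inter> SS"
    then show "sign_flip (half_turn \<gamma>) s p"
      using half_turn_flips_loop[OF g(1,3), of p] g(2) unfolding sign_flip_def by (metis IntD1)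
  qed (simp add: e)
next
  case (2 a b)
  then obtain \<gamma> where g: "smooth_path \<gamma>" "arc \<gamma>" "pathstart \<gamma> = a" "pathfinish \<gamma> = b" "path_image \<gamma> = s"
    unfolding smooth_arc_def by blast
  have pg: "path \<gamma>" using g arc_imp_path by blast
  have "a \<noteq> b" using g arc_distinct_ends by metis
  have "a \<in> s" "b \<in> s" using g by auto
  then have e: "s \<inter> M = {a, b}" using 2 marks_string_space by blast
\<comment> \<open>Turns a root of \<open>(b - z) / (a - z)\<close> into a root of \<open>1 / ((a - z) (b - z))\<close>.\<close>
  define f where "f = (\<lambda>z. inverse (b - z))"
  have cf: "isCont f z" if "z \<noteq> b" for z unfolding f_def using that by (intro continuous_intros) auto
  show ?thesis
  proof (rule that[of "\<lambda>z. half_turn \<gamma> z * f z"])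
    fix z assume z: "z \<notin> s"
    then have zb: "z \<noteq> b" "z \<noteq> a" using \<open>a \<in> s\<close> \<open>b \<in> s\<close> by auto
    show "isCont (\<lambda>z. half_turn \<gamma> z * f z) z"
      using isCont_half_turn[OF pg, of z] z g cf[OF zb(1)] by (intro continuous_intros) auto
    have "(half_turn \<gamma> z)\<^sup>2 * (a - z) = b - z" using half_turn_square[OF pg, of z] z g by simp
    then have "(half_turn \<gamma> z * f z)\<^sup>2 * (\<Prod>m\<in>s \<inter> M. m - z) = (f z)\<^sup>2 * (b - z)\<^sup>2"
      using \<open>a \<noteq> b\<close> unfolding e by (simp add: power_mult_distrib power2_eq_square mult.assoc)
    then show "(half_turn \<gamma> z * f z)\<^sup>2 * (\<Prod>m\<in>s \<inter> M. m - z) = 1"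
      using zb by (simp add: f_def power_mult_distrib[symmetric])
  next
    fix p assume p: "p \<in> s \<inter> SS"
    then have pab: "p \<noteq> a" "p \<noteq> b" using 2 marks_string_space by blast+
    obtain t0 where t0: "t0 \<in> {0..1}" "\<gamma> t0 = p" using p g(5) unfolding path_image_def by auto
    have "t0 \<noteq> 0" "t0 \<noteq> 1" using t0 g pab unfolding pathstart_def pathfinish_def by auto
    then have "0 < t0" "t0 < 1" using t0 by auto
    moreover have "\<forall>t\<in>{0..1}. \<gamma> t = \<gamma> t0 \<longrightarrow> t = t0" using g(2) t0(1) unfolding arc_def inj_on_def by auto
    ultimately obtain \<nu> \<delta> where "crosses \<gamma> t0 \<nu> \<delta>" using smooth_path_crosses[OF g(1)] by metis
    from half_turn_flips_arc[OF this] have "sign_flip (half_turn \<gamma>) s p"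
      unfolding sign_flip_def t0 g by metis
    then show "sign_flip (\<lambda>z. half_turn \<gamma> z * f z) s p"
      by (rule sign_flip_mult) (use pab cf in \<open>auto simp: f_def\<close>)
  qed (use e \<open>a \<noteq> b\<close> in simp)
qed

text \<open>The strings pair up the marked points.  This forces the disk along which two tangles are composed to
  be even whenever all other disks are.\<close>
lemma even_sum_marks: "even (\<Sum>d\<in>disks T. card (marks d))"
proof -
  have "card M = (\<Sum>d\<in>disks T. card (marks d))"
    unfolding all_marks_def using finite_disks finite_marks marks_disjoint by (intro card_UN_disjoint) auto
  moreover have "card M = (\<Sum>s\<in>strings T. card (s \<inter> M))"
    by (subst strings_partition_marks, rule card_UN_disjoint)
      (use finite_strings finite_all_marks disjoint_strings in auto)
  moreover have "even (card (s \<inter> M))" if "s \<in> strings T" for s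
    by (rule string_root[OF that]) blast
  ultimately show ?thesis by (metis dvd_sum)
qed

text \<open>Each marked point \<open>m\<close> is joined to a centre \<open>c\<close> by a path on the side of the boundary circle
  that is turned away from the strings, which gives a square root of \<open>(m - z) / (c - z)\<close>.  The power of
  \<open>c - z\<close> in the product of these quotients is even, and so it has an obvious square root.\<close>
lemma disk_root:
  assumes d: "d \<in> disks T" and ev: "even (card (marks d))"
  obtains h where "\<And>z. z \<in> RS \<union> SS \<Longrightarrow> isCont h z" "\<And>z. z \<in> RS \<union> SS \<Longrightarrow> (h z)\<^sup>2 = (\<Prod>m\<in>marks d. m - z)"
proof -
  note F = smooth_disk_facts[OF disk[OF d]]
  obtain U where U: "open U" "connected U" "U \<noteq> {}" "U \<inter> (RS \<union> SS) = {}"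
    "\<And>m. m \<in> marks d \<Longrightarrow> \<exists>r>0. \<exists>\<nu>. \<forall>y. 0 < y \<longrightarrow> y < r \<longrightarrow> m + of_real y * \<nu> \<in> U"
  proof (cases "d = out T")
    case True
    show ?thesis
    proof (rule that[of "- body d"])
      fix m assume "m \<in> marks d"
      then have "m \<in> frontier (body d)" using marks_frontier d by blast
      then obtain Nout \<nu> r where "Nout \<subseteq> UNIV \<inter> - body d" "0 < r"
         "\<And>y. 0 < y \<Longrightarrow> y < r \<Longrightarrow> m - of_real y * \<nu> \<in> Nout"
        by (rule smooth_disk_sides[OF disk[OF d] _ open_UNIV UNIV_I]) blast
      then show "\<exists>r>0. \<exists>\<nu>. \<forall>y. 0 < y \<longrightarrow> y < r \<longrightarrow> m + of_real y * \<nu> \<in> - body d"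
        by (intro exI[of _ r] conjI exI[of _ "- \<nu>"]) auto
    next
      show "- body d \<inter> (RS \<union> SS) = {}"
        unfolding True region_space_def string_space_def using interior_subset by blast
    qed (use F closed_disk d in auto)
  next
    case False
    then have "d \<in> set (ins T)" using d by (auto simp: disks_def)
    show ?thesis
    proof (rule that[of "interior (body d)"])
      fix m assume "m \<in> marks d"
      then have "m \<in> frontier (body d)" using marks_frontier d by blast
      then obtain Nin \<nu> r where "Nin \<subseteq> UNIV \<inter> interior (body d)" "0 < r"
         "\<And>y. 0 < y \<Longrightarrow> y < r \<Longrightarrow> m + of_real y * \<nu> \<in> Nin"
        by (rule smooth_disk_sides[OF disk[OF d] _ open_UNIV UNIV_I]) blast
      then show "\<exists>r>0. \<exists>\<nu>. \<forall>y. 0 < y \<longrightarrow> y < r \<longrightarrow> m + of_real y * \<nu> \<in> interior (body d)"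
        by (intro exI[of _ r] conjI exI[of _ "\<nu>"]) auto
    next
      show "interior (body d) \<inter> (RS \<union> SS) = {}"
        using \<open>d \<in> set (ins T)\<close> unfolding region_space_def string_space_def using interior_subset by blast
    qed (use F in auto)
  qed
  obtain c where c: "c \<in> U" using U(3) by blast
  have "\<exists>\<kappa>. path \<kappa> \<and> pathstart \<kappa> = c \<and> pathfinish \<kappa> = m \<and> path_image \<kappa> \<subseteq> insert m U" if "m \<in> marks d" for m
    using U(5)[OF that] access_path[OF U(1,2) c, of _ m] by metis
  then obtain \<kappa> where k: "\<And>m. m \<in> marks d \<Longrightarrow> path (\<kappa> m) \<and> pathstart (\<kappa> m) = c \<and> pathfinish (\<kappa> m) = m \<and> path_image (\<kappa> m) \<subseteq> insert m U"
    by metis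
  have mV: "m \<notin> RS \<union> SS" if "m \<in> marks d" for m
  proof -
    have "m \<in> M" using that d unfolding all_marks_def by blast
    then show ?thesis using marks_string_space marks_on_strings unfolding region_space_def by blast
  qed
  have off: "z \<notin> path_image (\<kappa> m)" if "z \<in> RS \<union> SS" "m \<in> marks d" for z m
    using that k mV U(4) by blast
  define n where "n = card (marks d) div 2"
  have n: "card (marks d) = n + n" using ev by (auto simp: n_def)
  define h where "h = (\<lambda>z. (\<Prod>m\<in>marks d. half_turn (\<kappa> m) z) * (c - z) ^ n)"
  show ?thesis
  proof (rule that[of h])
    fix z assume z: "z \<in> RS \<union> SS"
    show "isCont h z" unfolding h_def
      using isCont_half_turn k off[OF z] by (intro continuous_intros continuous_prod) auto
    have "(h z)\<^sup>2 = (\<Prod>m\<in>marks d. (half_turn (\<kappa> m) z)\<^sup>2) * (\<Prod>m\<in>marks d. c - z)"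
      by (simp add: h_def power_mult_distrib prod_power_distrib n power_mult[symmetric] mult_2_right)
    also have "\<dots> = (\<Prod>m\<in>marks d. (half_turn (\<kappa> m) z)\<^sup>2 * (c - z))" by (simp add: prod.distrib)
    also have "\<dots> = (\<Prod>m\<in>marks d. m - z)"
      using half_turn_square k off[OF z] by (intro prod.cong refl) metis
    finally show "(h z)\<^sup>2 = (\<Prod>m\<in>marks d. m - z)" .
  qed
qed

end


section \<open>Alternating colourings and shadings\<close>

text \<open>The last condition is the local form of the checkerboard condition: both colours occur arbitrarily
  close to each interior point of each string.  It mentions neither regions nor the sides of a string,
  and therefore it passes to the parts of a composite and along homeomorphisms.\<close>
definition alternating :: "tangle \<Rightarrow> complex set \<Rightarrow> bool" where
  "alternating T B \<longleftrightarrow>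
     B \<subseteq> region_space T \<and>
     (\<forall>C. connected C \<longrightarrow> C \<subseteq> region_space T \<longrightarrow> C \<subseteq> B \<or> disjnt C B) \<and>
     \<Union> (strings T) \<inter> string_space T \<subseteq> closure B \<inter> closure (region_space T - B)"

lemma alternatingD:
  assumes "alternating T B"
  shows "B \<subseteq> region_space T"
    "connected C \<Longrightarrow> C \<subseteq> region_space T \<Longrightarrow> C \<subseteq> B \<or> disjnt C B"
    "p \<in> \<Union> (strings T) \<Longrightarrow> p \<in> string_space T \<Longrightarrow> p \<in> closure B \<and> p \<in> closure (region_space T - B)"
  using assms unfolding alternating_def by blast+

definition even_tangle :: "tangle \<Rightarrow> bool" where
  "even_tangle T \<longleftrightarrow> is_tangle T \<and> (\<forall>d\<in>disks T. even (card (marks d)))"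

context planar_tangle
begin

text \<open>The product \<open>\<sigma>\<close> of the roots of all strings and of all disks squares to one, since each marked
  point lies on exactly one string and on exactly one disk.  It is continuous on the region space, and
  near an interior point of a string only the factor of that string is discontinuous, with a change of
  sign.\<close>
lemma exists_alternating:
  assumes ev: "\<And>d. d \<in> disks T \<Longrightarrow> even (card (marks d))"
  shows "\<exists>B. alternating T B"
proof -
  have "\<exists>g. (\<forall>z. z \<notin> s \<longrightarrow> isCont g z \<and> (g z)\<^sup>2 * (\<Prod>m\<in>s \<inter> M. m - z) = 1) \<and> (\<forall>p\<in>s \<inter> SS. sign_flip g s p)"
    if "s \<in> strings T" for s
    by (rule string_root[OF that]) blast
  then obtain g where g: "\<And>s z. s \<in> strings T \<Longrightarrow> z \<notin> s \<Longrightarrow> isCont (g s) z \<and> (g s z)\<^sup>2 * (\<Prod>m\<in>s \<inter> M. m - z) = 1"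
    "\<And>s p. s \<in> strings T \<Longrightarrow> p \<in> s \<inter> SS \<Longrightarrow> sign_flip (g s) s p" by metis
  have "\<exists>h. \<forall>z\<in>RS \<union> SS. isCont h z \<and> (h z)\<^sup>2 = (\<Prod>m\<in>marks d. m - z)" if "d \<in> disks T" for d
    by (rule disk_root[OF that ev[OF that]]) blast
  then obtain h where h: "\<And>d z. d \<in> disks T \<Longrightarrow> z \<in> RS \<union> SS \<Longrightarrow> isCont (h d) z \<and> (h d z)\<^sup>2 = (\<Prod>m\<in>marks d. m - z)"
    by metis
  define \<sigma> where "\<sigma> = (\<lambda>z. (\<Prod>s\<in>strings T. g s z) * (\<Prod>d\<in>disks T. h d z))"
  have offX: "z \<notin> s" if "z \<in> RS" "s \<in> strings T" for z s using that region_space_off_strings by blast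
  have cont: "isCont \<sigma> z" if "z \<in> RS" for z
    unfolding \<sigma>_def using g(1)[OF _ offX[OF that]] h that by (intro continuous_mult continuous_prod) blast+
  have prods: "(\<Prod>d\<in>disks T. \<Prod>m\<in>marks d. m - z) = (\<Prod>s\<in>strings T. \<Prod>m\<in>s \<inter> M. m - z)" for z :: complex
  proof -
    have "(\<Prod>d\<in>disks T. \<Prod>m\<in>marks d. m - z) = (\<Prod>m\<in>M. m - z)"
      unfolding all_marks_def using finite_disks finite_marks marks_disjoint
      by (intro prod.UNION_disjoint[symmetric]) auto
    also have "\<dots> = (\<Prod>s\<in>strings T. \<Prod>m\<in>s \<inter> M. m - z)"
      by (subst strings_partition_marks, rule prod.UNION_disjoint)
        (use finite_strings finite_all_marks disjoint_strings in auto)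
    finally show ?thesis .
  qed
  have sq: "(\<sigma> z)\<^sup>2 = 1" if "z \<in> RS" for z
  proof -
    have "(\<sigma> z)\<^sup>2 = (\<Prod>s\<in>strings T. (g s z)\<^sup>2) * (\<Prod>d\<in>disks T. (h d z)\<^sup>2)"
      by (simp add: \<sigma>_def power_mult_distrib prod_power_distrib)
    also have "\<dots> = (\<Prod>s\<in>strings T. (g s z)\<^sup>2) * (\<Prod>s\<in>strings T. \<Prod>m\<in>s \<inter> M. m - z)"
      using h that prods[of z] by simp
    also have "\<dots> = (\<Prod>s\<in>strings T. (g s z)\<^sup>2 * (\<Prod>m\<in>s \<inter> M. m - z))" by (simp add: prod.distrib)
    also have "\<dots> = 1" using g(1) offX[OF that] by (intro prod.neutral) blast
    finally show ?thesis .
  qed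
  have pm: "\<sigma> z = 1 \<or> \<sigma> z = -1" if "z \<in> RS" for z using sq[OF that] by (simp add: power2_eq_1_iff)
  define B where "B = {z \<in> RS. \<sigma> z = 1}"
  have "C \<subseteq> B \<or> disjnt C B" if C: "connected C" "C \<subseteq> RS" for C
  proof -
    have "continuous_on C \<sigma>" using cont C(2) by (intro continuous_at_imp_continuous_on) blast
    moreover have "\<sigma> ` C \<subseteq> {1, -1}" using pm C(2) by blast
    then have "finite (\<sigma> ` C)" by (rule finite_subset) simp
    ultimately have "\<sigma> constant_on C" using continuous_finite_range_constant C(1) by blast
    then obtain c where "\<And>z. z \<in> C \<Longrightarrow> \<sigma> z = c" unfolding constant_on_def by blast
    then show ?thesis unfolding B_def disjnt_def using C(2) by (cases "c = 1") auto
  qed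
  moreover have "p \<in> closure B \<and> p \<in> closure (RS - B)" if p: "p \<in> X" "p \<in> SS" for p
  proof -
    obtain s where s: "s \<in> strings T" "p \<in> s" using p by blast
\<comment> \<open>All factors of \<open>\<sigma>\<close> except that of the string through \<open>p\<close>.\<close>
    define f where "f = (\<lambda>z. (\<Prod>s\<in>strings T - {s}. g s z) * (\<Prod>d\<in>disks T. h d z))"
    have \<sigma>f: "\<sigma> = (\<lambda>z. g s z * f z)"
      unfolding \<sigma>_def f_def using s finite_strings by (simp add: prod.remove[of _ s] mult.assoc)
    have off: "p \<notin> s'" if "s' \<in> strings T - {s}" for s' using that s disjoint_strings by blast
    have "isCont f p" unfolding f_def
      using g(1)[OF _ off] h p(2) by (intro continuous_mult continuous_prod) blast+
    have "g s' p \<noteq> 0" if "s' \<in> strings T - {s}" for s'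
      using g(1)[OF _ off[OF that]] that by fastforce
    moreover have "h d p \<noteq> 0" if "d \<in> disks T" for d
    proof -
      have "m \<noteq> p" if "m \<in> marks d" for m using that \<open>d \<in> disks T\<close> p(2) marks_string_space unfolding all_marks_def by blast
      then have "(\<Prod>m\<in>marks d. m - p) \<noteq> 0" using finite_marks[OF that] by auto
      then show ?thesis using h[OF that, of p] p(2) by fastforce
    qed
    ultimately have "f p \<noteq> 0" unfolding f_def using finite_strings finite_disks by auto
    then have "sign_flip \<sigma> s p" unfolding \<sigma>f using s p g(2) \<open>isCont f p\<close> by (intro sign_flip_mult) auto
    then obtain zp zm where z: "zp \<longlonglongrightarrow> p" "zm \<longlonglongrightarrow> p" "\<And>n. zp n \<notin> s" "\<And>n. zm n \<notin> s"
      "(\<lambda>n. \<sigma> (zp n) / \<sigma> (zm n)) \<longlonglongrightarrow> -1" unfolding sign_flip_def by blast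
    define W where "W = SS - \<Union> (strings T - {s})"
    have W: "open W" "p \<in> W" unfolding W_def using p off
      by (auto intro!: open_Diff open_string_space compact_imp_closed compact_strings)
    have ne: "W \<inter> U \<inter> B \<noteq> {} \<and> W \<inter> U \<inter> (RS - B) \<noteq> {}" if U: "open U" "p \<in> U" for U
    proof -
      have "\<forall>\<^sub>F n in sequentially. zp n \<in> W \<inter> U" "\<forall>\<^sub>F n in sequentially. zm n \<in> W \<inter> U"
        using topological_tendstoD[OF z(1) open_Int[OF W(1) U(1)]] topological_tendstoD[OF z(2) open_Int[OF W(1) U(1)]] W(2) U(2)
        by simp_all
      moreover have "\<forall>\<^sub>F n in sequentially. dist (\<sigma> (zp n) / \<sigma> (zm n)) (-1) < 1"
        using z(5) by (rule tendstoD) simp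
      ultimately have "\<forall>\<^sub>F n in sequentially. zp n \<in> W \<inter> U \<and> zm n \<in> W \<inter> U \<and> dist (\<sigma> (zp n) / \<sigma> (zm n)) (-1) < 1"
        by eventually_elim auto
      then obtain n where n: "zp n \<in> W \<inter> U" "zm n \<in> W \<inter> U" "dist (\<sigma> (zp n) / \<sigma> (zm n)) (-1) < 1"
        by (auto simp: eventually_sequentially)
      have "W - s = SS - X" unfolding W_def using s by blast
      then have RSn: "zp n \<in> RS" "zm n \<in> RS" using n z(3,4) region_space_in_string_space by blast+
      have "\<sigma> (zp n) \<noteq> \<sigma> (zm n)"
      proof
        assume "\<sigma> (zp n) = \<sigma> (zm n)"
        moreover have "\<sigma> (zm n) \<noteq> 0" using pm[OF RSn(2)] by auto
        ultimately show False using n(3) by (simp add: dist_norm)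
      qed
      then have "zp n \<in> B \<and> zm n \<in> RS - B \<or> zm n \<in> B \<and> zp n \<in> RS - B"
        using pm[OF RSn(1)] pm[OF RSn(2)] RSn unfolding B_def by auto
      then show ?thesis using n by blast
    qed
    have "p \<in> closure B" using ne[of "- closure B"] closure_subset[of B] by (auto simp: open_Compl)
    moreover have "p \<in> closure (RS - B)" using ne[of "- closure (RS - B)"] closure_subset[of "RS - B"] by (auto simp: open_Compl)
    ultimately show ?thesis ..
  qed
  ultimately have "alternating T B" unfolding alternating_def B_def by blast
  then show ?thesis by blast
qed

text \<open>Each of the two local sides has a single colour, and both colours occur near \<open>p\<close>.\<close>
lemma alternating_sides:
  assumes B: "alternating T B" and p: "p \<in> X" "p \<in> SS" and N: "open N" "p \<in> N" "N \<subseteq> SS"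
    "connected Np" "connected Nm" "N - X = Np \<union> Nm"
  shows "Np \<subseteq> RS" "Nm \<subseteq> RS" "Np \<subseteq> B \<and> Nm \<inter> B = {} \<or> Nm \<subseteq> B \<and> Np \<inter> B = {}"
proof -
  have sub: "Np \<subseteq> RS" "Nm \<subseteq> RS" using N region_space_in_string_space by blast+
  show "Np \<subseteq> RS" "Nm \<subseteq> RS" by (fact sub)+
  have "N \<inter> B \<noteq> {}" "N \<inter> (RS - B) \<noteq> {}"
    using alternatingD(3)[OF B p] N(1,2) open_Int_closure_eq_empty by blast+
  moreover have "N \<inter> RS = Np \<union> Nm" using N region_space_in_string_space by blast
  ultimately show "Np \<subseteq> B \<and> Nm \<inter> B = {} \<or> Nm \<subseteq> B \<and> Np \<inter> B = {}"
    using alternatingD(2)[OF B N(4) sub(1)] alternatingD(2)[OF B N(5) sub(2)] alternatingD(1)[OF B]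
    unfolding disjnt_def by blast
qed

text \<open>A region could conceivably consist of boundary points of disks only; this is excluded by the side of
  the boundary circle that is turned towards the strings.\<close>
lemma region_space_inner_point:
  assumes "z \<in> RS"
  obtains C where "connected C" "C \<subseteq> RS" "z \<in> C" "C \<inter> SS \<noteq> {}"
proof (cases "z \<in> SS")
  case True
  show ?thesis by (rule that[of "{z}"]) (use True assms in auto)
next
  case False
  then obtain d where d: "d \<in> disks T" "z \<in> frontier (body d)" using region_space_frontier assms by blast
  define W where "W = - X \<inter> (if d = out T then - (\<Union>e\<in>set (ins T). body e)
     else interior (body (out T)) - (\<Union>e\<in>set (ins T) - {d}. body e))"
  have "open W" unfolding W_def
    using compact_strings[of "strings T"] closed_disk
    by (auto intro!: open_Int open_Diff closed_UN simp: open_Compl compact_imp_closed)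
  have zX: "z \<notin> X" using assms region_space_off_strings by blast
  have "z \<in> W"
  proof (cases "d = out T")
    case True
    then show ?thesis unfolding W_def using zX d body_disjoint_out_frontier by auto
  next
    case False
    then have din: "d \<in> set (ins T)" using d by (auto simp: disks_def)
    have "z \<in> body d" using frontier_subset_body[OF d(1)] d(2) by blast
    then have "z \<in> interior (body (out T))" "\<forall>e\<in>set (ins T) - {d}. z \<notin> body e"
      using body_subset[OF din] disjoint_ins[OF din] by blast+
    then show ?thesis unfolding W_def using zX False by simp
  qed
  obtain Nin Nout where N: "connected Nin" "Nin \<subseteq> W \<inter> interior (body d)" "z \<in> closure Nin"
    "connected Nout" "Nout \<subseteq> W \<inter> - body d" "z \<in> closure Nout"
    using smooth_disk_sides[OF disk[OF d(1)] d(2) \<open>open W\<close> \<open>z \<in> W\<close>] by metis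
  obtain N where N': "connected N" "z \<in> closure N" "N \<subseteq> SS - X"
  proof (cases "d = out T")
    case True
    show ?thesis by (rule that[OF N(1,3)]) (use N(2) True in \<open>auto simp: W_def string_space_def\<close>)
  next
    case False
    have "Nout \<subseteq> SS - X" using N(5) unfolding W_def string_space_def if_not_P[OF False] by blast
    then show ?thesis by (rule that[OF N(4,6)])
  qed
  have "N \<noteq> {}" using N'(2) by auto
  show ?thesis
  proof (rule that[of "insert z N"])
    show "connected (insert z N)" by (rule connected_intermediate_closure[OF N'(1)]) (use N'(2) closure_subset in auto)
    show "insert z N \<subseteq> RS" using assms N'(3) region_space_in_string_space by blast
  qed (use N' \<open>N \<noteq> {}\<close> in auto)
qed

text \<open>Whether the two colourings agree does not change across a string, because both of them flip there.  As
  the string space is connected, they agree everywhere or nowhere.\<close>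
lemma alternating_unique:
  assumes A: "alternating T A" and B: "alternating T B"
  shows "A = B \<or> A = RS - B"
proof -
  define E where "E = {z. z \<in> A \<longleftrightarrow> z \<in> B}"
\<comment> \<open>The points near which the two colourings agree off the strings, and those near which they differ.\<close>
  define U where "U = {p \<in> SS. \<exists>N. open N \<and> p \<in> N \<and> N \<subseteq> SS \<and> N - X \<subseteq> E}"
  define V where "V = {p \<in> SS. \<exists>N. open N \<and> p \<in> N \<and> N \<subseteq> SS \<and> (N - X) \<inter> E = {}}"
  have cv: "p \<in> U \<or> p \<in> V" if p: "p \<in> SS" for p
  proof (cases "p \<in> X")
    case True
    obtain N Np Nm where N: "open N" "p \<in> N" "N \<subseteq> SS" "connected Np" "connected Nm" "N - X = Np \<union> Nm"
      using string_sides[OF True p open_UNIV UNIV_I] by metis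
    have "N - X \<subseteq> E \<or> (N - X) \<inter> E = {}"
      using alternating_sides(3)[OF A True p N] alternating_sides(3)[OF B True p N] unfolding N(6) E_def by blast
    then show ?thesis unfolding U_def V_def using p N by blast
  next
    case False
    have "open (SS - X)" by (intro open_Diff open_string_space compact_imp_closed compact_strings) auto
    then obtain e where e: "e > 0" "ball p e \<subseteq> SS - X" using p False open_contains_ball by (metis Diff_iff)
    have "ball p e \<subseteq> RS" using e region_space_in_string_space by blast
    then have "ball p e - X \<subseteq> E \<or> (ball p e - X) \<inter> E = {}"
      using alternatingD(2)[OF A connected_ball] alternatingD(2)[OF B connected_ball] unfolding E_def disjnt_def by blast
    moreover have "open (ball p e)" "p \<in> ball p e" "ball p e \<subseteq> SS" using e by auto
    ultimately show ?thesis unfolding U_def V_def using p by blast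
  qed
  have "open U" unfolding U_def
    by (subst open_subopen) blast
  have "open V" unfolding V_def
    by (subst open_subopen) blast
  have dense: "N - X \<noteq> {}" if "open N" "p \<in> N" "N \<subseteq> SS" for N p
  proof (cases "p \<in> X")
    case True
    then have "N \<inter> A \<noteq> {}" using alternatingD(3)[OF A True] that open_Int_closure_eq_empty by blast
    then show ?thesis using alternatingD(1)[OF A] region_space_off_strings by blast
  qed (use that in blast)
  have "U \<inter> V = {}"
  proof (rule ccontr)
    assume "U \<inter> V \<noteq> {}"
    then obtain p N N' where "open N" "p \<in> N" "N \<subseteq> SS" "N - X \<subseteq> E" "open N'" "p \<in> N'" "(N' - X) \<inter> E = {}"
      unfolding U_def V_def by blast
    then show False using dense[of "N \<inter> N'" p] by blast
  qed
  then have "SS \<subseteq> U \<or> SS \<subseteq> V"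
    using connectedD[OF connected_string_space \<open>open U\<close> \<open>open V\<close>] cv by blast
  then have inner: "SS - X \<subseteq> E \<or> (SS - X) \<inter> E = {}" unfolding U_def V_def by blast
  have rel: "(z \<in> A \<longleftrightarrow> z \<in> B) \<longleftrightarrow> SS - X \<subseteq> E" if z: "z \<in> RS" for z
  proof -
    obtain C where C: "connected C" "C \<subseteq> RS" "z \<in> C" "C \<inter> SS \<noteq> {}" using region_space_inner_point[OF z] .
    then obtain w where w: "w \<in> C" "w \<in> SS - X" using region_space_in_string_space by blast
    have "z \<in> E \<longleftrightarrow> w \<in> E"
      using alternatingD(2)[OF A C(1,2)] alternatingD(2)[OF B C(1,2)] C(3) w(1) unfolding E_def disjnt_def by blast
    then show ?thesis using inner w by (auto simp: E_def)
  qed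
  show ?thesis
  proof (cases "SS - X \<subseteq> E")
    case True
    then have "A = B" using rel alternatingD(1)[OF A] alternatingD(1)[OF B] by blast
    then show ?thesis ..
  next
    case False
    then have "A = RS - B" using rel alternatingD(1)[OF A] alternatingD(1)[OF B] by blast
    then show ?thesis ..
  qed
qed

lemma string_interior_connected:
  assumes "s \<in> strings T"
  shows "connected (s \<inter> SS)" "s \<subseteq> closure (s \<inter> SS)" "s \<inter> SS \<noteq> {}"
proof -
  have "connected (s \<inter> SS) \<and> s \<subseteq> closure (s \<inter> SS) \<and> s \<inter> SS \<noteq> {}"
    using assms
  proof (cases rule: string_cases)
    case 1
    then have "s \<inter> SS = s" by blast
    moreover obtain \<gamma> where "simple_path \<gamma>" "path_image \<gamma> = s" using 1 unfolding smooth_circle_def by blast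
    ultimately show ?thesis using connected_simple_path_image path_image_nonempty closure_subset by metis
  next
    case (2 a b)
    then obtain \<gamma> where g: "arc \<gamma>" "pathstart \<gamma> = a" "pathfinish \<gamma> = b" "path_image \<gamma> = s" "path \<gamma>"
      unfolding smooth_arc_def using arc_imp_path by blast
    have e: "s \<inter> SS = s - {a, b}" using 2 marks_string_space by blast
    have im: "s - {a, b} = \<gamma> ` {0<..<1}"
    proof -
      have "s = \<gamma> ` {0..1}" "a = \<gamma> 0" "b = \<gamma> 1" using g unfolding path_image_def pathstart_def pathfinish_def by auto
      moreover have "{0..1::real} = insert 0 (insert 1 {0<..<1})" by auto
      moreover have "\<gamma> 0 \<notin> \<gamma> ` {0<..<1}" "\<gamma> 1 \<notin> \<gamma> ` {0<..<1}"
        using g(1) unfolding arc_def inj_on_def by fastforce+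
      ultimately show ?thesis by auto
    qed
    have c: "continuous_on {0..1} \<gamma>" using g(5) by (simp add: path_def)
    have "connected (\<gamma> ` {0<..<1})"
      by (rule connected_continuous_image[OF continuous_on_subset[OF c]]) auto
    moreover have "s \<subseteq> closure (\<gamma> ` {0<..<1})"
    proof -
      have "\<gamma> ` closure {0<..<1} \<subseteq> closure (\<gamma> ` {0<..<1})"
        by (rule image_closure_subset[OF _ closed_closure closure_subset]) (use c in simp)
      then show ?thesis using g(4) unfolding path_image_def by simp
    qed
    moreover have "\<gamma> ` {0<..<1} \<noteq> {}" by simp
    ultimately show ?thesis unfolding e im by simp
  qed
  then show "connected (s \<inter> SS)" "s \<subseteq> closure (s \<inter> SS)" "s \<inter> SS \<noteq> {}" by blast+
qed

text \<open>The points of the string that border \<open>C\<close> form a closed subset of its interior.  It is also open: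
  if \<open>C\<close> borders on \<open>s\<close> at a point, it contains one of the two local sides, which borders on all
  nearby points of \<open>s\<close>.\<close>
lemma region_borders_whole_string:
  assumes C: "C \<in> regions T" and s: "s \<in> strings T" and p: "p \<in> s" "p \<in> SS" "p \<in> closure C"
  shows "s \<subseteq> closure C"
proof -
  have "\<exists>N. open N \<and> q \<in> N \<and> (N \<inter> s \<subseteq> closure C)" if q: "q \<in> s \<inter> SS" "q \<in> closure C" for q
  proof -
    obtain N Np Nm where N: "open N" "q \<in> N" "N \<subseteq> SS" "connected Np" "connected Nm" "N - X = Np \<union> Nm" 
      "X \<inter> N \<subseteq> closure Np \<inter> closure Nm"
      using string_sides[of q UNIV] q s by (metis IntE UnionI UNIV_I open_UNIV)
    have sub: "Np \<subseteq> RS" "Nm \<subseteq> RS" using N region_space_in_string_space by blast+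
    have "N \<inter> C \<noteq> {}" using q(2) N(1,2) open_Int_closure_eq_empty by blast
    moreover have "C \<subseteq> RS" using C in_components_subset unfolding regions_def by blast
    ultimately have "(Np \<union> Nm) \<inter> C \<noteq> {}" using region_space_off_strings unfolding N(6)[symmetric] by blast
    then have "Np \<inter> C \<noteq> {} \<or> Nm \<inter> C \<noteq> {}" by blast
    moreover have "S \<subseteq> C" if "S \<inter> C \<noteq> {}" "connected S" "S \<subseteq> RS" for S
      using components_maximal[of C RS S] C that unfolding regions_def by (simp add: inf_commute)
    ultimately have "Np \<subseteq> C \<or> Nm \<subseteq> C" using N sub by blast
    then have "X \<inter> N \<subseteq> closure C" using N(7) closure_mono by blast
    then show ?thesis using N(1,2) s by blast
  qed
  then obtain W where W: "\<And>q. q \<in> s \<inter> SS \<inter> closure C \<Longrightarrow> open (W q) \<and> q \<in> W q \<and> W q \<inter> s \<subseteq> closure C"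
    by (metis IntE)
  define U where "U = (\<Union>q\<in>s \<inter> SS \<inter> closure C. W q)"
  have "open U" using W by (auto simp: U_def)
  have cover: "s \<inter> SS \<subseteq> U \<union> - closure C" using W by (auto simp: U_def)
  have "U \<inter> s \<subseteq> closure C" using W by (auto simp: U_def)
  then have "U \<inter> - closure C \<inter> (s \<inter> SS) = {}" by blast
  moreover have "U \<inter> (s \<inter> SS) \<noteq> {}" using p W by (auto simp: U_def)
  moreover have "open (- closure C)" by auto
  ultimately have "- closure C \<inter> (s \<inter> SS) = {}"
    using connectedD[OF string_interior_connected(1)[OF s] \<open>open U\<close> _ _ cover] by blast
  then have "s \<inter> SS \<subseteq> closure C" by blast
  then have "closure (s \<inter> SS) \<subseteq> closure C" by (simp add: closure_minimal)
  then show ?thesis using string_interior_connected(2)[OF s] by blast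
qed

text \<open>An alternating set gives adjacent regions opposite colours, since two different regions at a point
  of a string contain different local sides.  Conversely, the two sides of a string always belong to
  different regions, as an alternating set (which exists by evenness) tells them apart; these regions
  both border on the whole string, so they are adjacent and a shading gives them opposite colours.\<close>
lemma shading_iff_alternating:
  assumes ev: "\<And>d. d \<in> disks T \<Longrightarrow> even (card (marks d))"
  shows "is_shaded_tangle \<lparr>tangle_of = T, shade = B\<rparr> \<longleftrightarrow> alternating T B"
proof
  assume A: "alternating T B"
  have reg: "C \<subseteq> B \<or> disjnt C B" "C \<subseteq> RS" if "C \<in> regions T" for C
  proof -
    have "connected C" using that in_components_connected unfolding regions_def by blast
    moreover show "C \<subseteq> RS" using that in_components_subset unfolding regions_def by blast
    ultimately show "C \<subseteq> B \<or> disjnt C B" using alternatingD(2)[OF A] by blast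
  qed
  have "C \<subseteq> B \<longleftrightarrow> \<not> C' \<subseteq> B" if C: "C \<in> regions T" "C' \<in> regions T" "adjacent T C C'" for C C'
  proof -
    obtain s where s: "s \<in> strings T" "s \<subseteq> closure C \<inter> closure C'" "C \<noteq> C'" using C(3) unfolding adjacent_def by blast
    obtain p where p: "p \<in> s" "p \<in> SS" using string_interior_connected(3)[OF s(1)] by blast
    then have pX: "p \<in> X" using s by blast
    obtain N Np Nm where N: "open N" "p \<in> N" "N \<subseteq> SS" "connected Np" "connected Nm" "N - X = Np \<union> Nm"
      and clos: "X \<inter> N \<subseteq> closure Np \<inter> closure Nm"
      using string_sides[OF pX p(2) open_UNIV UNIV_I] by metis
    have "p \<in> closure Np" "p \<in> closure Nm" using clos N(2) pX by blast+
    then have ne: "Np \<noteq> {}" "Nm \<noteq> {}" by auto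
    note sides = alternating_sides[OF A pX p(2) N]
    have *: "Np \<subseteq> D \<or> Nm \<subseteq> D" if D: "D \<in> regions T" "p \<in> closure D" for D
    proof -
      have "N \<inter> D \<noteq> {}" using D(2) N(1,2) open_Int_closure_eq_empty by blast
      then have "(Np \<union> Nm) \<inter> D \<noteq> {}" using reg(2)[OF D(1)] region_space_off_strings unfolding N(6)[symmetric] by blast
      then have "Np \<inter> D \<noteq> {} \<or> Nm \<inter> D \<noteq> {}" by blast
      moreover have "S \<subseteq> D" if "S \<inter> D \<noteq> {}" "connected S" "S \<subseteq> RS" for S
        using components_maximal[of D RS S] D(1) that unfolding regions_def by (simp add: inf_commute)
      ultimately show ?thesis using N sides by blast
    qed
    have "C \<inter> C' = {}" using components_nonoverlap[of C RS C'] C s(3) unfolding regions_def by blast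
    then consider "Np \<subseteq> C" "Nm \<subseteq> C'" | "Np \<subseteq> C'" "Nm \<subseteq> C"
      using *[OF C(1)] *[OF C(2)] p s ne by blast
    then show ?thesis
    proof cases
      case 1
      then show ?thesis using sides(3) reg(1)[OF C(1)] reg(1)[OF C(2)] ne unfolding disjnt_def by blast
    next
      case 2
      then show ?thesis using sides(3) reg(1)[OF C(1)] reg(1)[OF C(2)] ne unfolding disjnt_def by blast
    qed
  qed
  then show "is_shaded_tangle \<lparr>tangle_of = T, shade = B\<rparr>"
    unfolding is_shaded_tangle_def using tangle ev alternatingD(1)[OF A] reg by simp
next
  assume S: "is_shaded_tangle \<lparr>tangle_of = T, shade = B\<rparr>"
  obtain A where A: "alternating T A" using exists_alternating ev by blast
  from S have B: "B \<subseteq> RS" "\<And>C. C \<in> regions T \<Longrightarrow> C \<subseteq> B \<or> disjnt C B"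
    "\<And>C C'. C \<in> regions T \<Longrightarrow> C' \<in> regions T \<Longrightarrow> adjacent T C C' \<Longrightarrow> C \<subseteq> B \<longleftrightarrow> \<not> C' \<subseteq> B"
    unfolding is_shaded_tangle_def by simp_all
  have reg: "\<exists>C\<in>regions T. S \<subseteq> C" if "connected S" "S \<subseteq> RS" "S \<noteq> {}" for S
    using exists_component_superset[OF that(2) _ that(1)] that(2,3) unfolding regions_def by blast
  have conn: "S \<subseteq> B \<or> disjnt S B" if "connected S" "S \<subseteq> RS" for S
    using reg[OF that] B(2) unfolding disjnt_def by blast
  have "p \<in> closure B \<and> p \<in> closure (RS - B)" if p: "p \<in> X" "p \<in> SS" for p
  proof -
    obtain s where s: "s \<in> strings T" "p \<in> s" using p by blast
    obtain N Np Nm where N: "open N" "p \<in> N" "N \<subseteq> SS" "connected Np" "connected Nm" "N - X = Np \<union> Nm"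
      "X \<inter> N \<subseteq> closure Np \<inter> closure Nm"
      using string_sides[OF p open_UNIV UNIV_I] by metis
    note sides = alternating_sides[OF A p N(1-6)]
    have pcl: "p \<in> closure Np" "p \<in> closure Nm" using N p by blast+
    then have ne: "Np \<noteq> {}" "Nm \<noteq> {}" by auto
    obtain C C' where C: "C \<in> regions T" "Np \<subseteq> C" "C' \<in> regions T" "Nm \<subseteq> C'"
      using reg[OF N(4) sides(1) ne(1)] reg[OF N(5) sides(2) ne(2)] by blast
    have "connected C" "C \<subseteq> RS"
      using C(1) in_components_connected in_components_subset unfolding regions_def by blast+
    then have "C \<subseteq> A \<or> disjnt C A" by (rule alternatingD(2)[OF A])
    then have "C \<noteq> C'" using sides(3) C ne unfolding disjnt_def by blast
    moreover have "s \<subseteq> closure C" "s \<subseteq> closure C'"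
      using region_borders_whole_string[OF C(1) s(1) s(2) p(2)] region_borders_whole_string[OF C(3) s(1) s(2) p(2)]
        pcl closure_mono[OF C(2)] closure_mono[OF C(4)] by blast+
    ultimately have "adjacent T C C'" unfolding adjacent_def using s by blast
    then have "C \<subseteq> B \<longleftrightarrow> \<not> C' \<subseteq> B" using B(3) C by blast
    then have "C \<subseteq> B \<and> C' \<inter> B = {} \<or> C' \<subseteq> B \<and> C \<inter> B = {}"
      using B(2)[OF C(1)] B(2)[OF C(3)] unfolding disjnt_def by blast
    then have "Np \<subseteq> B \<and> Nm \<subseteq> RS - B \<or> Nm \<subseteq> B \<and> Np \<subseteq> RS - B"
      using C(2,4) sides(1,2) by blast
    then show ?thesis using pcl closure_mono[of Np] closure_mono[of Nm] by blast
  qed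
  then show "alternating T B" unfolding alternating_def using B(1) conn by blast
qed

end


section \<open>Isotopies and complements\<close>

lemma homeomorphism_closure_image:
  fixes h :: "'a::topological_space \<Rightarrow> 'b::topological_space"
  assumes "homeomorphism UNIV UNIV h g"
  shows "closure (h ` A) = h ` closure A"
proof
  have hg: "h (g y) = y" "g (h x) = x" for x y using assms unfolding homeomorphism_def by auto
  have 1: "h ` closure A \<subseteq> closure (h ` A)"
    by (rule image_closure_subset[OF _ closed_closure closure_subset])
      (use assms continuous_on_subset in \<open>auto simp: homeomorphism_def\<close>)
  have "g ` closure (h ` A) \<subseteq> closure (g ` h ` A)"
    by (rule image_closure_subset[OF _ closed_closure closure_subset])
      (use assms continuous_on_subset in \<open>auto simp: homeomorphism_def\<close>)
  then have "g ` closure (h ` A) \<subseteq> closure A" by (simp add: image_image hg)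
  then have "h ` g ` closure (h ` A) \<subseteq> h ` closure A" by blast
  then show "closure (h ` A) \<subseteq> h ` closure A" by (simp add: image_image hg)
  show "h ` closure A \<subseteq> closure (h ` A)" by (fact 1)
qed

context
  fixes h g :: "complex \<Rightarrow> complex"
  assumes homeo: "homeomorphism UNIV UNIV h g"
begin

lemma homeo_inverse: "h (g y) = y" "g (h x) = x"
  using homeo unfolding homeomorphism_def by auto

lemma homeo_inj: "inj h" by (metis homeo_inverse(2) injI)

lemma homeo_bij: "bij h"
  using homeo_inj homeo_inverse(1) by (metis bijI surjI)

lemma homeo_interior: "interior (h ` A) = h ` interior A"
  using homeomorphism_closure_image[OF homeo, of "- A"]
  by (simp add: interior_closure bij_image_Compl_eq[OF homeo_bij])

lemma move_region_space: "region_space (move h T) = h ` region_space T"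
  unfolding region_space_def move_def move_disk_def
  by (simp add: homeo_interior image_set_diff[OF homeo_inj] image_UN image_Union)

lemma move_string_space: "string_space (move h T) = h ` string_space T"
  unfolding string_space_def move_def move_disk_def
  by (simp add: homeo_interior image_set_diff[OF homeo_inj] image_UN)

lemma move_strings: "\<Union> (strings (move h T)) = h ` \<Union> (strings T)"
  unfolding move_def by auto

lemma move_alternating:
  assumes B: "alternating T B" shows "alternating (move h T) (h ` B)"
  unfolding alternating_def move_region_space move_string_space move_strings
proof (intro conjI allI impI)
  show "h ` B \<subseteq> h ` region_space T" using alternatingD(1)[OF B] by blast
  show "C \<subseteq> h ` B \<or> disjnt C (h ` B)" if C: "connected C" "C \<subseteq> h ` region_space T" for C
  proof -
    have "connected (g ` C)"
      using homeo C(1) connected_continuous_image continuous_on_subset unfolding homeomorphism_def by blast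
    moreover have "g ` C \<subseteq> region_space T" using C(2) homeo_inverse by auto
    ultimately have "g ` C \<subseteq> B \<or> disjnt (g ` C) B" by (rule alternatingD(2)[OF B])
    then show ?thesis
    proof
      assume "g ` C \<subseteq> B"
      then have "C \<subseteq> h ` B" using homeo_inverse(1) by (metis image_subset_iff image_eqI subsetI)
      then show ?thesis ..
    next
      assume "disjnt (g ` C) B"
      then have "disjnt C (h ` B)" using homeo_inverse(2) by (force simp: disjnt_iff)
      then show ?thesis ..
    qed
  qed
  have "h ` (\<Union> (strings T) \<inter> string_space T) \<subseteq> h ` (closure B \<inter> closure (region_space T - B))"
    using B unfolding alternating_def by blast
  then show "h ` \<Union> (strings T) \<inter> h ` string_space T \<subseteq> closure (h ` B) \<inter> closure (h ` region_space T - h ` B)"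
    by (simp add: image_Int[OF homeo_inj] homeomorphism_closure_image[OF homeo] flip: image_set_diff[OF homeo_inj])
qed

lemma move_disk_type:
  "disk_type \<lparr>tangle_of = move h T, shade = h ` B\<rparr> (move_disk h d) = disk_type \<lparr>tangle_of = T, shade = B\<rparr> d"
proof -
  have "card (h ` marks d) = card (marks d)" by (rule card_image) (use homeo_inj in \<open>auto simp: inj_def inj_on_def\<close>)
  moreover have "disjnt (h ` U) (h ` V) \<longleftrightarrow> disjnt U V" for U V
    by (auto simp: disjnt_def image_Int[OF homeo_inj, symmetric])
  ultimately show ?thesis by (simp add: disk_type_def move_disk_def)
qed

lemma move_marks_card: "card (marks (move_disk h d)) = card (marks d)"
  by (simp add: move_disk_def card_image inj_on_subset[OF homeo_inj])

end

context planar_tangle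
begin

lemma disk_type_complement:
  assumes "alternating T B" "d \<in> disks T"
  shows "disk_type \<lparr>tangle_of = T, shade = RS - B\<rparr> d =
     (card (marks d) div 2, flip (snd (disk_type \<lparr>tangle_of = T, shade = B\<rparr> d)))"
proof -
  have "base_interval d \<subseteq> B \<or> disjnt (base_interval d) B"
    by (rule alternatingD(2)[OF assms(1) base_interval_connected[OF assms(2)] base_interval_subset[OF assms(2)]])
  then show ?thesis
    using base_interval_subset[OF assms(2)] base_interval_nonempty[OF assms(2)]
    by (auto simp: disk_type_def disjnt_def)
qed

text \<open>Inside the open set \<open>SS\<close> the two region spaces coincide, so the local condition at the strings of
  \<open>T\<close> is inherited.\<close>
lemma alternating_restrict:
  assumes B: "alternating T2 B" and RS: "RS \<subseteq> region_space T2" and SS: "SS \<subseteq> string_space T2"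
    and X: "X \<inter> SS \<subseteq> \<Union> (strings T2)" and loc: "SS \<inter> region_space T2 \<subseteq> RS"
  shows "alternating T (B \<inter> RS)"
  unfolding alternating_def
proof (intro conjI allI impI subsetI)
  fix C assume C: "connected C" "C \<subseteq> RS"
  then show "C \<subseteq> B \<inter> RS \<or> disjnt C (B \<inter> RS)"
    using alternatingD(2)[OF B C(1)] RS unfolding disjnt_def by blast
next
  fix p assume p: "p \<in> X \<inter> SS"
  then have c: "p \<in> closure B" "p \<in> closure (region_space T2 - B)"
    using alternatingD(3)[OF B, of p] X SS by blast+
  have "p \<in> closure (SS \<inter> B)" "p \<in> closure (SS \<inter> (region_space T2 - B))"
    using c p open_Int_closure_subset[OF open_string_space] by blast+
  moreover have "SS \<inter> B \<subseteq> B \<inter> RS" "SS \<inter> (region_space T2 - B) \<subseteq> RS - B \<inter> RS"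
    using alternatingD(1)[OF B] loc by blast+
  ultimately show "p \<in> closure (B \<inter> RS) \<inter> closure (RS - B \<inter> RS)" using closure_mono by blast
qed auto

end

section \<open>Composition of tangles\<close>

text \<open>The tangle \<open>T'\<close> is inserted into the \<open>i\<close>-th input disk, the hole, of \<open>T\<close>.\<close>
locale tangle_composite = T: planar_tangle T + T': planar_tangle T' + T'': planar_tangle T''
  for T T' T'' :: tangle +
  fixes i :: nat
  assumes comp: "composite T i T' T''"
begin

abbreviation "hole \<equiv> ins T ! i"

lemma composite_parts: "i < length (ins T)" "out T' = hole" "out T'' = out T"
  "ins T'' = take i (ins T) @ ins T' @ drop (Suc i) (ins T)"
  "\<Union> (strings T'') = T.X \<union> T'.X"
  using comp unfolding composite_def by blast+

lemma ins_split: "ins T = take i (ins T) @ hole # drop (Suc i) (ins T)"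
  by (rule id_take_nth_drop[OF composite_parts(1)])

lemma hole_in: "hole \<in> set (ins T)" using composite_parts(1) by simp

lemma other_disks:
  assumes "e \<in> set (take i (ins T)) \<union> set (drop (Suc i) (ins T))"
  shows "e \<in> set (ins T)" "body e \<inter> body hole = {}"
proof -
  obtain j where j: "j < length (ins T)" "j \<noteq> i" "e = ins T ! j"
  proof (cases "e \<in> set (take i (ins T))")
    case True
    then obtain j where "j < i" "e = ins T ! j" using composite_parts(1) by (auto simp: in_set_conv_nth)
    then show ?thesis using that[of j] composite_parts(1) by simp
  next
    case False
    then obtain j where "j < length (ins T) - Suc i" "e = ins T ! (Suc i + j)"
      using assms by (auto simp: in_set_conv_nth)
    then show ?thesis using that[of "Suc i + j"] by simp
  qed
  then show "e \<in> set (ins T)" "body e \<inter> body hole = {}" using T.disjoint_nth composite_parts(1) by auto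
qed

lemma set_ins: "set (ins T) = insert hole (set (take i (ins T)) \<union> set (drop (Suc i) (ins T)))"
  by (subst (1) ins_split) auto

lemma set_ins'': "set (ins T'') = set (ins T') \<union> (set (take i (ins T)) \<union> set (drop (Suc i) (ins T)))"
  unfolding composite_parts(4) by auto

lemma inner_subset: "e \<in> set (ins T') \<Longrightarrow> body e \<subseteq> interior (body hole)"
  using T'.body_subset composite_parts(2) by simp

lemma hole_subset: "body hole \<subseteq> interior (body (out T))" using T.body_subset hole_in by blast

lemma SS'_subset: "T'.SS \<subseteq> interior (body hole)" unfolding string_space_def composite_parts(2) by blast

lemma SS_disjoint: "T.SS \<inter> body hole = {}" unfolding string_space_def using hole_in by blast

lemma marks_in_hole: assumes "m \<in> T.M" "m \<in> body hole" shows "m \<in> marks hole"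
proof -
  obtain e where e: "e \<in> disks T" "m \<in> marks e" using assms(1) unfolding all_marks_def by blast
  have f: "m \<in> frontier (body e)" using T.marks_frontier e by blast
  have "e = hole"
  proof (rule ccontr)
    assume "e \<noteq> hole"
    show False
    proof (cases "e = out T")
      case True then show False using f assms(2) T.body_disjoint_out_frontier[OF hole_in] by blast
    next
      case False
      then have "e \<in> set (ins T)" using e by (auto simp: disks_def)
      then show False using \<open>e \<noteq> hole\<close> T.disjoint_ins[OF _ hole_in] T.frontier_subset_body[OF e(1)] f assms(2) by blast
    qed
  qed
  then show ?thesis using e by simp
qed

lemma strings_T_in_hole: "T.X \<inter> body hole \<subseteq> marks hole"
  using T.string_subset SS_disjoint marks_in_hole by blast

lemma marks_T'_outside: assumes "m \<in> T'.M" "m \<notin> interior (body hole)" shows "m \<in> marks hole"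
proof -
  obtain e where e: "e \<in> disks T'" "m \<in> marks e" using assms(1) unfolding all_marks_def by blast
  have f: "m \<in> body e" using T'.marks_frontier[OF e(1)] e T'.frontier_subset_body[OF e(1)] by blast
  then have "e \<notin> set (ins T')" using inner_subset assms(2) by blast
  then show ?thesis using e composite_parts(2) by (auto simp: disks_def)
qed

lemma strings_T'_outside: "T'.X - interior (body hole) \<subseteq> marks hole"
  using T'.string_subset SS'_subset marks_T'_outside by blast

text \<open>The strings of both tangles contain the marked points of the common circle.  Hence a point of the region
  space of one part lies on no string of the other, and both region spaces are contained in that of the
  composite.\<close>
lemma marks_hole: "marks hole \<subseteq> T.X" "marks hole \<subseteq> T'.X"
proof -
  have "marks hole \<subseteq> T.M" "marks hole \<subseteq> T'.M" 
    using hole_in T'.out_disk unfolding all_marks_def composite_parts(2) by (blast intro: T.in_disk)+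
  then show "marks hole \<subseteq> T.X" "marks hole \<subseteq> T'.X" using T.marks_on_strings T'.marks_on_strings by blast+
qed

lemma RS_subset: "T.RS \<subseteq> T''.RS"
proof
  fix z assume z: "z \<in> T.RS"
  have zd: "z \<notin> interior (body hole)" using z hole_in unfolding region_space_def by blast
  have "z \<in> body (out T)" "z \<notin> T.X" using z unfolding region_space_def by blast+
  moreover have "z \<notin> interior (body e)" if "e \<in> set (ins T'')" for e
    using that z inner_subset[of e] interior_subset[of "body e"] zd unfolding set_ins'' region_space_def set_ins by blast
  moreover have "z \<notin> T'.X" using zd strings_T'_outside marks_hole \<open>z \<notin> T.X\<close> by blast
  ultimately show "z \<in> T''.RS" unfolding region_space_def composite_parts(3,5) by blast
qed

lemma RS'_subset: "T'.RS \<subseteq> T''.RS"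
proof
  fix z assume z: "z \<in> T'.RS"
  have zd: "z \<in> body hole" "z \<notin> T'.X" using z unfolding region_space_def composite_parts(2) by blast+
  have "z \<in> body (out T)" using zd hole_subset interior_subset by blast
  moreover have "z \<notin> interior (body e)" if "e \<in> set (ins T'')" for e
    using that z other_disks(2)[of e] interior_subset[of "body e"] zd unfolding set_ins'' region_space_def by blast
  moreover have "z \<notin> T.X" using zd strings_T_in_hole marks_hole by blast
  ultimately show "z \<in> T''.RS" using zd(2) unfolding region_space_def composite_parts(3,5) by blast
qed

lemma SS_subset: "T.SS \<subseteq> T''.SS"
proof
  fix z assume z: "z \<in> T.SS"
  have "z \<notin> body e" if "e \<in> set (ins T'')" for e
    using that z inner_subset[of e] interior_subset[of "body hole"] SS_disjoint other_disks(1) unfolding set_ins'' string_space_def by blast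
  then show "z \<in> T''.SS" using z unfolding string_space_def composite_parts(3) by blast
qed

lemma SS'_subset'': "T'.SS \<subseteq> T''.SS"
proof
  fix z assume z: "z \<in> T'.SS"
  have zd: "z \<in> body hole" using z SS'_subset interior_subset by blast
  have "z \<notin> body e" if "e \<in> set (ins T'')" for e
    using that z other_disks(2)[of e] zd unfolding set_ins'' string_space_def by blast
  then show "z \<in> T''.SS" using zd hole_subset unfolding string_space_def composite_parts(3) by blast
qed

lemma restrict_outer: "alternating T'' B \<Longrightarrow> alternating T (B \<inter> T.RS)"
proof (rule T.alternating_restrict[OF _ RS_subset SS_subset])
  show "T.X \<inter> T.SS \<subseteq> \<Union> (strings T'')" using composite_parts(5) by blast
  have "T''.RS \<subseteq> - T.X" using T''.region_space_off_strings composite_parts(5) by blast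
  then show "T.SS \<inter> T''.RS \<subseteq> T.RS" using T.region_space_in_string_space by blast
qed

lemma restrict_inner: "alternating T'' B \<Longrightarrow> alternating T' (B \<inter> T'.RS)"
proof (rule T'.alternating_restrict[OF _ RS'_subset SS'_subset''])
  show "T'.X \<inter> T'.SS \<subseteq> \<Union> (strings T'')" using composite_parts(5) by blast
  have "T''.RS \<subseteq> - T'.X" using T''.region_space_off_strings composite_parts(5) by blast
  then show "T'.SS \<inter> T''.RS \<subseteq> T'.RS" using T'.region_space_in_string_space by blast
qed

lemma disk_type_restrict:
  assumes "e \<in> disks T"
  shows "disk_type \<lparr>tangle_of = T, shade = B \<inter> T.RS\<rparr> e = disk_type \<lparr>tangle_of = T'', shade = B\<rparr> e"
  using T.base_interval_subset[OF assms] by (auto simp: disk_type_def disjnt_def)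

lemma disk_type_restrict':
  assumes "e \<in> disks T'"
  shows "disk_type \<lparr>tangle_of = T', shade = B \<inter> T'.RS\<rparr> e = disk_type \<lparr>tangle_of = T'', shade = B\<rparr> e"
  using T'.base_interval_subset[OF assms] by (auto simp: disk_type_def disjnt_def)

text \<open>Every disk of the parts other than the hole is a disk of the composite, and the hole is even
  because the total number of marked points of \<open>T\<close> is even.\<close>
lemma even_composite:
  assumes "even_tangle T''"
  shows "even_tangle T" "even_tangle T'"
proof -
  have e: "even (card (marks e))" if "e \<in> disks T''" for e using assms that unfolding even_tangle_def by blast
  have "disks T - {hole} \<subseteq> disks T''" unfolding disks_def set_ins'' set_ins composite_parts(3) by blast
  then have "even (\<Sum>e\<in>disks T - {hole}. card (marks e))" using e by (intro dvd_sum) blast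
  moreover have "(\<Sum>e\<in>disks T. card (marks e)) = card (marks hole) + (\<Sum>e\<in>disks T - {hole}. card (marks e))"
    using T.finite_disks hole_in by (intro sum.remove) auto
  ultimately have "even (card (marks hole))" using T.even_sum_marks by simp
  moreover have "disks T \<subseteq> insert hole (disks T'')" "disks T' \<subseteq> insert hole (disks T'')"
    unfolding disks_def set_ins'' set_ins composite_parts(2,3) by blast+
  ultimately show "even_tangle T" "even_tangle T'"
    using e T.tangle T'.tangle unfolding even_tangle_def by blast+
qed

end


section \<open>Transport of multilinear maps\<close>

lemma listset_iff_nth:
  "vs \<in> listset Vs \<longleftrightarrow> length vs = length Vs \<and> (\<forall>i<length Vs. vs ! i \<in> Vs ! i)"
proof (induction Vs arbitrary: vs)
  case (Cons V Vs)
  show ?case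
    by (cases vs) (auto simp: set_Cons_def Cons.IH nth_Cons less_Suc_eq_0_disj split: nat.splits)
qed simp

lemma map2_list_update:
  "length ds = length vs \<Longrightarrow> i < length vs \<Longrightarrow>
   map2 f ds (vs[i := x]) = (map2 f ds vs)[i := f (ds ! i) x]"
  by (intro nth_equalityI) (auto simp: nth_list_update)

definition linear_into ::
    "(complex \<Rightarrow> 'a::ab_group_add \<Rightarrow> 'a) \<Rightarrow> 'a set \<Rightarrow> 'a set \<Rightarrow> ('a \<Rightarrow> 'a) \<Rightarrow> bool" where
  "linear_into sc V W f \<longleftrightarrow> f \<in> V \<rightarrow> W \<and>
     (\<forall>x\<in>V. \<forall>y\<in>V. f (x + y) = f x + f y) \<and> (\<forall>c. \<forall>x\<in>V. f (sc c x) = sc c (f x))"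

lemma multilinear_on_transport:
  assumes f: "multilinear_on sc (map V ds) W f"
    and g: "\<And>d. d \<in> set ds \<Longrightarrow> linear_into sc (U d) (V d) (g d)"
    and h: "linear_into sc W W' h"
    and U: "\<And>d x y c. d \<in> set ds \<Longrightarrow> x \<in> U d \<Longrightarrow> y \<in> U d \<Longrightarrow> x + y \<in> U d \<and> sc c x \<in> U d"
  shows "multilinear_on sc (map U ds) W' (\<lambda>vs. h (f (map2 g ds vs)))"
proof -
  have in_V: "map2 g ds vs \<in> listset (map V ds)" if "vs \<in> listset (map U ds)" for vs
    using that g unfolding listset_iff_nth linear_into_def by (auto simp: Pi_iff)
  have fW: "f vs \<in> W" if "vs \<in> listset (map V ds)" for vs using f that unfolding multilinear_on_def by blast
  have upd: "map2 g ds (vs[i := x]) = (map2 g ds vs)[i := g (ds ! i) x]"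
      "vs[i := x] \<in> listset (map U ds)"
    if "vs \<in> listset (map U ds)" "i < length ds" "x \<in> U (ds ! i)" for vs i x
    using that by (auto simp: listset_iff_nth nth_list_update intro!: map2_list_update)
  show ?thesis
    unfolding multilinear_on_def
  proof (intro conjI ballI allI impI)
    fix vs assume vs: "vs \<in> listset (map U ds)"
    show "h (f (map2 g ds vs)) \<in> W'" using h fW[OF in_V[OF vs]] unfolding linear_into_def by blast
    fix i assume "i < length (map U ds)"
    then have i: "i < length ds" "ds ! i \<in> set ds" by auto
    note gi = g[OF i(2)]
    have step: "f ((map2 g ds vs)[i := x']) \<in> W" if "x' \<in> V (ds ! i)" for x'
      using in_V[OF vs] that i by (intro fW) (auto simp: listset_iff_nth nth_list_update)
    fix x assume "x \<in> map U ds ! i"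
    then have x: "x \<in> U (ds ! i)" using i by simp
    have gx: "g (ds ! i) x \<in> V (ds ! i)" using gi x unfolding linear_into_def by blast
    show "h (f (map2 g ds (vs[i := sc c x]))) = sc c (h (f (map2 g ds (vs[i := x]))))" for c
    proof -
      have "f ((map2 g ds vs)[i := sc c (g (ds ! i) x)]) = sc c (f ((map2 g ds vs)[i := g (ds ! i) x]))"
        using f in_V[OF vs] gx i unfolding multilinear_on_def by simp
      then show ?thesis
        using upd(1)[OF vs i(1)] U[OF i(2) x x] x gi h step[OF gx] unfolding linear_into_def by simp
    qed
    fix y assume "y \<in> map U ds ! i"
    then have y: "y \<in> U (ds ! i)" using i by simp
    have gy: "g (ds ! i) y \<in> V (ds ! i)" using gi y unfolding linear_into_def by blast
    have "f ((map2 g ds vs)[i := g (ds ! i) x + g (ds ! i) y]) =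
        f ((map2 g ds vs)[i := g (ds ! i) x]) + f ((map2 g ds vs)[i := g (ds ! i) y])"
      using f in_V[OF vs] gx gy i unfolding multilinear_on_def by simp
    then show "h (f (map2 g ds (vs[i := x + y]))) =
        h (f (map2 g ds (vs[i := x]))) + h (f (map2 g ds (vs[i := y])))"
      using upd(1)[OF vs i(1)] U[OF i(2) x y] x y gi h step[OF gx] step[OF gy] unfolding linear_into_def by simp
  qed
qed

section \<open>The unshaded planar algebra\<close>

text \<open>The pair \<open>t = (n, \<epsilon>)\<close> is the type of a disk.  This map leads from \<open>P\<^bsub>n,\<epsilon>\<^esub>\<close> to
  \<open>P\<^bsub>n,+\<^esub>\<close>, and \<open>from_plus\<close> is its inverse.\<close>
definition to_plus :: "(nat \<Rightarrow> sign \<Rightarrow> 'a \<Rightarrow> 'a) \<Rightarrow> nat \<times> sign \<Rightarrow> 'a \<Rightarrow> 'a" where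
  "to_plus \<Phi> t x = (if snd t = Plus then x else \<Phi> (fst t) Minus x)"

definition from_plus :: "(nat \<Rightarrow> sign \<Rightarrow> 'a \<Rightarrow> 'a) \<Rightarrow> nat \<times> sign \<Rightarrow> 'a \<Rightarrow> 'a" where
  "from_plus \<Phi> t x = (if snd t = Plus then x else \<Phi> (fst t) Plus x)"

abbreviation shaded :: "tangle \<Rightarrow> complex set \<Rightarrow> shaded_tangle" where
  "shaded T B \<equiv> \<lparr>tangle_of = T, shade = B\<rparr>"

definition transported_action ::
    "'a shaded_data \<Rightarrow> (nat \<Rightarrow> sign \<Rightarrow> 'a \<Rightarrow> 'a) \<Rightarrow> tangle \<Rightarrow> complex set \<Rightarrow> 'a list \<Rightarrow> 'a" where
  "transported_action P \<Phi> T B vs =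
     to_plus \<Phi> (disk_type (shaded T B) (out T))
       (shaded_action P (shaded T B)
         (map2 (\<lambda>d. from_plus \<Phi> (disk_type (shaded T B) d)) (ins T) vs))"

text \<open>The choice of the shading does not matter, by \<open>action_eq\<close> below.  On pictures that are not tangles the
  action is the first input, so that the identity law for radial pictures has content only where the
  radial picture is a tangle.\<close>
definition unshading :: "'a::ab_group_add shaded_data \<Rightarrow> (nat \<Rightarrow> sign \<Rightarrow> 'a \<Rightarrow> 'a) \<Rightarrow> 'a unshaded_data" where
  "unshading P \<Phi> =
     \<lparr>spaces = (\<lambda>n. if even n then shaded_spaces P (n div 2) Plus else {0}),
      action = (\<lambda>T vs. if \<not> is_tangle T then hd vs
        else if even_tangle T then transported_action P \<Phi> T (SOME B. alternating T B) vs else 0)\<rparr>"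

lemma fst_disk_type [simp]: "fst (disk_type S d) = card (marks d) div 2"
  by (simp add: disk_type_def)

lemma even_tangleD: "even_tangle T \<Longrightarrow> d \<in> disks T \<Longrightarrow> even (card (marks d))"
  "even_tangle T \<Longrightarrow> planar_tangle T"
  unfolding even_tangle_def planar_tangle_def by auto

lemma even_tangle_alternating: "even_tangle T \<Longrightarrow> \<exists>B. alternating T B"
  using planar_tangle.exists_alternating even_tangleD by blast

lemma even_tangle_shaded: "even_tangle T \<Longrightarrow> is_shaded_tangle (shaded T B) \<longleftrightarrow> alternating T B"
  using planar_tangle.shading_iff_alternating even_tangleD by blast

locale self_dual =
  fixes sc :: "complex \<Rightarrow> 'a::ab_group_add \<Rightarrow> 'a" and P :: "'a shaded_data"
    and \<Phi> :: "nat \<Rightarrow> sign \<Rightarrow> 'a \<Rightarrow> 'a"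
  assumes pa: "shaded_planar_algebra sc P" and duality: "symmetric_self_duality sc P \<Phi>"
begin

sublocale vector_space sc
  using pa unfolding shaded_planar_algebra_def by blast

abbreviation "Q \<equiv> unshading P \<Phi>"

lemma shaded_subspace: "subspace (shaded_spaces P n \<epsilon>)"
  using pa[unfolded shaded_planar_algebra_def, THEN conjunct2, THEN conjunct1] by blast

lemma shaded_multilinear:
  "is_shaded_tangle S \<Longrightarrow> multilinear_on sc (input_spaces P S) (output_space P S) (shaded_action P S)"
  using pa[unfolded shaded_planar_algebra_def, THEN conjunct2, THEN conjunct2, THEN conjunct1] by blast

lemma shaded_isotopy:
  "is_shaded_tangle S \<Longrightarrow> is_shaded_tangle S' \<Longrightarrow> shaded_isotopic S S' \<Longrightarrow>
   vs \<in> listset (input_spaces P S) \<Longrightarrow> shaded_action P S' vs = shaded_action P S vs"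
  using pa[unfolded shaded_planar_algebra_def, THEN conjunct2, THEN conjunct2, THEN conjunct2, THEN conjunct1] by blast

lemma shaded_composition:
  "is_shaded_tangle S \<Longrightarrow> is_shaded_tangle S' \<Longrightarrow> is_shaded_tangle S'' \<Longrightarrow>
   shaded_composite S i S' S'' \<Longrightarrow> length us = i \<Longrightarrow> length ws = length (ins (tangle_of S')) \<Longrightarrow>
   us @ ws @ xs \<in> listset (input_spaces P S'') \<Longrightarrow>
   shaded_action P S'' (us @ ws @ xs) = shaded_action P S (us @ [shaded_action P S' ws] @ xs)"
  using pa[unfolded shaded_planar_algebra_def, THEN conjunct2, THEN conjunct2, THEN conjunct2,
      THEN conjunct2, THEN conjunct1, rule_format, of S S' S'' i us ws xs] by blast

lemma shaded_radial:
  "is_shaded_tangle S \<Longrightarrow> tangle_of S = radial_tangle (2 * n) \<Longrightarrow>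
   v \<in> output_space P S \<Longrightarrow> shaded_action P S [v] = v"
  using pa[unfolded shaded_planar_algebra_def, THEN conjunct2, THEN conjunct2, THEN conjunct2,
      THEN conjunct2, THEN conjunct2] by blast

lemma Phi_bij: "bij_betw (\<Phi> n \<epsilon>) (shaded_spaces P n \<epsilon>) (shaded_spaces P n (flip \<epsilon>))"
  and Phi_add: "x \<in> shaded_spaces P n \<epsilon> \<Longrightarrow> y \<in> shaded_spaces P n \<epsilon> \<Longrightarrow> \<Phi> n \<epsilon> (x + y) = \<Phi> n \<epsilon> x + \<Phi> n \<epsilon> y"
  and Phi_scale: "x \<in> shaded_spaces P n \<epsilon> \<Longrightarrow> \<Phi> n \<epsilon> (sc c x) = sc c (\<Phi> n \<epsilon> x)"
  and Phi_Phi: "x \<in> shaded_spaces P n \<epsilon> \<Longrightarrow> \<Phi> n (flip \<epsilon>) (\<Phi> n \<epsilon> x) = x"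
  and Phi_action: "is_shaded_tangle S \<Longrightarrow> vs \<in> listset (input_spaces P S) \<Longrightarrow>
     case_prod \<Phi> (disk_type S (out (tangle_of S))) (shaded_action P S vs) =
     shaded_action P (reverse_shading S)
       (map2 (\<lambda>d. case_prod \<Phi> (disk_type S d)) (ins (tangle_of S)) vs)"
  using duality unfolding symmetric_self_duality_def shaded_iso_def linear_iso_on_def dual_def by simp_all

lemma Phi_mem: "x \<in> shaded_spaces P n \<epsilon> \<Longrightarrow> \<Phi> n \<epsilon> x \<in> shaded_spaces P n (flip \<epsilon>)"
  using Phi_bij by (auto simp: bij_betw_def)

lemma from_plus_linear:
  "linear_into sc (shaded_spaces P n Plus) (shaded_spaces P n \<epsilon>) (from_plus \<Phi> (n, \<epsilon>))"
  using Phi_mem[of _ n Plus] by (cases \<epsilon>) (auto simp: linear_into_def from_plus_def Phi_add Phi_scale)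

lemma to_plus_linear:
  "linear_into sc (shaded_spaces P n \<epsilon>) (shaded_spaces P n Plus) (to_plus \<Phi> (n, \<epsilon>))"
  using Phi_mem[of _ n Minus] by (cases \<epsilon>) (auto simp: linear_into_def to_plus_def Phi_add Phi_scale)

lemma from_to_plus: "x \<in> shaded_spaces P n \<epsilon> \<Longrightarrow> from_plus \<Phi> (n, \<epsilon>) (to_plus \<Phi> (n, \<epsilon>) x) = x"
  using Phi_Phi[of x n Minus] by (cases \<epsilon>) (auto simp: from_plus_def to_plus_def)

lemma to_from_plus: "x \<in> shaded_spaces P n Plus \<Longrightarrow> to_plus \<Phi> (n, \<epsilon>) (from_plus \<Phi> (n, \<epsilon>) x) = x"
  using Phi_Phi[of x n Plus] by (cases \<epsilon>) (auto simp: from_plus_def to_plus_def)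

lemma from_plus_flip: "x \<in> shaded_spaces P n Plus \<Longrightarrow> from_plus \<Phi> (n, flip \<epsilon>) x = \<Phi> n \<epsilon> (from_plus \<Phi> (n, \<epsilon>) x)"
  using Phi_Phi[of x n Plus] by (cases \<epsilon>) (auto simp: from_plus_def)

lemma to_plus_flip: "x \<in> shaded_spaces P n \<epsilon> \<Longrightarrow> to_plus \<Phi> (n, flip \<epsilon>) (\<Phi> n \<epsilon> x) = to_plus \<Phi> (n, \<epsilon>) x"
  using Phi_Phi[of x n Plus] by (cases \<epsilon>) (auto simp: to_plus_def)

lemma shaded_disk_space_eq:
  "shaded_disk_space P S d = shaded_spaces P (card (marks d) div 2) (snd (disk_type S d))"
  unfolding shaded_disk_space_def by (simp add: case_prod_unfold)

lemma disk_type_pair: "disk_type S d = (card (marks d) div 2, snd (disk_type S d))"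
  by (simp add: prod_eq_iff)

lemma disk_space_even: "even (card (marks d)) \<Longrightarrow> disk_space Q d = shaded_spaces P (card (marks d) div 2) Plus"
  by (simp add: disk_space_def unshading_def)

lemma from_plus_disk:
  assumes "even (card (marks d))"
  shows "linear_into sc (disk_space Q d) (shaded_disk_space P S d) (from_plus \<Phi> (disk_type S d))"
  unfolding disk_space_even[OF assms] shaded_disk_space_eq
  by (subst disk_type_pair) (rule from_plus_linear)

lemma to_plus_disk:
  assumes "even (card (marks d))"
  shows "linear_into sc (shaded_disk_space P S d) (disk_space Q d) (to_plus \<Phi> (disk_type S d))"
  unfolding disk_space_even[OF assms] shaded_disk_space_eq
  by (subst disk_type_pair) (rule to_plus_linear)

lemma from_to_plus_disk:
  "x \<in> shaded_disk_space P S d \<Longrightarrow> from_plus \<Phi> (disk_type S d) (to_plus \<Phi> (disk_type S d) x) = x"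
  unfolding shaded_disk_space_eq by (subst (1 2) disk_type_pair) (rule from_to_plus)

lemma unshading_subspace: "subspace (spaces Q n)"
  using shaded_subspace by (simp add: unshading_def subspace_def)

lemma from_plus_inputs:
  assumes "even_tangle T" "vs \<in> listset (map (disk_space Q) (ins T))"
  shows "map2 (\<lambda>d. from_plus \<Phi> (disk_type (shaded T B) d)) (ins T) vs \<in> listset (input_spaces P (shaded T B))"
  unfolding listset_iff_nth input_spaces_def
proof (intro conjI allI impI)
  show "length (map2 (\<lambda>d. from_plus \<Phi> (disk_type (shaded T B) d)) (ins T) vs) =
     length (map (shaded_disk_space P (shaded T B)) (ins (tangle_of (shaded T B))))"
    using assms(2) by (simp add: listset_iff_nth)
  fix i assume "i < length (map (shaded_disk_space P (shaded T B)) (ins (tangle_of (shaded T B))))"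
  then have i: "i < length (ins T)" "length vs = length (ins T)" "vs ! i \<in> disk_space Q (ins T ! i)"
    using assms(2) by (auto simp: listset_iff_nth)
  then have "ins T ! i \<in> disks T" by (simp add: disks_def)
  then show "map2 (\<lambda>d. from_plus \<Phi> (disk_type (shaded T B) d)) (ins T) vs ! i \<in>
     map (shaded_disk_space P (shaded T B)) (ins (tangle_of (shaded T B))) ! i"
    using from_plus_disk[OF even_tangleD(1)[OF assms(1)]] i unfolding linear_into_def by (auto simp: Pi_iff)
qed

lemma transported_multilinear:
  assumes ev: "even_tangle T" and B: "alternating T B"
  shows "multilinear_on sc (map (disk_space Q) (ins T)) (disk_space Q (out T)) (transported_action P \<Phi> T B)"
proof -
  let ?S = "shaded T B"
  have sh: "is_shaded_tangle ?S" using even_tangle_shaded ev B by blast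
  have e: "even (card (marks d))" if "d \<in> set (ins T) \<or> d = out T" for d
    using that even_tangleD(1)[OF ev] by (auto simp: disks_def)
  have "multilinear_on sc (map (disk_space Q) (ins T)) (disk_space Q (out T))
     (\<lambda>vs. to_plus \<Phi> (disk_type ?S (out T)) (shaded_action P ?S (map2 (\<lambda>d. from_plus \<Phi> (disk_type ?S d)) (ins T) vs)))"
  proof (rule multilinear_on_transport[where V = "shaded_disk_space P ?S" and W = "shaded_disk_space P ?S (out T)"
        and f = "shaded_action P ?S" and g = "\<lambda>d. from_plus \<Phi> (disk_type ?S d)"
        and h = "to_plus \<Phi> (disk_type ?S (out T))"])
    show "multilinear_on sc (map (shaded_disk_space P ?S) (ins T)) (shaded_disk_space P ?S (out T)) (shaded_action P ?S)"
      using shaded_multilinear[OF sh] by (simp add: input_spaces_def output_space_def)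
    show "linear_into sc (disk_space Q d) (shaded_disk_space P ?S d) (from_plus \<Phi> (disk_type ?S d))"
      if "d \<in> set (ins T)" for d using that e by (intro from_plus_disk) blast
    show "linear_into sc (shaded_disk_space P ?S (out T)) (disk_space Q (out T)) (to_plus \<Phi> (disk_type ?S (out T)))"
      using e by (intro to_plus_disk) blast
    show "x + y \<in> disk_space Q d \<and> sc c x \<in> disk_space Q d"
      if "d \<in> set (ins T)" "x \<in> disk_space Q d" "y \<in> disk_space Q d" for d x y c
      using that(2,3) unshading_subspace unfolding disk_space_def by (simp add: subspace_def)
  qed
  then show ?thesis unfolding transported_action_def .
qed

text \<open>Reversing the shading replaces each type \<open>(n, \<epsilon>)\<close> by its opposite.  The inputs change by
  \<open>\<Phi>\<close>, hence so does the output of \<open>P\<close>, and \<open>\<Phi>\<^sup>2 = id\<close> cancels this when the output is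
  carried back.\<close>
lemma transported_complement:
  assumes ev: "even_tangle T" and B: "alternating T B" and vs: "vs \<in> listset (map (disk_space Q) (ins T))"
  shows "transported_action P \<Phi> T (region_space T - B) vs = transported_action P \<Phi> T B vs"
proof -
  interpret planar_tangle T by (rule even_tangleD(2)[OF ev])
  let ?S = "shaded T B"
  let ?R = "shaded T (region_space T - B)"
  have sh: "is_shaded_tangle ?S" using even_tangle_shaded ev B by blast
  have R: "reverse_shading ?S = ?R" by (simp add: reverse_shading_def)
  define us where "us = map2 (\<lambda>d. from_plus \<Phi> (disk_type ?S d)) (ins T) vs"
  have us: "us \<in> listset (input_spaces P ?S)" unfolding us_def by (rule from_plus_inputs[OF ev vs])
  have typs: "disk_type ?R d = (card (marks d) div 2, flip (snd (disk_type ?S d)))" if "d \<in> disks T" for d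
    by (rule disk_type_complement[OF B that])
  have "map2 (\<lambda>d. from_plus \<Phi> (disk_type ?R d)) (ins T) vs = map2 (\<lambda>d. case_prod \<Phi> (disk_type ?S d)) (ins T) us"
  proof (rule nth_equalityI)
    fix i assume "i < length (map2 (\<lambda>d. from_plus \<Phi> (disk_type ?R d)) (ins T) vs)"
    then have i: "i < length (ins T)" "length vs = length (ins T)" using vs by (auto simp: listset_iff_nth)
    let ?d = "ins T ! i"
    have d: "?d \<in> disks T" using i by simp
    have "vs ! i \<in> disk_space Q ?d" using vs i by (simp add: listset_iff_nth)
    then have m: "vs ! i \<in> shaded_spaces P (card (marks ?d) div 2) Plus"
      using disk_space_even[OF even_tangleD(1)[OF ev d]] by simp
    have "from_plus \<Phi> (disk_type ?R ?d) (vs ! i) = case_prod \<Phi> (disk_type ?S ?d) (from_plus \<Phi> (disk_type ?S ?d) (vs ! i))"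
      unfolding typs[OF d] by (subst (2 3) disk_type_pair) (simp add: from_plus_flip[OF m])
    then show "map2 (\<lambda>d. from_plus \<Phi> (disk_type ?R d)) (ins T) vs ! i = map2 (\<lambda>d. case_prod \<Phi> (disk_type ?S d)) (ins T) us ! i"
      using i by (simp add: us_def)
  qed (use vs in \<open>simp add: us_def listset_iff_nth\<close>)
  then have act: "shaded_action P ?R (map2 (\<lambda>d. from_plus \<Phi> (disk_type ?R d)) (ins T) vs) =
      case_prod \<Phi> (disk_type ?S (out T)) (shaded_action P ?S us)"
    using Phi_action[OF sh us] by (simp add: R)
  have "shaded_action P ?S us \<in> shaded_disk_space P ?S (out T)"
    using shaded_multilinear[OF sh] us unfolding multilinear_on_def output_space_def by simp
  then have "shaded_action P ?S us \<in> shaded_spaces P (card (marks (out T)) div 2) (snd (disk_type ?S (out T)))"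
    by (simp add: shaded_disk_space_eq)
  from to_plus_flip[OF this]
  have "to_plus \<Phi> (disk_type ?R (out T)) (case_prod \<Phi> (disk_type ?S (out T)) (shaded_action P ?S us)) =
     to_plus \<Phi> (disk_type ?S (out T)) (shaded_action P ?S us)"
    unfolding typs[OF out_disk] by (subst (2 3) disk_type_pair) simp
  then show ?thesis unfolding transported_action_def act us_def by simp
qed

lemma action_eq:
  assumes ev: "even_tangle T" and B: "alternating T B" and vs: "vs \<in> listset (map (disk_space Q) (ins T))"
  shows "action Q T vs = transported_action P \<Phi> T B vs"
proof -
  define A where "A = (SOME B. alternating T B)"
  have A: "alternating T A" unfolding A_def by (rule someI[of "alternating T" B]) (rule B)
  have "is_tangle T" using ev by (simp add: even_tangle_def)
  then have "action Q T vs = transported_action P \<Phi> T A vs" using ev by (simp add: unshading_def A_def)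
  also have "\<dots> = transported_action P \<Phi> T B vs"
    using planar_tangle.alternating_unique[OF even_tangleD(2)[OF ev] A B] transported_complement[OF ev B vs] by auto
  finally show ?thesis .
qed

lemma action_odd: "is_tangle T \<Longrightarrow> \<not> even_tangle T \<Longrightarrow> action Q T vs = 0"
  by (simp add: unshading_def)

lemma disk_space_zero: "0 \<in> disk_space Q d"
  using unshading_subspace subspace_0 unfolding disk_space_def by blast

lemma unshading_multilinear:
  assumes "is_tangle T"
  shows "multilinear_on sc (map (disk_space Q) (ins T)) (disk_space Q (out T)) (action Q T)"
proof (cases "even_tangle T")
  case True
  define A where "A = (SOME B. alternating T B)"
  have "alternating T A" unfolding A_def using even_tangle_alternating[OF True] by (rule someI_ex)
  moreover have "action Q T = transported_action P \<Phi> T A" using assms True by (simp add: unshading_def A_def fun_eq_iff)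
  ultimately show ?thesis using transported_multilinear[OF True] by simp
next
  case False
  then show ?thesis using assms disk_space_zero by (simp add: multilinear_on_def action_odd)
qed

lemma multilinear_zero:
  assumes "multilinear_on sc Vs W f" "vs \<in> listset Vs" "i < length Vs" "vs ! i = 0"
  shows "f vs = 0"
proof -
  have "vs ! i \<in> Vs ! i" "length vs = length Vs" using assms(2,3) by (auto simp: listset_iff_nth)
  then have "f (vs[i := sc 0 (vs ! i)]) = sc 0 (f (vs[i := vs ! i]))"
    using assms unfolding multilinear_on_def by blast
  then show ?thesis using assms(4) by (metis list_update_id scale_zero_left)
qed

lemma unshading_isotopy:
  assumes T: "is_tangle T" "is_tangle T'" "isotopic T T'" and vs: "vs \<in> listset (map (disk_space Q) (ins T))"
  shows "action Q T' vs = action Q T vs"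
proof -
  obtain H where H: "planar_isotopy H" "T' = move (H 1) T" using T(3) unfolding isotopic_def by blast
  define h where "h = H 1"
  obtain g where hom: "homeomorphism UNIV UNIV h g" using H(1) unfolding planar_isotopy_def h_def
    by (meson atLeastAtMost_iff order_refl zero_le_one)
  have T': "T' = move h T" using H by (simp add: h_def)
  have ins': "ins T' = map (move_disk h) (ins T)" and out': "out T' = move_disk h (out T)"
    by (simp_all add: T' move_def)
  note mc = move_marks_card[OF hom]
  have disks': "disks T' = move_disk h ` disks T" by (simp add: disks_def ins' out')
  have evI: "even_tangle T' \<longleftrightarrow> even_tangle T" using T by (simp add: even_tangle_def disks' mc)
  show ?thesis
  proof (cases "even_tangle T")
    case False then show ?thesis using T evI by (simp add: action_odd)
  next
    case True
    then obtain B where B: "alternating T B" using even_tangle_alternating by blast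
    have B': "alternating T' (h ` B)" unfolding T' by (rule move_alternating[OF hom B])
    have sh: "is_shaded_tangle (shaded T B)" "is_shaded_tangle (shaded T' (h ` B))"
      using even_tangle_shaded True evI B B' by blast+
    have iso: "shaded_isotopic (shaded T B) (shaded T' (h ` B))"
      unfolding shaded_isotopic_def using H by (intro exI[of _ H]) (simp add: h_def)
    have "map (disk_space Q) (ins T') = map (disk_space Q) (ins T)" by (simp add: ins' disk_space_def mc)
    then have vs': "vs \<in> listset (map (disk_space Q) (ins T'))" using vs by simp
    have typs: "disk_type (shaded T' (h ` B)) (move_disk h d) = disk_type (shaded T B) d" for d
      unfolding T' by (rule move_disk_type[OF hom])
    have "map2 (\<lambda>d. from_plus \<Phi> (disk_type (shaded T' (h ` B)) d)) (ins T') vs =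
       map2 (\<lambda>d. from_plus \<Phi> (disk_type (shaded T B) d)) (ins T) vs"
      by (simp add: ins' zip_map1 typs case_prod_unfold)
    then have "transported_action P \<Phi> T' (h ` B) vs = transported_action P \<Phi> T B vs"
      unfolding transported_action_def
      using shaded_isotopy[OF sh iso from_plus_inputs[OF True vs]] by (simp add: out' typs)
    then show ?thesis using action_eq[OF True B vs] action_eq[OF _ B' vs'] evI True by simp
  qed
qed

text \<open>If all disks of the composite are even, one shading of the composite is restricted to both parts; the
  transports to and from \<open>P\<^bsub>n,+\<^esub>\<close> at the hole cancel because the types match.  If some disk is odd,
  then one of the two parts has an odd disk, and both sides are zero.\<close>
lemma unshading_composition:
  assumes T: "is_tangle T" "is_tangle T'" "is_tangle T''" "composite T i T' T''"
    and len: "length us = i" "length vs = length (ins T')"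
    and mem: "us @ vs @ ws \<in> listset (map (disk_space Q) (ins T''))"
  shows "action Q T'' (us @ vs @ ws) = action Q T (us @ [action Q T' vs] @ ws)"
proof -
  interpret tangle_composite T T' T'' i
    by unfold_locales (use T in auto)
  let ?I = "take i (ins T)" let ?J = "drop (Suc i) (ins T)"
  have l: "length us = length ?I" "length vs = length (ins T')" using len composite_parts(1) by simp_all
  have lw: "length ws = length ?J" using mem l by (simp add: listset_iff_nth composite_parts(4))
  have app: "xs @ ys \<in> listset (As @ Bs) \<longleftrightarrow> xs \<in> listset As \<and> ys \<in> listset Bs"
    if "length xs = length As" for xs ys :: "'a list" and As Bs
    using that by (auto simp: listset_iff_nth nth_append) (metis add.commute add_diff_cancel_left' add_less_cancel_left not_add_less1)+
  have mem': "us \<in> listset (map (disk_space Q) ?I)" "vs \<in> listset (map (disk_space Q) (ins T'))"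
    "ws \<in> listset (map (disk_space Q) ?J)"
    using mem l by (auto simp: composite_parts(4) app)
  have "action Q T' vs \<in> disk_space Q (out T')"
    using unshading_multilinear[OF T(2)] mem'(2) unfolding multilinear_on_def by blast
  then have "us @ [action Q T' vs] @ ws \<in> listset (map (disk_space Q) (?I @ [hole] @ ?J))"
    unfolding map_append using l mem' by (subst app) (auto simp: app composite_parts(2) set_Cons_def)
  then have memT: "us @ [action Q T' vs] @ ws \<in> listset (map (disk_space Q) (ins T))"
    using ins_split by simp
  show ?thesis
  proof (cases "even_tangle T''")
    case True
    note ev = even_composite[OF True]
    obtain B where B: "alternating T'' B" using even_tangle_alternating[OF True] by blast
    note R = restrict_outer[OF B] restrict_inner[OF B]
    define S where "S = shaded T (B \<inter> T.RS)"
    define S' where "S' = shaded T' (B \<inter> T'.RS)"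
    define S'' where "S'' = shaded T'' B"
    have sh: "is_shaded_tangle S" "is_shaded_tangle S'" "is_shaded_tangle S''"
      unfolding S_def S'_def S''_def using even_tangle_shaded ev True B R by blast+
    have typs: "disk_type S e = disk_type S'' e" if "e \<in> disks T" for e
      unfolding S_def S''_def by (rule disk_type_restrict[OF that])
    have typs': "disk_type S' e = disk_type S'' e" if "e \<in> disks T'" for e
      unfolding S'_def S''_def by (rule disk_type_restrict'[OF that])
    have td: "disk_type S' hole = disk_type S hole"
      using typs[of hole] typs'[of hole] hole_in T'.out_disk composite_parts(2) by simp
    have sc: "shaded_composite S i S' S''"
      unfolding shaded_composite_def using T(4) td composite_parts(2) by (simp add: S_def S'_def S''_def)
    let ?F = "\<lambda>S ds vs. map2 (\<lambda>d. from_plus \<Phi> (disk_type S d)) ds vs"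
    have F: "?F S'' (ins T'') (us @ vs @ ws) = ?F S ?I us @ ?F S' (ins T') vs @ ?F S ?J ws"
    proof -
      have "?F S'' (ins T'') (us @ vs @ ws) = ?F S'' ?I us @ ?F S'' (ins T') vs @ ?F S'' ?J ws"
        using l by (simp add: composite_parts(4))
      moreover have "?F S'' ?I us = ?F S ?I us" "?F S'' ?J ws = ?F S ?J ws"
        using typs[OF T.in_disk[OF other_disks(1)]] by (auto dest!: set_zip_leftD)
      moreover have "?F S'' (ins T') vs = ?F S' (ins T') vs"
        using typs'[OF T'.in_disk] by (auto dest!: set_zip_leftD)
      ultimately show ?thesis by simp
    qed
    have in'': "?F S'' (ins T'') (us @ vs @ ws) \<in> listset (input_spaces P S'')"
      unfolding S''_def by (rule from_plus_inputs[OF True mem])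
    have in': "?F S' (ins T') vs \<in> listset (input_spaces P S')"
      unfolding S'_def by (rule from_plus_inputs[OF ev(2) mem'(2)])
    have "shaded_action P S' (?F S' (ins T') vs) \<in> output_space P S'"
      using shaded_multilinear[OF sh(2)] in' unfolding multilinear_on_def by blast
    then have o: "shaded_action P S' (?F S' (ins T') vs) \<in> shaded_disk_space P S' hole"
      by (simp add: output_space_def S'_def composite_parts(2))
    have a': "action Q T' vs = to_plus \<Phi> (disk_type S' hole) (shaded_action P S' (?F S' (ins T') vs))"
      using action_eq[OF ev(2) R(2) mem'(2)] by (simp add: transported_action_def S'_def composite_parts(2))
    have "shaded_action P S'' (?F S'' (ins T'') (us @ vs @ ws)) =
        shaded_action P S (?F S ?I us @ [shaded_action P S' (?F S' (ins T') vs)] @ ?F S ?J ws)"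
      unfolding F by (rule shaded_composition[OF sh sc]) (use l composite_parts(1) in'' F in \<open>auto simp: S'_def\<close>)
    also have "?F S ?I us @ [shaded_action P S' (?F S' (ins T') vs)] @ ?F S ?J ws =
        ?F S (?I @ [hole] @ ?J) (us @ [action Q T' vs] @ ws)"
      using l lw from_to_plus_disk[OF o] by (simp add: a' td)
    also have "?I @ [hole] @ ?J = ins T" using ins_split by simp
    finally have "transported_action P \<Phi> T'' B (us @ vs @ ws) = transported_action P \<Phi> T (B \<inter> T.RS) (us @ [action Q T' vs] @ ws)"
      unfolding transported_action_def S_def[symmetric] S''_def[symmetric] using typs[OF T.out_disk] composite_parts(3) by simp
    then show ?thesis using action_eq[OF True B mem] action_eq[OF ev(1) R(1) memT] by simp
  next
    case False
    then have "action Q T'' (us @ vs @ ws) = 0" using T by (simp add: action_odd)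
    moreover have "action Q T (us @ [action Q T' vs] @ ws) = 0"
    proof (cases "even_tangle T")
      case True
      have "\<not> even_tangle T'"
      proof
        assume "even_tangle T'"
        moreover have "disks T'' \<subseteq> disks T \<union> disks T'" unfolding disks_def set_ins'' set_ins composite_parts(3) by blast
        ultimately have "even_tangle T''" using True T(3) unfolding even_tangle_def by blast
        with False show False ..
      qed
      then have "action Q T' vs = 0" using T by (simp add: action_odd)
      then have "(us @ [action Q T' vs] @ ws) ! i = 0" using len by (simp add: nth_append)
      then show ?thesis using multilinear_zero[OF unshading_multilinear[OF T(1)] memT] composite_parts(1) by simp
    qed (use T in \<open>simp add: action_odd\<close>)
    ultimately show ?thesis by simp
  qed
qed

lemma card_round_marks:
  assumes "r \<noteq> 0" shows "card (marks (round_disk n r)) = n"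
proof (cases "n = 0")
  case False
  have "inj_on (\<lambda>k. cis (2 * pi * real k / real n)) {..<n}"
    using Complex.bij_betw_roots_unity[of n] False by (simp add: bij_betw_def)
  then have "inj_on (\<lambda>k. of_real r * cis (2 * pi * real k / real n)) {..<n}"
    using assms by (simp add: inj_on_def)
  then show ?thesis by (simp add: round_disk_def card_image)
qed (simp add: round_disk_def)

text \<open>The identity law of \<open>P\<close> involves only the output type of the radial tangle.  Its input type is the same
  because the two distinguished intervals are joined by a segment that avoids the strings.\<close>
lemma radial_types_agree:
  assumes sh: "is_shaded_tangle S" and S: "tangle_of S = radial_tangle n"
  shows "snd (disk_type S (round_disk n 1)) = snd (disk_type S (round_disk n 2))"
proof -
  interpret planar_tangle "radial_tangle n"
    using sh S unfolding is_shaded_tangle_def by unfold_locales simp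
  have ins: "ins (radial_tangle n) = [round_disk n 1]" "out (radial_tangle n) = round_disk n 2"
    by (simp_all add: radial_tangle_def)
\<comment> \<open>Half-way between the first two marked points; for \<open>n = 0\<close> there are no strings and \<open>w = 1\<close>.\<close>
  define w where "w = cis (pi / real n)"
  have nw: "norm w = 1" by (simp add: w_def)
  have b: "of_real r * w \<in> base_interval (round_disk n r)" if "r > 0" for r
    using that nw unfolding w_def round_disk_def
    by (auto simp: norm_mult intro!: image_eqI[of _ _ "1/2"])
  have noX: "of_real u * w \<notin> X" if "u > 0" for u
  proof
    assume "of_real u * w \<in> X"
    then obtain k where k: "k < n" "of_real u * w \<in> closed_segment (cis (2 * pi * real k / real n)) (2 * cis (2 * pi * real k / real n))"
      by (auto simp: radial_tangle_def)
    let ?c = "cis (2 * pi * real k / real n)"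
    obtain a where a: "0 \<le> a" "of_real u * w = (1 - a) *\<^sub>R ?c + a *\<^sub>R (2 * ?c)"
      using k(2) by (auto simp: closed_segment_def)
    then have e: "of_real u * w = of_real (1 + a) * ?c" by (simp add: scaleR_conv_of_real algebra_simps)
    then have "norm (of_real u * w) = norm (of_real (1 + a) * ?c)" by simp
    then have "u = 1 + a" using nw that a(1) by (simp add: norm_mult del: of_real_add)
    moreover have "complex_of_real u \<noteq> 0" using that by simp
    ultimately have "w = ?c" using e by (metis mult_left_cancel)
    then have "w ^ n = ?c ^ n" by simp
    moreover have "w ^ n = -1"
    proof -
      have "real n * (pi / real n) = pi" using k(1) by simp
      then show ?thesis by (simp only: w_def Complex.DeMoivre cis_pi)
    qed
    moreover have "?c ^ n = 1"
    proof -
      have "real n * (2 * pi * real k / real n) = 2 * pi * real k" using k(1) by simp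
      then have "?c ^ n = cis (2 * pi * real k)" by (simp only: Complex.DeMoivre)
      also have "\<dots> = 1" by (simp add: cis_multiple_2pi)
      finally show ?thesis .
    qed
    ultimately show False by simp
  qed
  define C where "C = (\<lambda>u. of_real u * w) ` {1..2}"
  have C1: "connected C" unfolding C_def by (intro connected_continuous_image continuous_intros) simp
  have C2: "C \<subseteq> RS"
  proof
    fix z assume "z \<in> C"
    then obtain u where u: "1 \<le> u" "u \<le> 2" "z = of_real u * w" by (auto simp: C_def)
    then have "norm z = u" using nw by (simp add: norm_mult)
    then show "z \<in> RS" using u noX[of u] by (auto simp: region_space_def ins round_disk_def)
  qed
  have C3: "of_real 1 * w \<in> C" "of_real 2 * w \<in> C" unfolding C_def by (intro imageI; simp)+
  have const: "D \<subseteq> shade S \<or> disjnt D (shade S)" if D: "connected D" "D \<subseteq> RS" "D \<noteq> {}" for D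
  proof -
    obtain R where R: "R \<in> regions (radial_tangle n)" "D \<subseteq> R"
      using exists_component_superset[OF D(2) _ D(1)] D(2,3) unfolding regions_def by blast
    then have "R \<subseteq> shade S \<or> disjnt R (shade S)" using sh S unfolding is_shaded_tangle_def by metis
    then show ?thesis using R(2) unfolding disjnt_def by blast
  qed
  have bb: "disjnt (base_interval e) (shade S) \<longleftrightarrow> z \<notin> shade S" if "e \<in> disks (radial_tangle n)" "z \<in> base_interval e" for e z
    using const[OF base_interval_connected[OF that(1)] base_interval_subset[OF that(1)] base_interval_nonempty[OF that(1)]] that(2)
    unfolding disjnt_def by blast
  have "of_real 1 * w \<in> shade S \<longleftrightarrow> of_real 2 * w \<in> shade S"
    using const[OF C1 C2] C3 unfolding disjnt_def by blast
  moreover have "round_disk n 1 \<in> disks (radial_tangle n)" "round_disk n 2 \<in> disks (radial_tangle n)"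
    by (simp_all add: disks_def ins)
  ultimately show ?thesis
    using bb[OF _ b[of 1]] bb[OF _ b[of 2]] by (simp add: disk_type_def)
qed

lemma unshading_radial:
  assumes v: "v \<in> spaces Q n"
  shows "action Q (radial_tangle n) [v] = v"
proof (cases "is_tangle (radial_tangle n)")
  case False then show ?thesis by (simp add: unshading_def)
next
  case T: True
  let ?T = "radial_tangle n"
  have ins: "ins ?T = [round_disk n 1]" "out ?T = round_disk n 2" by (simp_all add: radial_tangle_def)
  have cards: "card (marks (round_disk n 1)) = n" "card (marks (round_disk n 2)) = n"
    by (simp_all add: card_round_marks)
  show ?thesis
  proof (cases "even n")
    case False
    then have "\<not> even_tangle ?T" using cards by (simp add: even_tangle_def disks_def ins)
    then show ?thesis using T v False by (simp add: action_odd) (simp add: unshading_def)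
  next
    case True
    then obtain k where k: "n = 2 * k" by blast
    have ev: "even_tangle ?T" using T True cards by (simp add: even_tangle_def disks_def ins)
    then obtain B where B: "alternating ?T B" using even_tangle_alternating by blast
    let ?S = "shaded ?T B"
    have sh: "is_shaded_tangle ?S" using even_tangle_shaded ev B by blast
    have vP: "v \<in> shaded_spaces P k Plus" using v k by (simp add: unshading_def)
    have ty: "disk_type ?S (round_disk n 1) = (k, snd (disk_type ?S (round_disk n 2)))"
      "disk_type ?S (round_disk n 2) = (k, snd (disk_type ?S (round_disk n 2)))"
      using radial_types_agree[OF sh] by (auto simp: prod_eq_iff cards k[symmetric]) (simp_all add: k)
    define \<epsilon> where "\<epsilon> = snd (disk_type ?S (round_disk n 2))"
    have out: "output_space P ?S = shaded_spaces P k \<epsilon>"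
      by (simp only: output_space_def ins shaded_disk_space_eq cards \<epsilon>_def shaded_tangle.select_convs) (simp add: k)
    have "from_plus \<Phi> (k, \<epsilon>) v \<in> output_space P ?S"
      using from_plus_linear vP unfolding out linear_into_def by blast
    then have "shaded_action P ?S [from_plus \<Phi> (k, \<epsilon>) v] = from_plus \<Phi> (k, \<epsilon>) v"
      by (intro shaded_radial[OF sh]) (simp_all add: k)
    then have "transported_action P \<Phi> ?T B [v] = v"
      unfolding transported_action_def ins using ty to_from_plus[OF vP, of \<epsilon>] by (simp add: \<epsilon>_def)
    moreover have "[v] \<in> listset (map (disk_space Q) (ins ?T))"
      using v by (simp add: ins disk_space_def cards set_Cons_def)
    ultimately show ?thesis using action_eq[OF ev B] by simp
  qed
qed

lemma unshading_planar_algebra: "unshaded_planar_algebra sc Q"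
  unfolding unshaded_planar_algebra_def
  using vector_space_axioms unshading_subspace unshading_multilinear unshading_isotopy
    unshading_composition unshading_radial by blast

lemma reshading_iso: "shaded_iso sc P (reshading Q) (\<lambda>n \<epsilon>. to_plus \<Phi> (n, \<epsilon>))"
  unfolding shaded_iso_def
proof (intro conjI allI impI ballI)
  fix n \<epsilon>
  have sp: "shaded_spaces (reshading Q) n \<epsilon> = shaded_spaces P n Plus" by (simp add: reshading_def unshading_def)
  have "bij_betw (to_plus \<Phi> (n, \<epsilon>)) (shaded_spaces P n \<epsilon>) (shaded_spaces P n Plus)"
    by (rule bij_betw_byWitness[where f' = "from_plus \<Phi> (n, \<epsilon>)"])
      (use from_to_plus to_from_plus from_plus_linear to_plus_linear in \<open>auto simp: linear_into_def Pi_iff\<close>)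
  then show "linear_iso_on sc (shaded_spaces P n \<epsilon>) (shaded_spaces (reshading Q) n \<epsilon>) (to_plus \<Phi> (n, \<epsilon>))"
    using to_plus_linear[of n \<epsilon>] unfolding linear_iso_on_def sp linear_into_def by blast
next
  fix S :: shaded_tangle and vs assume sh: "is_shaded_tangle S" and vs: "vs \<in> listset (input_spaces P S)"
  define T where "T = tangle_of S"
  have S: "S = shaded T (shade S)" by (simp add: T_def)
  have ev: "even_tangle T" using sh unfolding is_shaded_tangle_def even_tangle_def T_def by blast
  have B: "alternating T (shade S)" using even_tangle_shaded[OF ev] sh S by metis
  have pair: "(case t of (n, \<epsilon>) \<Rightarrow> to_plus \<Phi> (n, \<epsilon>)) = to_plus \<Phi> t" for t by (cases t) simp
  have l: "length vs = length (ins T)" using vs by (simp add: listset_iff_nth input_spaces_def T_def)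
  have vi: "vs ! i \<in> shaded_disk_space P S (ins T ! i)" if "i < length (ins T)" for i
    using vs that by (simp add: listset_iff_nth input_spaces_def T_def)
  define us where "us = map2 (\<lambda>d. to_plus \<Phi> (disk_type S d)) (ins T) vs"
  have "us ! i \<in> disk_space Q (ins T ! i)" if "i < length (ins T)" for i
    using to_plus_disk[OF even_tangleD(1)[OF ev], of "ins T ! i" S] vi[OF that] that l
    unfolding us_def linear_into_def by (auto simp: disks_def)
  then have us: "us \<in> listset (map (disk_space Q) (ins T))"
    using l by (simp add: listset_iff_nth us_def)
  have "map2 (\<lambda>d. from_plus \<Phi> (disk_type S d)) (ins T) us = vs"
    by (rule nth_equalityI) (use l vi in \<open>auto simp: us_def from_to_plus_disk\<close>)
  then have "action Q T us = to_plus \<Phi> (disk_type S (out T)) (shaded_action P S vs)"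
    using action_eq[OF ev B us] S[symmetric] by (simp add: transported_action_def)
  then show "(case disk_type S (out (tangle_of S)) of (n, \<epsilon>) \<Rightarrow> to_plus \<Phi> (n, \<epsilon>)) (shaded_action P S vs) =
     shaded_action (reshading Q) S
      (map2 (\<lambda>d v. (case disk_type S d of (n, \<epsilon>) \<Rightarrow> to_plus \<Phi> (n, \<epsilon>)) v) (ins (tangle_of S)) vs)"
    unfolding pair by (simp add: reshading_def us_def T_def)
qed

end

theorem theorem1:
  fixes sc :: "complex \<Rightarrow> 'a::ab_group_add \<Rightarrow> 'a"
    and P :: "'a shaded_data"
    and \<Phi> :: "nat \<Rightarrow> sign \<Rightarrow> 'a \<Rightarrow> 'a"
  assumes "shaded_planar_algebra sc P"
    and "symmetric_self_duality sc P \<Phi>"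
  shows "\<exists>Q :: 'a unshaded_data.
           unshaded_planar_algebra sc Q \<and>
           (\<forall>n. spaces Q (2 * n + 1) = {0}) \<and>
           (\<exists>\<Psi>. shaded_iso sc P (reshading Q) \<Psi>)"
proof -
  interpret self_dual sc P \<Phi> by unfold_locales (fact assms)+
  have "spaces (unshading P \<Phi>) (2 * n + 1) = {0}" for n by (simp add: unshading_def)
  then show ?thesis using unshading_planar_algebra reshading_iso by blast
qed

end
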